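(* Let $\gamma\in(0,1]$ and let $\{\breve x^k\},\{\widetilde x^k\},\{\bar x^k\},\{\lambda^k\}$ be generated, for $k\ge0$, by Algorithm 4 (given in the context). Define $$\widetilde\lambda^k:=\lambda^k-\tau^k\beta^k\Big(A_1\widetilde x_1^k+\sum_{j=2}^mA_j\bar x_j^k-b\Big),$$ $\widetilde u^k=(\widetilde x_1^k,\dots,\widetilde x_m^k,\widetilde\lambda^k)$, $v^k=(A_2\bar x_2^k,\dots,A_m\bar x_m^k,\lambda^k)$, $\widetilde v^k=(A_2\widetilde x_2^k,\dots,A_m\widetilde x_m^k,\widetilde\lambda^k)$, and let $Q^k,M^k$ be the matrices defined in the context. The following hold. (i) Suppose $\beta^k=\beta/\tau^k$ for some $\beta>0$ and $1/\tau^{k-1}=(1-\tau^k)/\tau^k$ for $k\ge0$, $\tau^{-1}\in(0,1)$. Then for all $k\ge0$, with $c^k=(1-\gamma)(1-\tau^k)\beta^k$, $$\frac{1}{\tau^k}[f(x)-f(\breve x^k)]-\frac{1}{\tau^{k-1}}[f(x)-f(\breve x^{k-1})]+(u-\widetilde u^k)^TF(\widetilde u^k)+c^k(A(x-\widetilde x^k))^T(A\breve x^{k-1}-b)\ge (v-\widetilde v^k)^TQ^k(v^k-\widetilde v^k)\quad\forall u,$$ and $v^{k+1}=v^k-M^k(v^k-\widetilde v^k)$. Moreover there are matrices $H^k$ with $Q^k=H^kM^k$ such that, with $G^k:=(Q^k)^T+Q^k-(M^k)^TH^kM^k$, $H_0^k=\frac1\gamma\begin{pmatrix}\beta JJ^T&0\\0&\frac1\beta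 I_l\end{pmatrix}$ and some $\varTheta^k\ge0$ satisfying $\varTheta^{k+1}-\varTheta^k\ge(1-\gamma)\tau^k\beta^k\|A\widetilde x^k-b\|^2$, $$\|v^{k+1}-v'\|^2_{H^k}-\|v^k-v'\|^2_{H^k}+\|v^k-\widetilde v^k\|^2_{G^k}\ge\|v^{k+1}-v'\|^2_{H_0^{k+1}}-\|v^k-v'\|^2_{H_0^k}+\varTheta^{k+1}-\varTheta^k$$ for all $v'=(A_2x_2',\dots,A_mx_m',\lambda)$ with $x'\in\Omega$, $\lambda\in\mathbb{R}^l$. (ii) Suppose $f_m$ is $L$-gradient Lipschitz continuous, $\beta^k\equiv\beta>0$, $(1-\gamma)\beta\le1$, $\tau^k>0$, $1/(\tau^{k-1})^2=(1-\tau^k)/(\tau^k)^2$ for $k\ge0$, $\tau^{-1}\in(0,1)$, and $$\frac1{\beta(\tau^k)^2}+\frac{\sigma''}{\tau^k}\ge\frac1{\beta(\tau^{k+1})^2}+\frac{\sigma''(1-\gamma)}{\tau^{k+1}},\qquad \sigma''=\sigma'-\frac{\sigma'^2}{\sigma'+1},\quad\sigma'=\frac{\sigma_{\min}(A_mA_m^T)}{L}.$$ Then for all $k\ge0$, with $c^k=(1-\gamma)(1-\tau^k)\beta^k/\tau^k$, $\sigma=1/L$, $R=I_{n_m}$, $z=\nabla f_m(x_m)$, $z^k=\nabla f_m(\breve x_m^k)$, $$\frac{1}{(\tau^k)^2}[f(x)-f(\breve x^k)]-\frac{1}{(\tau^{k-1})^2}[f(x)-f(\breve x^{k-1})]+\frac1{\tau^k}(u-\widetilde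 u^k)^TF(\widetilde u^k)+c^k(A(x-\widetilde x^k))^T(A\breve x^{k-1}-b)$$ $$\ge\frac1{\tau^k}\Big[(v-\widetilde v^k)^TQ^k(v^k-\widetilde v^k)+\frac\sigma2\|z^k-z\|_R^2\Big]\quad\forall u,$$ and $v^{k+1}=v^k-M^k(v^k-\widetilde v^k)$. Moreover there are matrices $H^k$ with $Q^k=H^kM^k$ such that, with $G^k:=(Q^k)^T+Q^k-(M^k)^TH^kM^k$, $$H_0^k=\frac1\gamma\begin{pmatrix}\beta JJ^T&0\\0&\frac1{\beta(\tau^k)^2}I_l+\frac{\sigma''(1-\gamma)}{\tau^k}I_l\end{pmatrix}$$ and some $\varTheta^k\ge0$ satisfying $\varTheta^{k+1}-\varTheta^k\ge(1-\gamma)\beta^k\big(\|A\widetilde x^k-b\|^2-\frac{\tau^k}{(\tau^{k-1})^2}\|A\breve x^{k-1}-b\|^2\big)$, $$\frac1{\tau^k}\Big(\|v^{k+1}-v'\|^2_{H^k}+\sigma\|z^k-z'\|_R^2-\|v^k-v'\|^2_{H^k}+\|v^k-\widetilde v^k\|^2_{G^k}\Big)\ge\|v^{k+1}-v'\|^2_{H_0^{k+1}}-\|v^k-v'\|^2_{H_0^k}+\varTheta^{k+1}-\varTheta^k$$ in the special setting $z'=\nabla f_m(x_m^* )$ and $v'=v^*=(A_2x_2^*,\dots,A_mx_m^*,\lambda^* )$, where $(x^*,\lambda^* )$ is a saddle point of the Lagrangian.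
   Context: Problem (P3): minimize $f(x)=\sum_{i=1}^mf_i(x_i)$ subject to $Ax:=\sum_{i=1}^mA_ix_i=b$, $m\ge2$, $f_i:\mathbb{R}^{n_i}\to\mathbb{R}$ closed proper convex, $A_i\in\mathbb{R}^{l\times n_i}$, $b\in\mathbb{R}^l$, $\Omega=\{x:Ax=b\}$. A saddle point $(x^*,\lambda^* )$ of $L(x,\lambda)=f(x)-\lambda^T(Ax-b)$ satisfies $L(x^*,\lambda)\le L(x^*,\lambda^* )\le L(x,\lambda^* )$ for all $x,\lambda$. $u=(x_1,\dots,x_m,\lambda)$, $v=(A_2x_2,\dots,A_mx_m,\lambda)$, $F(u)=(-A_1^T\lambda,\dots,-A_m^T\lambda,Ax-b)$. $\|w\|_D^2:=w^TDw$; $\sigma_{\min}$ denotes smallest eigenvalue. A function $g$ is $L$-gradient Lipschitz continuous ($L>0$) if it is differentiable and $g(y)\le g(x)+\langle\nabla g(x),y-x\rangle+\frac L2\|y-x\|^2$ for all $x,y$ (for convex $g$, equivalently $g(y)\ge g(x)+\langle\nabla g(x),y-x\rangle+\frac1{2L}\|\nabla g(x)-\nabla g(y)\|^2$). Let $\beta^k>0$ and $\varphi^k(x_1,\dots,x_m,\lambda):=-\lambda^T(\sum_iA_ix_i-b)+\frac{\beta^k}2\|\sum_iA_ix_i-b\|^2$. Matrices: $J\in\mathbb{R}^{(m-1)l\times(m-1)l}$ is the block lower triangular matrix whose $(i,j)$ block is $I_l$ for $i\ge j$ and $0$ for $i<j$; $\widetilde I=(I_l,\dots,I_l)\in\mathbb{R}^{l\times(m-1)l}$;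 $P^k=\begin{pmatrix}\sqrt{\tau^k\beta^k}J&0\\0&\frac1{\sqrt{\tau^k\beta^k}}I_l\end{pmatrix}$, $N^k=\gamma\begin{pmatrix}\sqrt{\tau^k\beta^k}I_{(m-1)l}&0\\-\sqrt{\tau^k\beta^k}\widetilde I&\frac1{\sqrt{\tau^k\beta^k}}I_l\end{pmatrix}$, $Q^k=\begin{pmatrix}\tau^k\beta^kJ&0\\-\widetilde I&\frac1{\tau^k\beta^k}I_l\end{pmatrix}$, $M^k=(P^k)^{-T}N^k$. Algorithm 4 (given $\breve x^{-1},\bar x^0,\lambda^0$; minimizers are assumed to exist): for $k\ge0$, - $\hat\lambda^k=\lambda^k+\gamma(1-\tau^k)\beta^k(A\breve x^{k-1}-b)$; - $\hat x^k=(1-\tau^k)\breve x^{k-1}+\tau^k\bar x^k$; - $\breve x_1^k\in\arg\min_{x_1}\{f_1(x_1)+x_1^T\nabla_{x_1}\varphi^k(\hat x_1^k,\dots,\hat x_m^k,\hat\lambda^k)+\frac{\beta^k}2\|x_1-\hat x_1^k\|^2_{A_1^TA_1}\}$; - for $j=2,\dots,m$: $\breve x_j^k\in\arg\min_{x_j}\{f_j(x_j)+x_j^T\nabla_{x_j}\varphi^k(\breve x_1^k,\dots,\breve x_{j-1}^k,\hat x_j^k,\dots,\hat x_m^k,\hat\lambda^k)+\frac{\beta^k}2\|x_j-\hat x_j^k\|^2_{A_j^TA_j}\}$; - $\widetilde x^k=\breve x^k/\tau^k-(1-\tau^k)\breve x^{k-1}/\tau^k$; - $\bar x^{k+1}$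 satisfies $\bar x_1^{k+1}=\bar x_1^k$ and $(A_j\bar x_j^{k+1})_{j=2}^m=(A_j\bar x_j^k)_{j=2}^m-\gamma J^{-T}\big(A_j\bar x_j^k-A_j\widetilde x_j^k\big)_{j=2}^m$ (block column vectors in $\mathbb{R}^{(m-1)l}$); - $\lambda^{k+1}=\lambda^k-\gamma\tau^k\beta^k(A\widetilde x^k-b)$. *)

theory Defs
  imports
    "Jordan_Normal_Form.Char_Poly"
    "Jordan_Normal_Form.Gauss_Jordan_Elimination"
begin

section \<open>Convexity and differentiability on \<open>\<real>\<^sup>n\<close>\<close>

text \<open>The block dimensions \<open>n\<^sub>1, \<dots>, n\<^sub>m\<close> are arbitrary and depend on the block index, so
  \<open>\<real>\<^sup>n\<close> is \<^term>\<open>carrier_vec n :: real vec set\<close>. The type of vectors of all dimensions is not a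
  normed space, hence the notions of this section are spelled out relative to the carrier.\<close>

definition vnorm :: "real vec \<Rightarrow> real" where
  "vnorm x = sqrt (x \<bullet> x)"

definition sqnorm_wrt :: "real mat \<Rightarrow> real vec \<Rightarrow> real" where
  "sqnorm_wrt D w = w \<bullet> (D *\<^sub>v w)"

definition convex_fun :: "nat \<Rightarrow> (real vec \<Rightarrow> real) \<Rightarrow> bool" where
  "convex_fun n g \<longleftrightarrow>
     (\<forall>x\<in>carrier_vec n. \<forall>y\<in>carrier_vec n. \<forall>t. 0 \<le> t \<and> t \<le> 1 \<longrightarrow>
        g ((1 - t) \<cdot>\<^sub>v x + t \<cdot>\<^sub>v y) \<le> (1 - t) * g x + t * g y)"

text \<open>The epigraph is sequentially closed in \<open>\<real>\<^sup>n \<times> \<real>\<close>.\<close>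

definition closed_fun :: "nat \<Rightarrow> (real vec \<Rightarrow> real) \<Rightarrow> bool" where
  "closed_fun n g \<longleftrightarrow>
     (\<forall>X T x t. (\<forall>i::nat. X i \<in> carrier_vec n \<and> g (X i) \<le> T i) \<longrightarrow> x \<in> carrier_vec n \<longrightarrow>
        (\<lambda>i. vnorm (X i - x)) \<longlonglongrightarrow> 0 \<longrightarrow> T \<longlonglongrightarrow> t \<longrightarrow> g x \<le> t)"

text \<open>Frechet gradients.\<close>

definition has_gradient :: "nat \<Rightarrow> (real vec \<Rightarrow> real) \<Rightarrow> real vec \<Rightarrow> real vec \<Rightarrow> bool" where
  "has_gradient n g d x \<longleftrightarrow> d \<in> carrier_vec n \<and>
     (\<forall>e>0. \<exists>\<delta>>0. \<forall>y\<in>carrier_vec n. vnorm (y - x) < \<delta> \<longrightarrow>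
        \<bar>g y - g x - d \<bullet> (y - x)\<bar> \<le> e * vnorm (y - x))"

definition gradient :: "nat \<Rightarrow> (real vec \<Rightarrow> real) \<Rightarrow> real vec \<Rightarrow> real vec" where
  "gradient n g x = (THE d. has_gradient n g d x)"

definition gradient_Lipschitz :: "nat \<Rightarrow> (real vec \<Rightarrow> real) \<Rightarrow> real \<Rightarrow> bool" where
  "gradient_Lipschitz n g L \<longleftrightarrow> L > 0 \<and>
     (\<forall>x\<in>carrier_vec n. \<exists>d. has_gradient n g d x) \<and>
     (\<forall>x\<in>carrier_vec n. \<forall>y\<in>carrier_vec n.
        g y \<le> g x + gradient n g x \<bullet> (y - x) + L / 2 * (vnorm (y - x))\<^sup>2)"

text \<open>Smallest (real) eigenvalue; used for symmetric matrices of positive size.\<close>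

definition sigma_min :: "real mat \<Rightarrow> real" where
  "sigma_min D = Min {e. eigenvalue D e}"

definition minv :: "real mat \<Rightarrow> real mat" where
  "minv D = the (mat_inverse D)"


section \<open>The separable problem\<close>

text \<open>A point \<open>x = (x\<^sub>1, \<dots>, x\<^sub>m)\<close> is a function on block indices; only its values on
  \<open>{1..m}\<close> are ever used.\<close>

type_synonym blocks = "nat \<Rightarrow> real vec"

definition block_space :: "nat \<Rightarrow> (nat \<Rightarrow> nat) \<Rightarrow> blocks set" where
  "block_space m n = {x. \<forall>i\<in>{1..m}. x i \<in> carrier_vec (n i)}"

definition A_sum :: "nat \<Rightarrow> (nat \<Rightarrow> real mat) \<Rightarrow> nat set \<Rightarrow> blocks \<Rightarrow> real vec" where
  "A_sum l A I x = finsum_vec TYPE(real) l (\<lambda>i. A i *\<^sub>v x i) I"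

abbreviation A_op :: "nat \<Rightarrow> nat \<Rightarrow> (nat \<Rightarrow> real mat) \<Rightarrow> blocks \<Rightarrow> real vec" where
  "A_op m l A x \<equiv> A_sum l A {1..m} x"

definition residual :: "nat \<Rightarrow> nat \<Rightarrow> (nat \<Rightarrow> real mat) \<Rightarrow> real vec \<Rightarrow> blocks \<Rightarrow> real vec" where
  "residual m l A b x = A_op m l A x - b"

definition objective :: "nat \<Rightarrow> (nat \<Rightarrow> real vec \<Rightarrow> real) \<Rightarrow> blocks \<Rightarrow> real" where
  "objective m f x = (\<Sum>i=1..m. f i (x i))"

text \<open>The \<open>f\<^sub>i\<close> are finite on their whole space, so properness holds automatically.\<close>

definition problem_P3 ::
  "nat \<Rightarrow> nat \<Rightarrow> (nat \<Rightarrow> nat) \<Rightarrow> (nat \<Rightarrow> real vec \<Rightarrow> real) \<Rightarrow> (nat \<Rightarrow> real mat) \<Rightarrow> real vec \<Rightarrow> bool" where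
  "problem_P3 m l n f A b \<longleftrightarrow> m \<ge> 2 \<and> l > 0 \<and> b \<in> carrier_vec l \<and>
     (\<forall>i\<in>{1..m}. A i \<in> carrier_mat l (n i) \<and> closed_fun (n i) (f i) \<and> convex_fun (n i) (f i))"

definition feasible_set ::
  "nat \<Rightarrow> nat \<Rightarrow> (nat \<Rightarrow> nat) \<Rightarrow> (nat \<Rightarrow> real mat) \<Rightarrow> real vec \<Rightarrow> blocks set" where
  "feasible_set m l n A b = {x \<in> block_space m n. A_op m l A x = b}"

definition lagrangian ::
  "nat \<Rightarrow> nat \<Rightarrow> (nat \<Rightarrow> real vec \<Rightarrow> real) \<Rightarrow> (nat \<Rightarrow> real mat) \<Rightarrow> real vec \<Rightarrow> blocks \<Rightarrow> real vec \<Rightarrow> real"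
where
  "lagrangian m l f A b x lam = objective m f x - lam \<bullet> residual m l A b x"

definition saddle_point ::
  "nat \<Rightarrow> nat \<Rightarrow> (nat \<Rightarrow> nat) \<Rightarrow> (nat \<Rightarrow> real vec \<Rightarrow> real) \<Rightarrow> (nat \<Rightarrow> real mat) \<Rightarrow> real vec \<Rightarrow>
   blocks \<Rightarrow> real vec \<Rightarrow> bool" where
  "saddle_point m l n f A b xs lams \<longleftrightarrow> xs \<in> block_space m n \<and> lams \<in> carrier_vec l \<and>
     (\<forall>lam\<in>carrier_vec l. lagrangian m l f A b xs lam \<le> lagrangian m l f A b xs lams) \<and>
     (\<forall>x\<in>block_space m n. lagrangian m l f A b xs lams \<le> lagrangian m l f A b x lams)"

text \<open>\<open>u = (x\<^sub>1, \<dots>, x\<^sub>m, \<lambda>)\<close> is a pair of a block point and a multiplier, with the Euclidean inner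
  product of the product space.\<close>

type_synonym primal_dual = "blocks \<times> real vec"

definition u_diff :: "primal_dual \<Rightarrow> primal_dual \<Rightarrow> primal_dual" where
  "u_diff u w = ((\<lambda>i. fst u i - fst w i), snd u - snd w)"

definition u_inner :: "nat \<Rightarrow> primal_dual \<Rightarrow> primal_dual \<Rightarrow> real" where
  "u_inner m u w = (\<Sum>i=1..m. fst u i \<bullet> fst w i) + snd u \<bullet> snd w"

definition F_op :: "nat \<Rightarrow> nat \<Rightarrow> (nat \<Rightarrow> real mat) \<Rightarrow> real vec \<Rightarrow> primal_dual \<Rightarrow> primal_dual" where
  "F_op m l A b u = ((\<lambda>i. - (transpose_mat (A i) *\<^sub>v snd u)), residual m l A b (fst u))"

text \<open>The column \<open>(w\<^sub>2, \<dots>, w\<^sub>m)\<close> of vectors in \<open>\<real>\<^sup>l\<close>; position \<open>r\<close> lies in the (zero-based) block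
  \<open>r div l\<close>, which holds \<open>w\<close> of index \<open>r div l + 2\<close>.\<close>

definition stack :: "nat \<Rightarrow> nat \<Rightarrow> blocks \<Rightarrow> real vec" where
  "stack m l w = vec ((m - 1) * l) (\<lambda>r. w (r div l + 2) $ (r mod l))"

definition v_vec :: "nat \<Rightarrow> nat \<Rightarrow> (nat \<Rightarrow> real mat) \<Rightarrow> blocks \<Rightarrow> real vec \<Rightarrow> real vec" where
  "v_vec m l A x lam = stack m l (\<lambda>j. A j *\<^sub>v x j) @\<^sub>v lam"


section \<open>The matrices\<close>

definition J_mat :: "nat \<Rightarrow> nat \<Rightarrow> real mat" where
  "J_mat m l = mat ((m - 1) * l) ((m - 1) * l)
     (\<lambda>(r, c). if r mod l = c mod l \<and> r div l \<ge> c div l then 1 else 0)"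

definition I_row :: "nat \<Rightarrow> nat \<Rightarrow> real mat" where
  "I_row m l = mat l ((m - 1) * l) (\<lambda>(r, c). if r = c mod l then 1 else 0)"

text \<open>In the matrices below the argument \<open>t\<close> stands for \<open>\<tau>\<^sup>k \<beta>\<^sup>k\<close>.\<close>

definition P_mat :: "nat \<Rightarrow> nat \<Rightarrow> real \<Rightarrow> real mat" where
  "P_mat m l t = four_block_mat
     (sqrt t \<cdot>\<^sub>m J_mat m l)      (0\<^sub>m ((m - 1) * l) l)
     (0\<^sub>m l ((m - 1) * l))       ((1 / sqrt t) \<cdot>\<^sub>m 1\<^sub>m l)"

definition N_mat :: "nat \<Rightarrow> nat \<Rightarrow> real \<Rightarrow> real \<Rightarrow> real mat" where
  "N_mat m l \<gamma> t = \<gamma> \<cdot>\<^sub>m four_block_mat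
     (sqrt t \<cdot>\<^sub>m 1\<^sub>m ((m - 1) * l))  (0\<^sub>m ((m - 1) * l) l)
     ((- sqrt t) \<cdot>\<^sub>m I_row m l)    ((1 / sqrt t) \<cdot>\<^sub>m 1\<^sub>m l)"

definition Q_mat :: "nat \<Rightarrow> nat \<Rightarrow> real \<Rightarrow> real mat" where
  "Q_mat m l t = four_block_mat
     (t \<cdot>\<^sub>m J_mat m l)   (0\<^sub>m ((m - 1) * l) l)
     (- I_row m l)      ((1 / t) \<cdot>\<^sub>m 1\<^sub>m l)"

definition M_mat :: "nat \<Rightarrow> nat \<Rightarrow> real \<Rightarrow> real \<Rightarrow> real mat" where
  "M_mat m l \<gamma> t = minv (transpose_mat (P_mat m l t)) * N_mat m l \<gamma> t"

definition G_mat :: "real mat \<Rightarrow> real mat \<Rightarrow> real mat \<Rightarrow> real mat" where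
  "G_mat Q M H = transpose_mat Q + Q - transpose_mat M * H * M"

text \<open>\<open>1/\<gamma>\<close> times the block diagonal matrix with blocks \<open>\<beta> J J\<^sup>T\<close> and \<open>a I\<^sub>l\<close>.\<close>

definition H0_mat :: "nat \<Rightarrow> nat \<Rightarrow> real \<Rightarrow> real \<Rightarrow> real \<Rightarrow> real mat" where
  "H0_mat m l \<gamma> \<beta> a = (1 / \<gamma>) \<cdot>\<^sub>m four_block_mat
     (\<beta> \<cdot>\<^sub>m (J_mat m l * transpose_mat (J_mat m l)))  (0\<^sub>m ((m - 1) * l) l)
     (0\<^sub>m l ((m - 1) * l))                          (a \<cdot>\<^sub>m 1\<^sub>m l)"


section \<open>The algorithm\<close>

definition phi ::
  "nat \<Rightarrow> nat \<Rightarrow> (nat \<Rightarrow> real mat) \<Rightarrow> real vec \<Rightarrow> real \<Rightarrow> blocks \<Rightarrow> real vec \<Rightarrow> real" where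
  "phi m l A b \<beta> x lam =
     - (lam \<bullet> residual m l A b x) + \<beta> / 2 * (vnorm (residual m l A b x))\<^sup>2"

definition partial_gradient_phi ::
  "nat \<Rightarrow> nat \<Rightarrow> (nat \<Rightarrow> nat) \<Rightarrow> (nat \<Rightarrow> real mat) \<Rightarrow> real vec \<Rightarrow> real \<Rightarrow> nat \<Rightarrow> blocks \<Rightarrow> real vec \<Rightarrow> real vec"
where
  "partial_gradient_phi m l n A b \<beta> j x lam =
     gradient (n j) (\<lambda>y. phi m l A b \<beta> (x(j := y)) lam) (x j)"

text \<open>Iterations are indexed by integers, as \<open>\<tau>\<close> and the first primal sequence start at index \<open>-1\<close>.
  The sequences \<open>xbr\<close>, \<open>xt\<close>, \<open>xba\<close> are the primal iterates written with a breve, a tilde and a bar.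
  In the subproblem for block \<open>j\<close> the linearization point has the new blocks \<open>1, \<dots>, j - 1\<close> and the
  extrapolated blocks \<open>j, \<dots>, m\<close>; for \<open>j = 1\<close> no new block occurs.\<close>

definition algorithm4 ::
  "nat \<Rightarrow> nat \<Rightarrow> (nat \<Rightarrow> nat) \<Rightarrow> (nat \<Rightarrow> real vec \<Rightarrow> real) \<Rightarrow> (nat \<Rightarrow> real mat) \<Rightarrow> real vec \<Rightarrow>
   real \<Rightarrow> (int \<Rightarrow> real) \<Rightarrow> (int \<Rightarrow> real) \<Rightarrow>
   (int \<Rightarrow> blocks) \<Rightarrow> (int \<Rightarrow> blocks) \<Rightarrow> (int \<Rightarrow> blocks) \<Rightarrow> (int \<Rightarrow> real vec) \<Rightarrow> bool" where
  "algorithm4 m l n f A b \<gamma> \<tau> \<beta> xbr xt xba lam \<longleftrightarrow>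
     xbr (- 1) \<in> block_space m n \<and> xba 0 \<in> block_space m n \<and> lam 0 \<in> carrier_vec l \<and>
     (\<forall>k\<ge>0.
        xbr k \<in> block_space m n \<and> xba (k + 1) \<in> block_space m n \<and> \<beta> k > 0 \<and>
        (let lamh = lam k + (\<gamma> * (1 - \<tau> k) * \<beta> k) \<cdot>\<^sub>v residual m l A b (xbr (k - 1));
             xh = (\<lambda>i. (1 - \<tau> k) \<cdot>\<^sub>v xbr (k - 1) i + \<tau> k \<cdot>\<^sub>v xba k i)
         in \<forall>j\<in>{1..m}.
              is_arg_min
                (\<lambda>y. f j y
                   + y \<bullet> partial_gradient_phi m l n A b (\<beta> k) j
                         (\<lambda>i. if i < j then xbr k i else xh i) lamh
                   + \<beta> k / 2 * sqnorm_wrt (transpose_mat (A j) * A j) (y - xh j))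
                (\<lambda>y. y \<in> carrier_vec (n j))
                (xbr k j)) \<and>
        (\<forall>i\<in>{1..m}.
           xt k i = (1 / \<tau> k) \<cdot>\<^sub>v xbr k i - ((1 - \<tau> k) / \<tau> k) \<cdot>\<^sub>v xbr (k - 1) i) \<and>
        xba (k + 1) 1 = xba k 1 \<and>
        stack m l (\<lambda>j. A j *\<^sub>v xba (k + 1) j) =
          stack m l (\<lambda>j. A j *\<^sub>v xba k j)
          - \<gamma> \<cdot>\<^sub>v (minv (transpose_mat (J_mat m l)) *\<^sub>v
                  stack m l (\<lambda>j. A j *\<^sub>v xba k j - A j *\<^sub>v xt k j)) \<and>
        lam (k + 1) = lam k - (\<gamma> * \<tau> k * \<beta> k) \<cdot>\<^sub>v residual m l A b (xt k))"

end

(*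
  Write r^k = A xbr^k - b, w^k = A xt^k - b, y_k = 1 / tau^k, t = tau^k beta^k, c' = (1 - gamma) (1 - tau^k) beta^k.
  The optimality condition of block j is a variational inequality with the multiplier
  s_j = c' r^(k-1) - lamt^k - t (sum of A_i (xba_i - xt_i) over i = 2..j). Testing it with
  (1 - tau) xbr^(k-1) + tau x, using convexity and summing over j gives the first inequality; in (ii)
  the optimality condition of block m reads z^k = - A_m^T s_m, and cocoercivity of the gradient of f_m adds
  the extra term. As Q = P N / gamma, the matrix H = P P^T / gamma satisfies Q = H M; the left hand side of the
  last inequality in (i) telescopes to 2 (v' - vt)^T Q (v - vt), and the G-norm of v - vt is at least
  (1 - gamma) t |w^k|^2.

  In (ii) the increments of Theta are taken to be exactly their lower bound L_k. With p = lam^k - t w^k - lam*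
  and q = c' r^(k-1), z^k - z* = A_m^T (p - q), so the inequality follows from
  sigma' |p - q|^2 + |q|^2 >= sigma'' |p|^2. To have Theta >= 0 the partial sums of L_k must be bounded
  below. If a saddle point exists, the first inequality at the saddle point makes
  2 y_(k-1)^2 (Lagrangian gap) + (1 - gamma) beta y_(k-1)^2 |r^(k-1)|^2 + |v^k - v*|^2_(H0^k)
  decrease by at least U_k - L_k, where U_k is the largest admissible increment. The slack in the
  hypothesis on tau grows linearly in y_k, so the sum of y_k |lam^k - lam*|^2 converges, hence so does that of
  y_k |p|^2, and with it the negative part (1 - gamma) beta (y_k - 1) |r^(k-1)|^2 of L_k is summable.
*)
theory Submission
  imports Defs
begin

text \<open>In (i) t is constant, so H^k and H_0^k coincide. In (ii) t = tau^k beta, and y_k H^k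
  differs from H_0^k only by the sigma'' part of the multiplier block; this part and the step from
  y_k^2 to y_(k+1)^2 are paid for by the gradient term and the hypothesis on tau. At a saddle point
  the gradient term dominates sigma' |p - q|^2; the parallel sum of sigma' and 1 is the best
  multiple of |p|^2 that holds whatever q is, whence sigma''. The term |q|^2 is paid for by the
  negative part of L_k, and this needs (1 - gamma) beta <= 1. The obstacle is that L_k has no sign,
  while one nonnegative Theta must serve all saddle points. The lower bound for U_k - L_k is
  therefore read twice: keeping the slack of the hypothesis on tau controls the multipliers, and
  keeping the residual term then controls the residuals. By y_k^2 = y_(k-1)^2 + y_k the slack equals
  y_(k+1) times gamma sigma'' - 1/beta - sigma''/(y_(k+1) + y_k), so its sign at k = 0 decides its
  growth.\<close>

section \<open>Inner products, norms and Cauchy-Schwarz for real vectors\<close>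

lemma scalar_prod_add_left_dim:
  "dim_vec a = dim_vec c \<Longrightarrow> dim_vec b = dim_vec c \<Longrightarrow> (a + b) \<bullet> (c :: real vec) = a \<bullet> c + b \<bullet> c"
  by (rule add_scalar_prod_distrib[of _ "dim_vec c"]) (auto intro: carrier_vecI)

lemma scalar_prod_add_right_dim:
  "dim_vec a = dim_vec c \<Longrightarrow> dim_vec b = dim_vec c \<Longrightarrow> (c :: real vec) \<bullet> (a + b) = c \<bullet> a + c \<bullet> b"
  by (rule scalar_prod_add_distrib[of _ "dim_vec c"]) (auto intro: carrier_vecI)

lemma scalar_prod_minus_left_dim:
  "dim_vec a = dim_vec c \<Longrightarrow> dim_vec b = dim_vec c \<Longrightarrow> (a - b) \<bullet> (c :: real vec) = a \<bullet> c - b \<bullet> c"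
  by (rule minus_scalar_prod_distrib[of _ "dim_vec c"]) (auto intro: carrier_vecI)

lemma scalar_prod_minus_right_dim:
  "dim_vec a = dim_vec c \<Longrightarrow> dim_vec b = dim_vec c \<Longrightarrow> (c :: real vec) \<bullet> (a - b) = c \<bullet> a - c \<bullet> b"
  by (rule scalar_prod_minus_distrib[of _ "dim_vec c"]) (auto intro: carrier_vecI)

lemma scalar_prod_comm_dim:
  "dim_vec a = dim_vec c \<Longrightarrow> a \<bullet> (c :: real vec) = c \<bullet> a"
  by (rule comm_scalar_prod[of _ "dim_vec c"]) (auto intro: carrier_vecI)

text \<open>The dimension is read off from \<open>c\<close> and the side conditions are equations
  between dimensions, so these rules have no free dimension variable and rewrite unconditionally
  once the dimensions are known.\<close>

lemmas ip_simps = scalar_prod_add_left_dim scalar_prod_add_right_dim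
  scalar_prod_minus_left_dim scalar_prod_minus_right_dim

lemma scalar_prod_self_nonneg: "0 \<le> x \<bullet> (x :: real vec)"
  unfolding scalar_prod_def by (intro sum_nonneg) auto

lemma scalar_prod_self_eq_0:
  assumes "x \<in> carrier_vec n" "x \<bullet> (x :: real vec) = 0"
  shows "x = 0\<^sub>v n"
proof (rule eq_vecI)
  fix i assume i: "i < dim_vec (0\<^sub>v n :: real vec)"
  have "(\<Sum>i<n. x $ i * x $ i) = 0"
    using assms by (simp add: scalar_prod_def lessThan_atLeast0)
  then have "\<forall>i\<in>{..<n}. x $ i * x $ i = 0"
    by (subst (asm) sum_nonneg_eq_0_iff) auto
  with i show "x $ i = 0\<^sub>v n $ i" by simp
qed (use assms in simp)

lemma vnorm_nonneg: "0 \<le> vnorm x"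
  by (simp add: vnorm_def scalar_prod_self_nonneg)

lemma vnorm_sq: "(vnorm x)\<^sup>2 = x \<bullet> x"
  by (simp add: vnorm_def scalar_prod_self_nonneg)

lemma vnorm_smult: "vnorm (c \<cdot>\<^sub>v x) = \<bar>c\<bar> * vnorm x"
  by (simp add: vnorm_def real_sqrt_mult flip: mult.assoc power2_eq_square)

text \<open>A negative \<open>c\<close> is excluded by large \<open>s\<close>, \<open>c = 0\<close>
  forces \<open>b = 0\<close>, and for \<open>c > 0\<close> the value at the minimiser
  \<open>- b / c\<close> is the claim.\<close>

lemma quadratic_nonneg_imp_discriminant:
  fixes a b c :: real
  assumes "\<And>s. 0 \<le> a + 2 * s * b + s\<^sup>2 * c"
  shows "b\<^sup>2 \<le> a * c"
proof (cases "c = 0")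
  case True
  have "b = 0"
  proof (rule ccontr)
    assume "b \<noteq> 0"
    then show False
      using assms[of "- (a + 1) / (2 * b)"] True by (simp add: field_simps)
  qed
  with True show ?thesis by simp
next
  case False
  have "0 \<le> c"
  proof (rule ccontr)
    assume c: "\<not> 0 \<le> c"
    \<comment> \<open>Chosen so that \<open>s * c = c - \<bar>a\<bar> - 2 * \<bar>b\<bar>\<close>
      and \<open>s \<ge> 1\<close>; the quadratic is then at most \<open>c\<close>, which is
      negative.\<close>
    define s where "s = 1 + (\<bar>a\<bar> + 2 * \<bar>b\<bar>) / (- c)"
    have "(\<bar>a\<bar> + 2 * \<bar>b\<bar>) / (- c) \<ge> 0" using c by (intro divide_nonneg_pos) auto
    then have s1: "s \<ge> 1" by (simp add: s_def)
    have sc: "s * c = c - \<bar>a\<bar> - 2 * \<bar>b\<bar>" using c by (simp add: s_def field_simps)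
    have "a + 2 * s * b + s\<^sup>2 * c = a + s * (2 * b + s * c)"
      by (simp add: power2_eq_square algebra_simps)
    also have "\<dots> \<le> a + s * (c - \<bar>a\<bar>)"
      using s1 by (intro add_left_mono mult_left_mono) (auto simp: sc)
    also have "\<dots> \<le> a + 1 * (c - \<bar>a\<bar>)"
      using s1 c by (intro add_left_mono mult_right_mono_neg) auto
    also have "\<dots> < 0" using c by auto
    finally show False using assms[of s] by simp
  qed
  with False have c: "c > 0" by simp
  have "0 \<le> a + 2 * (- b / c) * b + (- b / c)\<^sup>2 * c" by (rule assms)
  also have "\<dots> = a - b\<^sup>2 / c" using c by (simp add: field_simps power2_eq_square)
  finally show ?thesis using c by (simp add: field_simps)
qed

text \<open>The form may be degenerate, so nothing is normalised; the discriminant of the form along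
  \<open>x + s y\<close> is used instead.\<close>

lemma psd_Cauchy_Schwarz:
  fixes S :: "real mat"
  assumes S: "S \<in> carrier_mat n n" and sym: "transpose_mat S = S"
    and psd: "\<And>x. x \<in> carrier_vec n \<Longrightarrow> 0 \<le> x \<bullet> (S *\<^sub>v x)"
    and x: "x \<in> carrier_vec n" and y: "y \<in> carrier_vec n"
  shows "(x \<bullet> (S *\<^sub>v y))\<^sup>2 \<le> (x \<bullet> (S *\<^sub>v x)) * (y \<bullet> (S *\<^sub>v y))"
proof (rule quadratic_nonneg_imp_discriminant)
  fix s :: real
  have yx: "y \<bullet> (S *\<^sub>v x) = x \<bullet> (S *\<^sub>v y)"
    using transpose_vec_mult_scalar[OF S x y] S x y sym
    by (simp add: comm_scalar_prod[of _ n])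
  have "0 \<le> (x + s \<cdot>\<^sub>v y) \<bullet> (S *\<^sub>v (x + s \<cdot>\<^sub>v y))" using x y by (intro psd) auto
  also have "S *\<^sub>v (x + s \<cdot>\<^sub>v y) = S *\<^sub>v x + s \<cdot>\<^sub>v (S *\<^sub>v y)"
    using S x y by (simp add: mult_add_distrib_mat_vec[OF S] mult_mat_vec[OF S])
  also have "(x + s \<cdot>\<^sub>v y) \<bullet> \<dots> = x \<bullet> (S *\<^sub>v x) + 2 * s * (x \<bullet> (S *\<^sub>v y)) + s\<^sup>2 * (y \<bullet> (S *\<^sub>v y))"
    using S x y yx
    by (simp add: ip_simps carrier_vecD carrier_matD power2_eq_square algebra_simps)
  finally show "0 \<le> x \<bullet> (S *\<^sub>v x) + 2 * s * (x \<bullet> (S *\<^sub>v y)) + s\<^sup>2 * (y \<bullet> (S *\<^sub>v y))" .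
qed

lemma Cauchy_Schwarz_vec:
  fixes x y :: "real vec"
  assumes "x \<in> carrier_vec n" "y \<in> carrier_vec n"
  shows "(x \<bullet> y)\<^sup>2 \<le> (x \<bullet> x) * (y \<bullet> y)"
  using psd_Cauchy_Schwarz[of "1\<^sub>m n" n x y] assms by (simp add: scalar_prod_self_nonneg)

text \<open>The constant is the squared Frobenius norm, by Cauchy-Schwarz in every row.\<close>

lemma mult_mat_vec_bounded:
  fixes A :: "real mat"
  assumes A: "A \<in> carrier_mat r n"
  shows "\<exists>C\<ge>0. \<forall>x\<in>carrier_vec n. (A *\<^sub>v x) \<bullet> (A *\<^sub>v x) \<le> C * (x \<bullet> x)"
proof (intro exI[of _ "\<Sum>i<r. row A i \<bullet> row A i"] conjI ballI)
  show "0 \<le> (\<Sum>i<r. row A i \<bullet> row A i)" by (intro sum_nonneg scalar_prod_self_nonneg)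
  fix x :: "real vec" assume x: "x \<in> carrier_vec n"
  have "(A *\<^sub>v x) \<bullet> (A *\<^sub>v x) = (\<Sum>i<r. (row A i \<bullet> x)\<^sup>2)"
    using A by (simp add: scalar_prod_def[of "A *\<^sub>v x"] lessThan_atLeast0 power2_eq_square)
  also have "\<dots> \<le> (\<Sum>i<r. (row A i \<bullet> row A i) * (x \<bullet> x))"
    using A x by (intro sum_mono Cauchy_Schwarz_vec[of _ n]) (auto simp: row_def)
  finally show "(A *\<^sub>v x) \<bullet> (A *\<^sub>v x) \<le> (\<Sum>i<r. row A i \<bullet> row A i) * (x \<bullet> x)"
    by (simp add: sum_distrib_right)
qed

lemma mat_vec_adjoint:
  fixes A :: "real mat"
  assumes "A \<in> carrier_mat r n" "x \<in> carrier_vec n" "y \<in> carrier_vec r"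
  shows "y \<bullet> (A *\<^sub>v x) = (transpose_mat A *\<^sub>v y) \<bullet> x"
  using transpose_vec_mult_scalar[OF assms] assms by (simp add: comm_scalar_prod[of _ r])

lemma smult_mat_mult_vec:
  fixes A :: "real mat"
  assumes A: "A \<in> carrier_mat r n" and x: "x \<in> carrier_vec n"
  shows "(a \<cdot>\<^sub>m A) *\<^sub>v x = a \<cdot>\<^sub>v (A *\<^sub>v x)"
  using A x by (intro eq_vecI) (auto simp: scalar_prod_def sum_distrib_left mult.assoc intro!: sum.cong)

section \<open>The Rayleigh quotient\<close>

text \<open>Cauchy-Schwarz for the form of \<open>S\<close>, applied to \<open>y\<close> and the
  preimage \<open>R y\<close> of \<open>y\<close>, bounds \<open>(y \<bullet> y)\<^sup>2\<close> by
  the form at \<open>y\<close> times \<open>(R y) \<bullet> y\<close>, and \<open>R\<close> is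
  bounded. Neither compactness nor diagonalisation is involved.\<close>

lemma pos_def_if_psd_nonsingular:
  fixes S :: "real mat"
  assumes S: "S \<in> carrier_mat n n" and sym: "transpose_mat S = S"
    and psd: "\<And>x. x \<in> carrier_vec n \<Longrightarrow> 0 \<le> x \<bullet> (S *\<^sub>v x)"
    and det: "det S \<noteq> 0"
  shows "\<exists>e>0. \<forall>x\<in>carrier_vec n. e * (x \<bullet> x) \<le> x \<bullet> (S *\<^sub>v x)"
proof -
  obtain R where R: "R \<in> carrier_mat n n" "S * R = 1\<^sub>m n"
    using det_non_zero_imp_unit[OF S det, of "()"] S
    by (auto simp: Units_def ring_mat_simps)
  obtain C where C: "0 \<le> C" "\<And>x. x \<in> carrier_vec n \<Longrightarrow> (R *\<^sub>v x) \<bullet> (R *\<^sub>v x) \<le> C * (x \<bullet> x)"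
    using mult_mat_vec_bounded[OF R(1)] by blast
  have "1 / (C + 1) * (y \<bullet> y) \<le> y \<bullet> (S *\<^sub>v y)" if y: "y \<in> carrier_vec n" for y
  proof (cases "y \<bullet> y = 0")
    case True
    then show ?thesis using psd[OF y] by simp
  next
    case False
    then have yp: "y \<bullet> y > 0" using scalar_prod_self_nonneg[of y] by simp
    have SR: "S *\<^sub>v (R *\<^sub>v y) = y"
      using assoc_mult_mat_vec[OF S R(1) y] R(2) y by simp
    have Ry: "R *\<^sub>v y \<in> carrier_vec n" using R y by simp
    have "((R *\<^sub>v y) \<bullet> y)\<^sup>2 \<le> (C * (y \<bullet> y)) * (y \<bullet> y)"
      using Cauchy_Schwarz_vec[OF Ry y] mult_right_mono[OF C(2)[OF y], of "y \<bullet> y"] yp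
      by linarith
    also have "\<dots> \<le> ((C + 1) * (y \<bullet> y))\<^sup>2"
    proof -
      \<comment> \<open>Passing from \<open>C\<close> to the square of \<open>C + 1\<close> makes
        the bound a perfect square, so that the root can be taken.\<close>
      have "C \<le> (C + 1)\<^sup>2" using C(1) by (simp add: power2_eq_square algebra_simps)
      from mult_right_mono[OF this, of "(y \<bullet> y)\<^sup>2"] show ?thesis
        by (simp add: power2_eq_square ac_simps)
    qed
    finally have q: "(R *\<^sub>v y) \<bullet> y \<le> (C + 1) * (y \<bullet> y)"
      by (rule power2_le_imp_le) (use C(1) yp in simp)
    have "(y \<bullet> (S *\<^sub>v (R *\<^sub>v y)))\<^sup>2 \<le> (y \<bullet> (S *\<^sub>v y)) * ((R *\<^sub>v y) \<bullet> (S *\<^sub>v (R *\<^sub>v y)))"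
      by (rule psd_Cauchy_Schwarz[OF S sym psd y Ry])
    then have "(y \<bullet> y)\<^sup>2 \<le> (y \<bullet> (S *\<^sub>v y)) * ((R *\<^sub>v y) \<bullet> y)" by (simp add: SR)
    also have "\<dots> \<le> (y \<bullet> (S *\<^sub>v y)) * ((C + 1) * (y \<bullet> y))"
      using q psd[OF y] by (rule mult_left_mono)
    finally have "y \<bullet> y \<le> (y \<bullet> (S *\<^sub>v y)) * (C + 1)"
      using yp by (simp add: power2_eq_square mult.assoc[symmetric])
    then show ?thesis using C(1) by (simp add: field_simps)
  qed
  with C(1) show ?thesis by (intro exI[of _ "1 / (C + 1)"]) auto
qed

lemma finite_eigenvalues:
  assumes "(D :: real mat) \<in> carrier_mat n n"
  shows "finite {e. eigenvalue D e}"
proof -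
  have "char_poly D \<noteq> 0" using degree_monic_char_poly[OF assms] by auto
  then show ?thesis
    using poly_roots_finite by (simp add: eigenvalue_root_char_poly[OF assms])
qed

text \<open>Take the largest \<open>c\<close> for which D - c I is positive semidefinite. If
  \<open>c\<close> were not an eigenvalue, D - c I would be nonsingular, hence uniformly positive
  definite, and \<open>c\<close> could be raised.\<close>

lemma Rayleigh_eigenvalue:
  fixes D :: "real mat"
  assumes D: "D \<in> carrier_mat n n" and sym: "transpose_mat D = D" and n: "n > 0"
  shows "\<exists>e. eigenvalue D e \<and> (\<forall>x\<in>carrier_vec n. e * (x \<bullet> x) \<le> x \<bullet> (D *\<^sub>v x))"
proof -
  define X where "X = {c. \<forall>x\<in>carrier_vec n. c * (x \<bullet> x) \<le> x \<bullet> (D *\<^sub>v x)}"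
  obtain C where C: "0 \<le> C" "\<And>x. x \<in> carrier_vec n \<Longrightarrow> (D *\<^sub>v x) \<bullet> (D *\<^sub>v x) \<le> C * (x \<bullet> x)"
    using mult_mat_vec_bounded[OF D] by blast
  \<comment> \<open>The set is nonempty by expanding the squared norm of x + D x, which bounds the
    form at x below by -(C + 1)/2 times the squared norm of x.\<close>
  have "- (C + 1) \<in> X"
    unfolding X_def
  proof (intro CollectI ballI)
    fix x :: "real vec" assume x: "x \<in> carrier_vec n"
    have "0 \<le> (x + D *\<^sub>v x) \<bullet> (x + D *\<^sub>v x)" by (rule scalar_prod_self_nonneg)
    also have "\<dots> = x \<bullet> x + 2 * (x \<bullet> (D *\<^sub>v x)) + (D *\<^sub>v x) \<bullet> (D *\<^sub>v x)"
      using x D by (simp add: ip_simps carrier_vecD carrier_matD scalar_prod_comm_dim[of "D *\<^sub>v x" x])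
    finally have "0 \<le> (C + 1) * (x \<bullet> x) + 2 * (x \<bullet> (D *\<^sub>v x))"
      using C(2)[OF x] by (simp add: algebra_simps)
    moreover have "0 \<le> (C + 1) * (x \<bullet> x)" using C(1) scalar_prod_self_nonneg[of x] by simp
    ultimately show "- (C + 1) * (x \<bullet> x) \<le> x \<bullet> (D *\<^sub>v x)" by (simp add: algebra_simps)
  qed
  then have ne: "X \<noteq> {}" by auto
  let ?u = "unit_vec n 0 :: real vec"
  have uu: "?u \<bullet> ?u = 1" using n by simp
  have bdd: "bdd_above X"
    unfolding X_def
  proof (rule bdd_aboveI[of _ "?u \<bullet> (D *\<^sub>v ?u)"])
    fix c assume "c \<in> {c. \<forall>x\<in>carrier_vec n. c * (x \<bullet> x) \<le> x \<bullet> (D *\<^sub>v x)}"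
    then have "\<forall>x\<in>carrier_vec n. c * (x \<bullet> x) \<le> x \<bullet> (D *\<^sub>v x)" by (rule CollectD)
    then have "c * (?u \<bullet> ?u) \<le> ?u \<bullet> (D *\<^sub>v ?u)" by (rule bspec) simp
    then show "c \<le> ?u \<bullet> (D *\<^sub>v ?u)" by (simp only: uu)
  qed
  define c where "c = Sup X"
  have c: "c * (x \<bullet> x) \<le> x \<bullet> (D *\<^sub>v x)" if x: "x \<in> carrier_vec n" for x
  proof (cases "x \<bullet> x = 0")
    case True
    then have "x = 0\<^sub>v n" using scalar_prod_self_eq_0 x by blast
    then show ?thesis using D by simp
  next
    case False
    then have xp: "x \<bullet> x > 0" using scalar_prod_self_nonneg[of x] by simp
    have "c \<le> (x \<bullet> (D *\<^sub>v x)) / (x \<bullet> x)"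
      unfolding c_def using ne
      by (rule cSup_least) (use x xp in \<open>auto simp: X_def field_simps\<close>)
    then show ?thesis using xp by (simp add: field_simps)
  qed
  define S where "S = char_matrix D c"
  have S: "S \<in> carrier_mat n n" using D by (simp add: S_def)
  have Sx: "S *\<^sub>v x = D *\<^sub>v x - c \<cdot>\<^sub>v x" if x: "x \<in> carrier_vec n" for x
  proof -
    have "S = D + (- c) \<cdot>\<^sub>m 1\<^sub>m n" using D by (simp add: S_def char_matrix_def)
    moreover have "((- c) \<cdot>\<^sub>m 1\<^sub>m n) *\<^sub>v x = (- c) \<cdot>\<^sub>v x"
      using smult_mat_mult_vec[OF one_carrier_mat x, of "- c"] x by simp
    ultimately show ?thesis
      using D x by (intro eq_vecI) (auto simp: add_mult_distrib_mat_vec[of _ n n])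
  qed
  have Sq: "x \<bullet> (S *\<^sub>v x) = x \<bullet> (D *\<^sub>v x) - c * (x \<bullet> x)" if x: "x \<in> carrier_vec n" for x
    using D x by (simp add: Sx ip_simps)
  have symS: "transpose_mat S = S"
  proof (rule eq_matI)
    fix i j assume ij: "i < dim_row S" "j < dim_col S"
    have "D $$ (j, i) = D $$ (i, j)"
      using arg_cong[OF sym, of "\<lambda>M. M $$ (i, j)"] ij S D by simp
    then show "transpose_mat S $$ (i, j) = S $$ (i, j)"
      using ij S D by (simp add: S_def char_matrix_def)
  qed (use S in auto)
  have "eigenvalue D c"
  proof (rule ccontr)
    assume "\<not> eigenvalue D c"
    then have "det S \<noteq> 0" using eigenvalue_det[OF D] by (simp add: S_def)
    then obtain e where e: "e > 0" "\<And>x. x \<in> carrier_vec n \<Longrightarrow> e * (x \<bullet> x) \<le> x \<bullet> (S *\<^sub>v x)"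
      using pos_def_if_psd_nonsingular[OF S symS] Sq c by force
    have "c + e \<in> X" unfolding X_def using e(2) Sq by (force simp: algebra_simps)
    then have "c + e \<le> c" unfolding c_def by (rule cSup_upper[OF _ bdd])
    with e(1) show False by simp
  qed
  with c show ?thesis by blast
qed

text \<open>The smallest eigenvalue is at most the eigenvalue that bounds the quotient below. In
  dimension 0 there are no eigenvalues and \<open>Min\<close> is taken of the empty set, but both
  sides vanish.\<close>

lemma sigma_min_le_Rayleigh:
  fixes D :: "real mat"
  assumes D: "D \<in> carrier_mat n n" and sym: "transpose_mat D = D" and x: "x \<in> carrier_vec n"
  shows "sigma_min D * (x \<bullet> x) \<le> x \<bullet> (D *\<^sub>v x)"
proof (cases "n = 0")
  case True
  then show ?thesis using D x by (auto simp: scalar_prod_def)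
next
  case False
  then obtain e where e: "eigenvalue D e" "\<And>x. x \<in> carrier_vec n \<Longrightarrow> e * (x \<bullet> x) \<le> x \<bullet> (D *\<^sub>v x)"
    using Rayleigh_eigenvalue[OF D sym] by blast
  have "sigma_min D \<le> e"
    unfolding sigma_min_def using finite_eigenvalues[OF D] e(1) by (intro Min_le) auto
  then have "sigma_min D * (x \<bullet> x) \<le> e * (x \<bullet> x)"
    by (rule mult_right_mono) (rule scalar_prod_self_nonneg)
  with e(2)[OF x] show ?thesis by simp
qed

lemma sigma_min_nonneg:
  fixes D :: "real mat"
  assumes D: "D \<in> carrier_mat n n" and sym: "transpose_mat D = D" and n: "n > 0"
    and psd: "\<And>x. x \<in> carrier_vec n \<Longrightarrow> 0 \<le> x \<bullet> (D *\<^sub>v x)"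
  shows "0 \<le> sigma_min D"
proof -
  have ne: "{e. eigenvalue D e} \<noteq> {}" using Rayleigh_eigenvalue[OF D sym n] by blast
  have "0 \<le> e" if e: "eigenvalue D e" for e
  proof -
    obtain x where x: "x \<in> carrier_vec n" "x \<noteq> 0\<^sub>v n" "D *\<^sub>v x = e \<cdot>\<^sub>v x"
      using e D unfolding eigenvalue_def eigenvector_def by (metis carrier_matD(1))
    have "x \<bullet> x \<noteq> 0" using scalar_prod_self_eq_0 x by blast
    then have "x \<bullet> x > 0" using scalar_prod_self_nonneg[of x] by simp
    moreover have "0 \<le> e * (x \<bullet> x)" using psd[OF x(1)] x by simp
    ultimately show "0 \<le> e" by (simp add: zero_le_mult_iff)
  qed
  with ne finite_eigenvalues[OF D] show ?thesis by (simp add: sigma_min_def)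
qed

section \<open>Gradients of convex functions\<close>

text \<open>Extracts a first-order condition from minimality along a segment: \<open>a\<close> is
  the linear term and \<open>c\<close> the coefficient of the quadratic remainder.\<close>

lemma nonneg_if_small_perturbation:
  fixes a c :: real
  assumes "\<And>s. 0 < s \<Longrightarrow> s \<le> 1 \<Longrightarrow> 0 \<le> s * a + s\<^sup>2 * c"
  shows "0 \<le> a"
proof (rule ccontr)
  assume a: "\<not> 0 \<le> a"
  \<comment> \<open>Small enough that \<open>s * \<bar>c\<bar>\<close> is at most half of
    \<open>- a\<close>.\<close>
  define s where "s = min 1 (- a / (2 * (\<bar>c\<bar> + 1)))"
  have s: "0 < s" "s \<le> 1" using a by (auto simp: s_def field_simps)
  have "s * (\<bar>c\<bar> + 1) \<le> - a / (2 * (\<bar>c\<bar> + 1)) * (\<bar>c\<bar> + 1)"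
    by (intro mult_right_mono) (auto simp: s_def)
  also have "\<dots> = - a / 2" by (simp add: field_simps)
  finally have "s * (\<bar>c\<bar> + 1) \<le> - a / 2" .
  moreover have "s * c \<le> s * (\<bar>c\<bar> + 1)" using s by (intro mult_left_mono) auto
  ultimately have "a + s * c < 0" using a by linarith
  then have "s * (a + s * c) < 0" using s by (simp add: mult_pos_neg)
  with assms[OF s] show False by (simp add: power2_eq_square algebra_simps)
qed

text \<open>Moving from \<open>x\<close> in the direction \<open>h = s - d\<close> gains at least
  the squared norm of \<open>h\<close> over the linear part \<open>d\<close>, which the Frechet
  remainder allows only if \<open>h\<close> vanishes.\<close>

lemma subgradient_eq_gradient:
  assumes d: "has_gradient n g d x" and x: "x \<in> carrier_vec n" and s: "s \<in> carrier_vec n"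
    and sub: "\<And>y. y \<in> carrier_vec n \<Longrightarrow> g y - g x \<ge> s \<bullet> (y - x)"
  shows "s = d"
proof -
  have dc: "d \<in> carrier_vec n" using d by (simp add: has_gradient_def)
  define h where "h = s - d"
  have h: "h \<in> carrier_vec n" using s dc by (simp add: h_def)
  have "vnorm h \<le> e" if e: "e > 0" for e
  proof (cases "vnorm h = 0")
    case False
    then have hp: "vnorm h > 0" using vnorm_nonneg[of h] by simp
    obtain D where D: "D > 0" "\<And>y. y \<in> carrier_vec n \<Longrightarrow> vnorm (y - x) < D \<Longrightarrow>
        \<bar>g y - g x - d \<bullet> (y - x)\<bar> \<le> e * vnorm (y - x)"
      using d e unfolding has_gradient_def by meson
    \<comment> \<open>Half of the admissible radius, so that the strict inequality holds.\<close>
    define r where "r = D / (2 * vnorm h)"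
    have r: "r > 0" "r * vnorm h < D" using D(1) hp by (auto simp: r_def)
    define y where "y = x + r \<cdot>\<^sub>v h"
    have y: "y \<in> carrier_vec n" and yx: "y - x = r \<cdot>\<^sub>v h"
      using x h by (auto simp: y_def)
    have vn: "vnorm (y - x) = r * vnorm h" using r(1) by (simp add: yx vnorm_smult)
    have "r * (s \<bullet> h) \<le> g y - g x" using sub[OF y] s h by (simp add: yx)
    also have "\<dots> \<le> r * (d \<bullet> h) + e * (r * vnorm h)"
      using D(2)[OF y] r(2) dc h by (simp add: vn) (simp add: yx)
    finally have "r * (h \<bullet> h) \<le> r * (e * vnorm h)"
      using s dc h by (simp add: h_def ip_simps carrier_vecD algebra_simps)
    then have "(vnorm h)\<^sup>2 \<le> e * vnorm h" using r(1) by (simp add: vnorm_sq)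
    then show ?thesis using hp by (simp add: power2_eq_square)
  qed (use e in simp)
  then have "vnorm h \<le> 0" by (metis dual_order.refl field_le_epsilon add_0)
  then have "(vnorm h)\<^sup>2 = 0" using vnorm_nonneg[of h] by simp
  then have "h = 0\<^sub>v n" using scalar_prod_self_eq_0[OF h] by (simp add: vnorm_sq)
  then have "(s - d) $ i = 0" if "i < n" for i using that by (simp add: h_def)
  then show ?thesis using s dc by (intro eq_vecI) auto
qed

text \<open>The affine function with slope \<open>d'\<close> has \<open>d'\<close> as a subgradient
  at \<open>x\<close>, and it also has gradient \<open>d\<close> because both slopes approximate
  \<open>g\<close> to first order. Uniqueness is what evaluates the definite description in
  \<open>gradient\<close>.\<close>

lemma has_gradient_unique:
  assumes "has_gradient n g d x" "has_gradient n g d' x" "x \<in> carrier_vec n"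
  shows "d' = d"
proof -
  have dc: "d \<in> carrier_vec n" "d' \<in> carrier_vec n"
    using assms by (auto simp: has_gradient_def)
  define g' where "g' = (\<lambda>y. d' \<bullet> (y - x))"
  have "has_gradient n g' d x"
    unfolding has_gradient_def
  proof (intro conjI allI impI)
    fix e :: real assume e: "e > 0"
    then have e2: "e / 2 > 0" by simp
    obtain D where D: "D > 0" "\<And>y. y \<in> carrier_vec n \<Longrightarrow> vnorm (y - x) < D \<Longrightarrow>
        \<bar>g y - g x - d \<bullet> (y - x)\<bar> \<le> e / 2 * vnorm (y - x)"
      using assms(1) e2 unfolding has_gradient_def by meson
    obtain D' where D': "D' > 0" "\<And>y. y \<in> carrier_vec n \<Longrightarrow> vnorm (y - x) < D' \<Longrightarrow>
        \<bar>g y - g x - d' \<bullet> (y - x)\<bar> \<le> e / 2 * vnorm (y - x)"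
      using assms(2) e2 unfolding has_gradient_def by meson
    show "\<exists>\<delta>>0. \<forall>y\<in>carrier_vec n. vnorm (y - x) < \<delta> \<longrightarrow>
        \<bar>g' y - g' x - d \<bullet> (y - x)\<bar> \<le> e * vnorm (y - x)"
    proof (intro exI[of _ "min D D'"] conjI ballI impI)
      fix y assume y: "y \<in> carrier_vec n" "vnorm (y - x) < min D D'"
      have "g' x = 0" using assms(3) dc by (simp add: g'_def)
      show "\<bar>g' y - g' x - d \<bullet> (y - x)\<bar> \<le> e * vnorm (y - x)"
      proof -
        have "\<bar>v - u\<bar> \<le> 2 * c" if "\<bar>t - u\<bar> \<le> c" "\<bar>t - v\<bar> \<le> c" for t u v c :: real
          using that by linarith
        from this[OF D(2) D'(2)] \<open>g' x = 0\<close> y show ?thesis by (simp add: g'_def)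
      qed
    qed (use D D' in simp)
  qed (rule dc)
  then show ?thesis
    by (rule subgradient_eq_gradient) (use assms(3) dc in \<open>auto simp: g'_def\<close>)
qed

lemma gradient_eqI:
  assumes "has_gradient n g d x" "x \<in> carrier_vec n"
  shows "gradient n g x = d"
  unfolding gradient_def using assms has_gradient_unique by (intro the_equality) blast+

lemma convex_gradient_ineq:
  assumes conv: "convex_fun n g" and d: "has_gradient n g d x"
    and x: "x \<in> carrier_vec n" and y: "y \<in> carrier_vec n"
  shows "g y - g x \<ge> d \<bullet> (y - x)"
proof (rule field_le_epsilon)
  fix e :: real assume e: "e > 0"
  have dc: "d \<in> carrier_vec n" using d by (simp add: has_gradient_def)
  \<comment> \<open>The summand 1 keeps \<open>N\<close> positive when \<open>y = x\<close>.\<close>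
  define N where "N = vnorm (y - x) + 1"
  have N: "N > 0" "vnorm (y - x) < N" using vnorm_nonneg[of "y - x"] by (auto simp: N_def)
  have "e / N > 0" using e N by simp
  then obtain D where D: "D > 0" "\<And>z. z \<in> carrier_vec n \<Longrightarrow> vnorm (z - x) < D \<Longrightarrow>
      \<bar>g z - g x - d \<bullet> (z - x)\<bar> \<le> e / N * vnorm (z - x)"
    using d unfolding has_gradient_def by meson
  define r where "r = min 1 (D / N)"
  have r: "0 < r" "r \<le> 1" using D(1) N by (auto simp: r_def)
  have "r * vnorm (y - x) < r * N" using r N by simp
  also have "\<dots> \<le> D / N * N" using N by (intro mult_right_mono) (auto simp: r_def)
  finally have rD: "r * vnorm (y - x) < D" using N by simp
  define z where "z = (1 - r) \<cdot>\<^sub>v x + r \<cdot>\<^sub>v y"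
  have z: "z \<in> carrier_vec n" using x y by (simp add: z_def)
  have zx: "z - x = r \<cdot>\<^sub>v (y - x)"
    using x y by (intro eq_vecI) (auto simp: z_def algebra_simps)
  have vn: "vnorm (z - x) = r * vnorm (y - x)" using r by (simp add: zx vnorm_smult)
  have "d \<bullet> (z - x) = r * (d \<bullet> (y - x))" using dc x y by (simp add: zx)
  then have "r * (d \<bullet> (y - x)) \<le> g z - g x + e / N * (r * vnorm (y - x))"
    using D(2)[OF z] rD by (simp add: vn)
  also have "g z \<le> (1 - r) * g x + r * g y"
    using conv x y r unfolding convex_fun_def z_def by auto
  finally have "r * (d \<bullet> (y - x)) \<le> r * (g y - g x + e / N * vnorm (y - x))"
    by (simp add: algebra_simps)
  then have "d \<bullet> (y - x) \<le> g y - g x + e / N * vnorm (y - x)" using r by simp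
  also have "e / N * vnorm (y - x) \<le> e / N * N"
    using e N by (intro mult_left_mono) auto
  finally show "d \<bullet> (y - x) \<le> g y - g x + e" using N by simp
qed

lemma gradient_Lipschitz_has_gradient:
  assumes "gradient_Lipschitz n g L" "x \<in> carrier_vec n"
  shows "has_gradient n g (gradient n g x) x"
  using assms gradient_eqI unfolding gradient_Lipschitz_def by metis

text \<open>Compare the convex lower bound based at \<open>x\<close> with the Lipschitz upper bound
  based at \<open>y\<close> at one point \<open>w\<close>. The chosen \<open>w\<close> minimises
  upper minus lower bound, which produces the constant 1/(2L).\<close>

lemma gradient_cocoercive:
  assumes conv: "convex_fun n g" and lip: "gradient_Lipschitz n g L"
    and x: "x \<in> carrier_vec n" and y: "y \<in> carrier_vec n"
  shows "g y \<ge> g x + gradient n g x \<bullet> (y - x)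
    + 1 / (2 * L) * ((gradient n g x - gradient n g y) \<bullet> (gradient n g x - gradient n g y))"
proof -
  have L: "L > 0" using lip by (simp add: gradient_Lipschitz_def)
  define p where "p = gradient n g x"
  define q where "q = gradient n g y"
  have hp: "has_gradient n g p x" and hq: "has_gradient n g q y"
    using gradient_Lipschitz_has_gradient[OF lip] x y by (auto simp: p_def q_def)
  then have p: "p \<in> carrier_vec n" and q: "q \<in> carrier_vec n" by (auto simp: has_gradient_def)
  define w where "w = y + (1 / L) \<cdot>\<^sub>v (p - q)"
  have w: "w \<in> carrier_vec n" using y p q by (simp add: w_def)
  have wy: "w - y = (1 / L) \<cdot>\<^sub>v (p - q)" using y p q by (intro eq_vecI) (auto simp: w_def)
  have 1: "p \<bullet> (w - x) \<le> g w - g x" by (rule convex_gradient_ineq[OF conv hp x w])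
  have 2: "g w \<le> g y + q \<bullet> (w - y) + L / 2 * (vnorm (w - y))\<^sup>2"
    using lip y w unfolding gradient_Lipschitz_def q_def by blast
  have 3: "p \<bullet> (w - x) = p \<bullet> (y - x) + p \<bullet> (w - y)"
    using p w x y by (simp add: ip_simps carrier_vecD)
  have 4: "p \<bullet> (w - y) - q \<bullet> (w - y) = (p - q) \<bullet> (w - y)"
    using p q w y by (simp add: ip_simps carrier_vecD)
  have 5: "(p - q) \<bullet> (w - y) = 1 / L * ((p - q) \<bullet> (p - q))"
    using p q by (simp add: wy)
  have 6: "(vnorm (w - y))\<^sup>2 = (1 / L)\<^sup>2 * ((p - q) \<bullet> (p - q))"
    using p q by (simp add: wy vnorm_smult power_mult_distrib vnorm_sq power_divide)
  have "L / 2 * (vnorm (w - y))\<^sup>2 = 1 / (2 * L) * ((p - q) \<bullet> (p - q))"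
    unfolding 6 using L by (simp add: power2_eq_square field_simps)
  moreover have "1 / L * ((p - q) \<bullet> (p - q)) = 2 * (1 / (2 * L) * ((p - q) \<bullet> (p - q)))"
    using L by simp
  ultimately show ?thesis
    using 1 2 3 4 5 unfolding p_def[symmetric] q_def[symmetric] by linarith
qed

section \<open>Vector sums, the gradient of the penalty term and the proximal step\<close>

abbreviation vsum :: "nat \<Rightarrow> ('i \<Rightarrow> real vec) \<Rightarrow> 'i set \<Rightarrow> real vec" where
  "vsum l w I \<equiv> finsum_vec TYPE(real) l w I"

lemma vsum_carrier: "(\<And>i. i \<in> I \<Longrightarrow> w i \<in> carrier_vec l) \<Longrightarrow> vsum l w I \<in> carrier_vec l"
  by (rule finsum_vec_closed) auto

lemma vsum_index:
  "finite I \<Longrightarrow> (\<And>i. i \<in> I \<Longrightarrow> w i \<in> carrier_vec l) \<Longrightarrow> p < l \<Longrightarrow> vsum l w I $ p = (\<Sum>i\<in>I. w i $ p)"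
  by (rule index_finsum_vec) auto

lemma vsum_scalar_right:
  assumes "finite I" "\<And>i. i \<in> I \<Longrightarrow> w i \<in> carrier_vec l" "y \<in> carrier_vec l"
  shows "y \<bullet> vsum l w I = (\<Sum>i\<in>I. y \<bullet> w i)"
proof -
  have "y \<bullet> vsum l w I = (\<Sum>p<l. \<Sum>i\<in>I. y $ p * w i $ p)"
    using vsum_carrier[of I w l] assms
    by (simp add: scalar_prod_def lessThan_atLeast0 vsum_index sum_distrib_left)
  also have "\<dots> = (\<Sum>i\<in>I. \<Sum>p<l. y $ p * w i $ p)" by (rule sum.swap)
  also have "\<dots> = (\<Sum>i\<in>I. y \<bullet> w i)"
    using carrier_vecD[OF assms(2)] by (intro sum.cong) (auto simp: scalar_prod_def lessThan_atLeast0)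
  finally show ?thesis .
qed

lemma vsum_scalar_left:
  assumes "finite I" "\<And>i. i \<in> I \<Longrightarrow> w i \<in> carrier_vec l" "y \<in> carrier_vec l"
  shows "vsum l w I \<bullet> y = (\<Sum>i\<in>I. w i \<bullet> y)"
  using vsum_scalar_right[OF assms] vsum_carrier[of I w l] assms
  by (simp add: comm_scalar_prod[of _ l])

lemma has_gradient_quadratic_remainder:
  fixes g :: "real vec \<Rightarrow> real"
  assumes d: "d \<in> carrier_vec n" and x: "x \<in> carrier_vec n" and C: "0 \<le> C"
    and rem: "\<And>y. y \<in> carrier_vec n \<Longrightarrow> \<bar>g y - g x - d \<bullet> (y - x)\<bar> \<le> C * ((y - x) \<bullet> (y - x))"
  shows "has_gradient n g d x"
  unfolding has_gradient_def
proof (intro conjI allI impI)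
  fix e :: real assume e: "e > 0"
  show "\<exists>\<delta>>0. \<forall>y\<in>carrier_vec n. vnorm (y - x) < \<delta> \<longrightarrow>
      \<bar>g y - g x - d \<bullet> (y - x)\<bar> \<le> e * vnorm (y - x)"
  proof (intro exI[of _ "e / (C + 1)"] conjI ballI impI)
    fix y assume y: "y \<in> carrier_vec n" and near: "vnorm (y - x) < e / (C + 1)"
    have "\<bar>g y - g x - d \<bullet> (y - x)\<bar> \<le> C * vnorm (y - x) * vnorm (y - x)"
      using rem[OF y] by (simp add: vnorm_sq[symmetric] power2_eq_square mult.assoc)
    also have "C * vnorm (y - x) \<le> C * (e / (C + 1))"
      using near C by (intro mult_left_mono) auto
    also have "\<dots> \<le> e" using e C by (simp add: field_simps)
    finally show "\<bar>g y - g x - d \<bullet> (y - x)\<bar> \<le> e * vnorm (y - x)"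
      using vnorm_nonneg[of "y - x"] by (simp add: mult_right_mono)
  qed (use e C in simp)
qed (rule d)

text \<open>The function is quadratic, so the remainder of its linearisation is exactly \<beta>/2
  times the squared norm of A(y - x), which boundedness of \<open>A\<close> controls.\<close>

lemma gradient_penalty:
  fixes \<beta> :: real
  assumes A: "A \<in> carrier_mat l n" and d: "d \<in> carrier_vec l" and lam: "lam \<in> carrier_vec l"
    and x: "x \<in> carrier_vec n"
  shows "gradient n (\<lambda>y. - (lam \<bullet> (A *\<^sub>v y + d)) + \<beta> / 2 * (vnorm (A *\<^sub>v y + d))\<^sup>2) x
    = transpose_mat A *\<^sub>v (\<beta> \<cdot>\<^sub>v (A *\<^sub>v x + d) - lam)"
proof -
  let ?r = "A *\<^sub>v x + d"
  let ?G = "transpose_mat A *\<^sub>v (\<beta> \<cdot>\<^sub>v ?r - lam)"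
  let ?g = "\<lambda>y. - (lam \<bullet> (A *\<^sub>v y + d)) + \<beta> / 2 * (vnorm (A *\<^sub>v y + d))\<^sup>2"
  obtain C where C: "0 \<le> C" "\<And>x. x \<in> carrier_vec n \<Longrightarrow> (A *\<^sub>v x) \<bullet> (A *\<^sub>v x) \<le> C * (x \<bullet> x)"
    using mult_mat_vec_bounded[OF A] by blast
  have G: "?G \<in> carrier_vec n" using A x d lam by auto
  have expand: "- (lam \<bullet> (r + h)) + \<beta> / 2 * ((r + h) \<bullet> (r + h))
      - (- (lam \<bullet> r) + \<beta> / 2 * (r \<bullet> r)) - (\<beta> \<cdot>\<^sub>v r - lam) \<bullet> h = \<beta> / 2 * (h \<bullet> h)"
    if r: "r \<in> carrier_vec l" and h: "h \<in> carrier_vec l" for r h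
  proof -
    have "(r + h) \<bullet> (r + h) = r \<bullet> r + 2 * (r \<bullet> h) + h \<bullet> h"
      using r h by (simp add: ip_simps comm_scalar_prod[of h l r])
    moreover have "lam \<bullet> (r + h) = lam \<bullet> r + lam \<bullet> h" "(\<beta> \<cdot>\<^sub>v r - lam) \<bullet> h = \<beta> * (r \<bullet> h) - lam \<bullet> h"
      using r h lam by (simp_all add: ip_simps)
    ultimately show ?thesis by (simp add: algebra_simps)
  qed
  have "has_gradient n ?g ?G x"
  proof (rule has_gradient_quadratic_remainder[OF G x, of "\<bar>\<beta>\<bar> / 2 * C"])
    show "0 \<le> \<bar>\<beta>\<bar> / 2 * C" using C by simp
    fix y :: "real vec" assume y: "y \<in> carrier_vec n"
    let ?h = "A *\<^sub>v (y - x)"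
    have h: "?h \<in> carrier_vec l" and r: "?r \<in> carrier_vec l" using A x y d by auto
    have Ay: "A *\<^sub>v y + d = ?r + ?h"
      using A x y d by (intro eq_vecI) (auto simp: mult_minus_distrib_mat_vec[OF A])
    have Gh: "?G \<bullet> (y - x) = (\<beta> \<cdot>\<^sub>v ?r - lam) \<bullet> ?h"
      using mat_vec_adjoint[OF A, of "y - x" "\<beta> \<cdot>\<^sub>v ?r - lam"] x y r lam by simp
    have "?g y - ?g x - ?G \<bullet> (y - x) = \<beta> / 2 * (?h \<bullet> ?h)"
      unfolding Gh Ay vnorm_sq by (rule expand[OF r h])
    then have "\<bar>?g y - ?g x - ?G \<bullet> (y - x)\<bar> = \<bar>\<beta>\<bar> / 2 * (?h \<bullet> ?h)"
      by (simp only: abs_mult abs_divide abs_numeral abs_of_nonneg[OF scalar_prod_self_nonneg])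
    also have "\<dots> \<le> \<bar>\<beta>\<bar> / 2 * (C * ((y - x) \<bullet> (y - x)))"
      using C(2)[of "y - x"] x y by (intro mult_left_mono) auto
    finally show "\<bar>?g y - ?g x - ?G \<bullet> (y - x)\<bar> \<le> \<bar>\<beta>\<bar> / 2 * C * ((y - x) \<bullet> (y - x))"
      by (simp add: mult.assoc)
  qed
  then show ?thesis by (rule gradient_eqI[OF _ x])
qed

text \<open>As a function of block \<open>j\<close> alone the residual is affine: \<open>d\<close>
  collects the other blocks and \<open>b\<close>.\<close>

lemma partial_gradient_phi_eq:
  assumes A: "\<And>i. i \<in> {1..m} \<Longrightarrow> A i \<in> carrier_mat l (n i)" and b: "b \<in> carrier_vec l"
    and x: "x \<in> block_space m n" and lam: "lam \<in> carrier_vec l" and j: "j \<in> {1..m}"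
  shows "partial_gradient_phi m l n A b \<beta> j x lam
    = transpose_mat (A j) *\<^sub>v (\<beta> \<cdot>\<^sub>v residual m l A b x - lam)"
proof -
  have Ax: "A i *\<^sub>v x i \<in> carrier_vec l" if "i \<in> {1..m}" for i
    using A[OF that] x that by (auto simp: block_space_def)
  define d where "d = vsum l (\<lambda>i. A i *\<^sub>v x i) ({1..m} - {j}) - b"
  have vd: "vsum l (\<lambda>i. A i *\<^sub>v x i) ({1..m} - {j}) \<in> carrier_vec l"
    using Ax by (intro vsum_carrier) auto
  then have d: "d \<in> carrier_vec l" using b by (simp add: d_def)
  have xj: "x j \<in> carrier_vec (n j)" using x j by (auto simp: block_space_def)
  have res: "residual m l A b (x(j := y)) = A j *\<^sub>v y + d" if y: "y \<in> carrier_vec (n j)" for y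
  proof (rule eq_vecI)
    have c: "A i *\<^sub>v (x(j := y)) i \<in> carrier_vec l" if "i \<in> {1..m}" for i
      using Ax[OF that] A[OF that] y by auto
    have vc: "vsum l (\<lambda>i. A i *\<^sub>v (x(j := y)) i) {1..m} \<in> carrier_vec l"
      using c by (intro vsum_carrier) auto
    show "dim_vec (residual m l A b (x(j := y))) = dim_vec (A j *\<^sub>v y + d)"
      using d b by (simp add: residual_def)
    fix p assume "p < dim_vec (A j *\<^sub>v y + d)"
    then have p: "p < l" using d by simp
    have sum_eq: "(A j *\<^sub>v y + d) $ p
        = (A j *\<^sub>v y) $ p + (vsum l (\<lambda>i. A i *\<^sub>v x i) ({1..m} - {j}) $ p - b $ p)"
      using p b d vd by (simp add: d_def)
    have "residual m l A b (x(j := y)) $ p = (\<Sum>i\<in>{1..m}. (A i *\<^sub>v (x(j := y)) i) $ p) - b $ p"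
      unfolding residual_def A_sum_def using b p by (simp only: index_minus_vec carrier_vecD vsum_index[OF finite_atLeastAtMost c p])
    also have "(\<Sum>i\<in>{1..m}. (A i *\<^sub>v (x(j := y)) i) $ p)
        = (A j *\<^sub>v y) $ p + (\<Sum>i\<in>{1..m} - {j}. (A i *\<^sub>v x i) $ p)"
      using j by (subst sum.remove[of _ j]) (auto intro!: sum.cong)
    also have "(\<Sum>i\<in>{1..m} - {j}. (A i *\<^sub>v x i) $ p) = vsum l (\<lambda>i. A i *\<^sub>v x i) ({1..m} - {j}) $ p"
      using Ax p by (intro vsum_index[symmetric]) auto
    finally show "residual m l A b (x(j := y)) $ p = (A j *\<^sub>v y + d) $ p"
      using sum_eq by linarith
  qed
  have eq: "phi m l A b \<beta> (x(j := y)) lam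
      = - (lam \<bullet> (A j *\<^sub>v y + d)) + \<beta> / 2 * (vnorm (A j *\<^sub>v y + d))\<^sup>2" if "y \<in> carrier_vec (n j)" for y
    using res[OF that] by (simp add: phi_def)
  \<comment> \<open>The two functions agree only on the carrier, so they cannot be rewritten as
    functions; \<open>has_gradient\<close> looks at no other arguments.\<close>
  have cong: "has_gradient (n j) g e (x j) \<longleftrightarrow> has_gradient (n j) h e (x j)"
    if "\<And>y. y \<in> carrier_vec (n j) \<Longrightarrow> g y = h y" for g h e
    using that xj unfolding has_gradient_def by simp
  have "partial_gradient_phi m l n A b \<beta> j x lam
      = gradient (n j) (\<lambda>y. - (lam \<bullet> (A j *\<^sub>v y + d)) + \<beta> / 2 * (vnorm (A j *\<^sub>v y + d))\<^sup>2) (x j)"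
    unfolding partial_gradient_phi_def gradient_def by (simp only: cong[OF eq])
  also have "\<dots> = transpose_mat (A j) *\<^sub>v (\<beta> \<cdot>\<^sub>v (A j *\<^sub>v x j + d) - lam)"
    by (rule gradient_penalty[OF A[OF j] d lam xj])
  also have "A j *\<^sub>v x j + d = residual m l A b x" using res[OF xj] by simp
  finally show ?thesis .
qed

text \<open>Compare the minimiser with points of the segment to \<open>y\<close>. The proximal form
  belongs to A^T A and may be degenerate, so only its first-order part along the segment is kept,
  and it enters through images under \<open>A\<close>.\<close>

lemma prox_step_optimality:
  assumes A: "A \<in> carrier_mat l n" and conv: "convex_fun n f" and g: "g \<in> carrier_vec n"
    and xh: "xh \<in> carrier_vec n"
    and min: "is_arg_min (\<lambda>y. f y + y \<bullet> g + \<beta> / 2 * sqnorm_wrt (transpose_mat A * A) (y - xh))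
      (\<lambda>y. y \<in> carrier_vec n) x"
    and y: "y \<in> carrier_vec n"
  shows "0 \<le> f y - f x + (y - x) \<bullet> g + \<beta> * ((A *\<^sub>v (y - x)) \<bullet> (A *\<^sub>v (x - xh)))"
proof -
  have x: "x \<in> carrier_vec n" using min by (simp add: is_arg_min_def)
  define h where "h = y - x"
  define e where "e = A *\<^sub>v (x - xh)"
  define u where "u = A *\<^sub>v h"
  have h: "h \<in> carrier_vec n" and e: "e \<in> carrier_vec l" and u: "u \<in> carrier_vec l"
    using x y xh A by (auto simp: h_def e_def u_def)
  have sq: "sqnorm_wrt (transpose_mat A * A) z = (A *\<^sub>v z) \<bullet> (A *\<^sub>v z)" if z: "z \<in> carrier_vec n" for z
    using mat_vec_adjoint[OF A z, of "A *\<^sub>v z"] A z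
      assoc_mult_mat_vec[of "transpose_mat A" n l A n z]
    by (simp add: sqnorm_wrt_def comm_scalar_prod[of _ n])
  have "0 \<le> f y - f x + h \<bullet> g + \<beta> * (u \<bullet> e)"
  proof (rule nonneg_if_small_perturbation[where c = "\<beta> / 2 * (u \<bullet> u)"])
    fix s :: real assume s: "0 < s" "s \<le> 1"
    define z where "z = (1 - s) \<cdot>\<^sub>v x + s \<cdot>\<^sub>v y"
    have z: "z \<in> carrier_vec n" using x y by (simp add: z_def)
    have zx: "z - xh = (x - xh) + s \<cdot>\<^sub>v h" and z': "z = x + s \<cdot>\<^sub>v h"
      using x y xh by (auto intro!: eq_vecI simp: z_def h_def algebra_simps)
    have Az: "A *\<^sub>v (z - xh) = e + s \<cdot>\<^sub>v u"
      unfolding zx e_def u_def using A x xh h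
      by (simp add: mult_add_distrib_mat_vec[OF A] mult_mat_vec[OF A])
    have zg: "z \<bullet> g = x \<bullet> g + s * (h \<bullet> g)" using x h g by (simp add: z' ip_simps)
    have qz: "(e + s \<cdot>\<^sub>v u) \<bullet> (e + s \<cdot>\<^sub>v u) = e \<bullet> e + 2 * s * (u \<bullet> e) + s\<^sup>2 * (u \<bullet> u)"
      using e u by (simp add: ip_simps power2_eq_square comm_scalar_prod[of e l u] algebra_simps)
    have "f x + x \<bullet> g + \<beta> / 2 * (e \<bullet> e) \<le> f z + z \<bullet> g + \<beta> / 2 * ((A *\<^sub>v (z - xh)) \<bullet> (A *\<^sub>v (z - xh)))"
      using min z sq[of "x - xh"] sq[of "z - xh"] x z xh
      unfolding is_arg_min_def e_def by (metis (no_types, lifting) minus_carrier_vec not_le_imp_less)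
    also have "f z \<le> (1 - s) * f x + s * f y"
      using conv x y s unfolding convex_fun_def z_def by auto
    finally show "0 \<le> s * (f y - f x + h \<bullet> g + \<beta> * (u \<bullet> e)) + s\<^sup>2 * (\<beta> / 2 * (u \<bullet> u))"
      unfolding Az zg qz by (simp add: field_simps)
  qed
  then show ?thesis by (simp add: h_def e_def u_def)
qed

text \<open>Keeps \<open>(m - 1) * l\<close> in the form in which the block dimensions are given.\<close>

declare One_nat_def [simp del]

section \<open>Stacked vectors and the block matrices\<close>

lemma stack_carrier [simp]: "stack m l w \<in> carrier_vec ((m - 1) * l)"
  by (simp add: stack_def)

lemma block_index_less:
  fixes r K l :: nat
  assumes "r < K * l"
  shows "r div l < K" "r mod l < l"
proof -
  have "l > 0" using assms by (cases l) auto
  then show "r mod l < l" by simp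
  show "r div l < K" using assms by (rule less_mult_imp_div_less)
qed

lemma block_in_range:
  fixes r :: nat
  assumes "r < (m - 1) * l"
  shows "r div l + 2 \<in> {2..m}"
  using block_index_less(1)[OF assms] by auto

lemma stack_index: "r < (m - 1) * l \<Longrightarrow> stack m l w $ r = w (r div l + 2) $ (r mod l)"
  by (simp add: stack_def)

lemma stack_cong: "(\<And>j. j \<in> {2..m} \<Longrightarrow> w j = w' j) \<Longrightarrow> stack m l w = stack m l w'"
  using block_in_range by (intro eq_vecI) (simp_all add: stack_def)

lemma stack_minus:
  assumes "\<And>j. j \<in> {2..m} \<Longrightarrow> w j \<in> carrier_vec l" "\<And>j. j \<in> {2..m} \<Longrightarrow> w' j \<in> carrier_vec l"
  shows "stack m l w - stack m l w' = stack m l (\<lambda>j. w j - w' j)"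
proof (rule eq_vecI)
  fix r assume "r < dim_vec (stack m l (\<lambda>j. w j - w' j))"
  then have r: "r < (m - 1) * l" by (simp add: stack_def)
  show "(stack m l w - stack m l w') $ r = stack m l (\<lambda>j. w j - w' j) $ r"
    using carrier_vecD[OF assms(2)[OF block_in_range[OF r]]] block_index_less(2)[OF r] r
    by (simp add: stack_index carrier_vecD[OF stack_carrier])
qed (simp add: stack_def)

lemma sum_blocks:
  fixes F :: "nat \<Rightarrow> nat \<Rightarrow> real"
  shows "(\<Sum>r<(m - 1) * l. F (r div l) (r mod l)) = (\<Sum>q<m - 1. \<Sum>p<l. F q p)"
proof -
  have "(\<Sum>q<m - 1. \<Sum>p<l. F q p) = (\<Sum>q<m - 1. \<Sum>r\<in>{q * l..<q * l + l}. F (r div l) (r mod l))"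
  proof (rule sum.cong[OF refl])
    fix q
    show "(\<Sum>p<l. F q p) = (\<Sum>r\<in>{q * l..<q * l + l}. F (r div l) (r mod l))"
      by (rule sum.reindex_bij_witness[of _ "\<lambda>r. r - q * l" "\<lambda>p. q * l + p"])
        (auto simp: div_add1_eq[of "q * l"])
  qed
  also have "\<dots> = (\<Sum>r<(m - 1) * l. F (r div l) (r mod l))" by (rule sum.nat_group)
  finally show ?thesis by simp
qed

lemma sum_block_shift:
  fixes h :: "nat \<Rightarrow> real"
  shows "(\<Sum>q<m - 1. h (q + 2)) = (\<Sum>j=2..m. h j)"
  by (rule sum.reindex_bij_witness[of _ "\<lambda>j. j - 2" "\<lambda>q. q + 2"]) auto

lemma stack_scalar_prod:
  assumes "\<And>j. j \<in> {2..m} \<Longrightarrow> w' j \<in> carrier_vec l"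
  shows "stack m l w \<bullet> stack m l w' = (\<Sum>j=2..m. w j \<bullet> w' j)"
proof -
  have "stack m l w \<bullet> stack m l w' = (\<Sum>r<(m - 1) * l. w (r div l + 2) $ (r mod l) * w' (r div l + 2) $ (r mod l))"
    by (simp add: scalar_prod_def lessThan_atLeast0 stack_def)
  also have "\<dots> = (\<Sum>q<m - 1. \<Sum>p<l. w (q + 2) $ p * w' (q + 2) $ p)"
    by (rule sum_blocks[where F = "\<lambda>q p. w (q + 2) $ p * w' (q + 2) $ p"])
  also have "\<dots> = (\<Sum>j=2..m. \<Sum>p<l. w j $ p * w' j $ p)"
    by (rule sum_block_shift[where h = "\<lambda>j. \<Sum>p<l. w j $ p * w' j $ p"])
  also have "\<dots> = (\<Sum>j=2..m. w j \<bullet> w' j)"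
    using carrier_vecD[OF assms] by (intro sum.cong) (auto simp: scalar_prod_def lessThan_atLeast0)
  finally show ?thesis .
qed

lemma J_mat_carrier [simp]: "J_mat m l \<in> carrier_mat ((m - 1) * l) ((m - 1) * l)"
  by (simp add: J_mat_def)

lemma I_row_carrier [simp]: "I_row m l \<in> carrier_mat l ((m - 1) * l)"
  by (simp add: I_row_def)

lemma I_row_stack:
  assumes w: "\<And>j. j \<in> {2..m} \<Longrightarrow> w j \<in> carrier_vec l"
  shows "I_row m l *\<^sub>v stack m l w = vsum l w {2..m}"
proof (rule eq_vecI)
  have c: "vsum l w {2..m} \<in> carrier_vec l" using w by (rule vsum_carrier)
  then show "dim_vec (I_row m l *\<^sub>v stack m l w) = dim_vec (vsum l w {2..m})" by (simp add: I_row_def)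
  fix i assume "i < dim_vec (vsum l w {2..m})"
  then have i: "i < l" using c by simp
  have "(I_row m l *\<^sub>v stack m l w) $ i
      = (\<Sum>r<(m - 1) * l. (if i = r mod l then 1 else 0) * w (r div l + 2) $ (r mod l))"
    using i by (simp add: I_row_def stack_def scalar_prod_def lessThan_atLeast0)
  also have "\<dots> = (\<Sum>q<m - 1. \<Sum>p<l. (if i = p then 1 else 0) * w (q + 2) $ p)"
    by (rule sum_blocks[where F = "\<lambda>q p. (if i = p then 1 else 0) * w (q + 2) $ p"])
  also have "\<dots> = (\<Sum>q<m - 1. w (q + 2) $ i)"
    using i by (intro sum.cong) (auto simp: if_distribR if_distrib sum.delta cong: if_cong)
  also have "\<dots> = (\<Sum>j=2..m. w j $ i)" by (rule sum_block_shift)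
  also have "\<dots> = vsum l w {2..m} $ i" using w i by (intro vsum_index[symmetric]) auto
  finally show "(I_row m l *\<^sub>v stack m l w) $ i = vsum l w {2..m} $ i" .
qed

text \<open>\<open>J_mat\<close> is partial summation over blocks. Through this lemma the partial
  sums created by the sequential sweep over the blocks become a matrix product.\<close>

lemma J_mat_stack:
  assumes w: "\<And>j. j \<in> {2..m} \<Longrightarrow> w j \<in> carrier_vec l"
  shows "J_mat m l *\<^sub>v stack m l w = stack m l (\<lambda>j. vsum l w {2..j})"
proof (rule eq_vecI)
  fix i assume "i < dim_vec (stack m l (\<lambda>j. vsum l w {2..j}))"
  then have i: "i < (m - 1) * l" by (simp add: stack_def)
  note il = block_index_less[OF i] and ir = block_in_range[OF i]
  have "(J_mat m l *\<^sub>v stack m l w) $ i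
      = (\<Sum>r<(m - 1) * l. (if i mod l = r mod l \<and> i div l \<ge> r div l then 1 else 0) * w (r div l + 2) $ (r mod l))"
    using i by (simp add: J_mat_def stack_def scalar_prod_def lessThan_atLeast0)
  also have "\<dots> = (\<Sum>q<m - 1. \<Sum>p<l. (if i mod l = p \<and> i div l \<ge> q then 1 else 0) * w (q + 2) $ p)"
    by (rule sum_blocks[where F = "\<lambda>q p. (if i mod l = p \<and> i div l \<ge> q then 1 else 0) * w (q + 2) $ p"])
  also have "\<dots> = (\<Sum>q<m - 1. if q + 2 \<le> i div l + 2 then w (q + 2) $ (i mod l) else 0)"
  proof (rule sum.cong[OF refl])
    fix q
    have "(\<Sum>p<l. (if i mod l = p \<and> i div l \<ge> q then 1 else 0) * w (q + 2) $ p)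
        = (\<Sum>p<l. if i mod l = p then (if q + 2 \<le> i div l + 2 then w (q + 2) $ p else 0) else 0)"
      by (intro sum.cong) auto
    also have "\<dots> = (if q + 2 \<le> i div l + 2 then w (q + 2) $ (i mod l) else 0)"
      using il(2) by (subst sum.delta') auto
    finally show "(\<Sum>p<l. (if i mod l = p \<and> i div l \<ge> q then 1 else 0) * w (q + 2) $ p)
        = (if q + 2 \<le> i div l + 2 then w (q + 2) $ (i mod l) else 0)" .
  qed
  also have "\<dots> = (\<Sum>j=2..m. if j \<le> i div l + 2 then w j $ (i mod l) else 0)"
    by (rule sum_block_shift[where h = "\<lambda>j. if j \<le> i div l + 2 then w j $ (i mod l) else 0"])
  also have "\<dots> = (\<Sum>j\<in>{2..i div l + 2}. w j $ (i mod l))"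
    using ir by (intro sum.mono_neutral_cong_right) auto
  also have "\<dots> = vsum l w {2..i div l + 2} $ (i mod l)"
    using w il ir by (intro vsum_index[symmetric]) auto
  finally show "(J_mat m l *\<^sub>v stack m l w) $ i = stack m l (\<lambda>j. vsum l w {2..j}) $ i"
    using i by (simp add: stack_def)
qed (simp add: J_mat_def stack_def)

section \<open>The inverse of the transposed J, the matrices M and Q, and the metric H\<close>

lemma minv_nonsingular:
  assumes D: "D \<in> carrier_mat n n" and det: "det D \<noteq> 0"
  shows "minv D \<in> carrier_mat n n" "D * minv D = 1\<^sub>m n" "minv D * D = 1\<^sub>m n"
proof -
  have "mat_inverse D \<noteq> None"
    using mat_inverse(1)[OF D, of "()"] det_non_zero_imp_unit[OF D det, of "()"] by auto
  then have "mat_inverse D = Some (minv D)" by (simp add: minv_def)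
  from mat_inverse(2)[OF D this]
  show "minv D \<in> carrier_mat n n" "D * minv D = 1\<^sub>m n" "minv D * D = 1\<^sub>m n" by auto
qed

lemma minv_eqI:
  assumes D: "D \<in> carrier_mat n n" and X: "X \<in> carrier_mat n n" and DX: "D * X = 1\<^sub>m n"
  shows "minv D = X"
proof -
  have "det D * det X = 1" using det_mult[OF D X] DX by simp
  then have "det D \<noteq> 0" by auto
  note inv = minv_nonsingular[OF D this]
  have "minv D = minv D * (D * X)" using inv(1) by (simp add: DX)
  also have "\<dots> = X" using assoc_mult_mat[OF inv(1) D X] inv(3) X by simp
  finally show ?thesis .
qed

abbreviation JT_inv :: "nat \<Rightarrow> nat \<Rightarrow> real mat" where
  "JT_inv m l \<equiv> minv (transpose_mat (J_mat m l))"

text \<open>\<open>J_mat\<close> is lower triangular entrywise, not only blockwise, with ones on the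
  diagonal, so its determinant is 1.\<close>

lemma JT_inv:
  "JT_inv m l \<in> carrier_mat ((m - 1) * l) ((m - 1) * l)"
  "transpose_mat (J_mat m l) * JT_inv m l = 1\<^sub>m ((m - 1) * l)"
  "JT_inv m l * transpose_mat (J_mat m l) = 1\<^sub>m ((m - 1) * l)"
proof -
  let ?K = "(m - 1) * l"
  have JT: "transpose_mat (J_mat m l) \<in> carrier_mat ?K ?K" by simp
  have "det (J_mat m l) = prod_list (diag_mat (J_mat m l))"
  proof (rule det_lower_triangular[OF _ J_mat_carrier])
    fix i j assume ij: "i < j" "j < ?K"
    have "\<not> (i mod l = j mod l \<and> i div l \<ge> j div l)"
    proof
      assume le: "i mod l = j mod l \<and> i div l \<ge> j div l"
      then have "j div l * l \<le> i div l * l" by (intro mult_le_mono1) auto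
      with le have "j div l * l + j mod l \<le> i div l * l + i mod l" by linarith
      then show False using ij by simp
    qed
    then show "J_mat m l $$ (i, j) = 0" using ij by (simp add: J_mat_def)
  qed
  also have "\<dots> = 1"
    unfolding prod_list_diag_prod by (rule prod.neutral) (auto simp: J_mat_def)
  finally have "det (transpose_mat (J_mat m l)) \<noteq> 0" by (simp add: det_transpose[OF J_mat_carrier])
  from minv_nonsingular[OF JT this]
  show "JT_inv m l \<in> carrier_mat ?K ?K" "transpose_mat (J_mat m l) * JT_inv m l = 1\<^sub>m ?K"
    "JT_inv m l * transpose_mat (J_mat m l) = 1\<^sub>m ?K" by auto
qed

text \<open>The primal parts of M d and Q d contain the inverse of J^T and J respectively; in their
  inner product these cancel by adjointness.\<close>

lemma JT_inv_J:
  assumes p: "p \<in> carrier_vec ((m - 1) * l)"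
  shows "(JT_inv m l *\<^sub>v p) \<bullet> (J_mat m l *\<^sub>v p) = p \<bullet> p"
proof -
  have R: "JT_inv m l *\<^sub>v p \<in> carrier_vec ((m - 1) * l)"
    by (rule mult_mat_vec_carrier[OF JT_inv(1) p])
  have "(JT_inv m l *\<^sub>v p) \<bullet> (J_mat m l *\<^sub>v p) = (transpose_mat (J_mat m l) *\<^sub>v (JT_inv m l *\<^sub>v p)) \<bullet> p"
    by (rule mat_vec_adjoint[OF J_mat_carrier p R])
  also have "transpose_mat (J_mat m l) *\<^sub>v (JT_inv m l *\<^sub>v p) = p"
    using assoc_mult_mat_vec[OF _ JT_inv(1) p, of "transpose_mat (J_mat m l)" "(m - 1) * l"] JT_inv(2) p
    by simp
  finally show ?thesis .
qed

lemma smult_smult_mat: "a \<cdot>\<^sub>m (b \<cdot>\<^sub>m X) = (a * b :: real) \<cdot>\<^sub>m X"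
  by (intro eq_matI) auto

lemma one_smult_mat: "(1 :: real) \<cdot>\<^sub>m X = X"
  by (intro eq_matI) auto

lemma smult_mult_smult:
  assumes "X \<in> carrier_mat r n" "Y \<in> carrier_mat n c"
  shows "(a \<cdot>\<^sub>m X) * (b \<cdot>\<^sub>m Y) = (a * b :: real) \<cdot>\<^sub>m (X * Y)"
proof -
  have "(a \<cdot>\<^sub>m X) * (b \<cdot>\<^sub>m Y) = a \<cdot>\<^sub>m (X * (b \<cdot>\<^sub>m Y))"
    by (rule mult_smult_assoc_mat[OF assms(1), of _ c]) (use assms in simp)
  also have "X * (b \<cdot>\<^sub>m Y) = b \<cdot>\<^sub>m (X * Y)" by (rule mult_smult_distrib[OF assms])
  finally show ?thesis by (simp add: smult_smult_mat)
qed

lemma block_lower_mult: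
  fixes A1 :: "real mat"
  assumes "A1 \<in> carrier_mat k k" "C1 \<in> carrier_mat l k" "D1 \<in> carrier_mat l l"
    and "A2 \<in> carrier_mat k k" "C2 \<in> carrier_mat l k" "D2 \<in> carrier_mat l l"
  shows "four_block_mat A1 (0\<^sub>m k l) C1 D1 * four_block_mat A2 (0\<^sub>m k l) C2 D2
    = four_block_mat (A1 * A2) (0\<^sub>m k l) (C1 * A2 + D1 * C2) (D1 * D2)"
  using assms by (subst mult_four_block_mat[of _ k k _ l _ l _ _ k _ l]) auto

lemma zero_mult_mat_vec: "(v :: real vec) \<in> carrier_vec n \<Longrightarrow> 0\<^sub>m r n *\<^sub>v v = 0\<^sub>v r"
  by (intro eq_vecI) (auto simp: row_def scalar_prod_def)

lemma block_lower_mult_append: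
  fixes A :: "real mat"
  assumes A: "A \<in> carrier_mat k k" and C: "C \<in> carrier_mat l k" and D: "D \<in> carrier_mat l l"
    and p: "p \<in> carrier_vec k" and q: "q \<in> carrier_vec l"
  shows "four_block_mat A (0\<^sub>m k l) C D *\<^sub>v (p @\<^sub>v q) = (A *\<^sub>v p) @\<^sub>v (C *\<^sub>v p + D *\<^sub>v q)"
proof -
  have "A *\<^sub>v p \<in> carrier_vec k" using A p by simp
  then show ?thesis
    using four_block_mat_mult_vec[OF A zero_carrier_mat C D p q] q by (simp add: zero_mult_mat_vec)
qed

lemma smult_append_vec: "a \<cdot>\<^sub>v (p @\<^sub>v q) = (a \<cdot>\<^sub>v p) @\<^sub>v (a \<cdot>\<^sub>v q)"
  by (intro eq_vecI) auto

text \<open>The square roots of \<open>t\<close> in the inverse of P^T and in N cancel; only one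
  factor \<open>t\<close> survives, in the coupling block.\<close>

lemma M_mat_eq:
  assumes t: "t > 0"
  shows "M_mat m l \<gamma> t = \<gamma> \<cdot>\<^sub>m four_block_mat (JT_inv m l) (0\<^sub>m ((m - 1) * l) l)
    ((- t) \<cdot>\<^sub>m I_row m l) (1\<^sub>m l)"
proof -
  define K where "K = (m - 1) * l"
  define J where "J = J_mat m l"
  define E where "E = I_row m l"
  define R where "R = JT_inv m l"
  have J: "J \<in> carrier_mat K K" and E: "E \<in> carrier_mat l K" and R: "R \<in> carrier_mat K K"
    and JR: "transpose_mat J * R = 1\<^sub>m K"
    using J_mat_carrier I_row_carrier JT_inv by (auto simp: K_def J_def E_def R_def)
  have JT: "transpose_mat J \<in> carrier_mat K K" using J by simp
  \<comment> \<open>The blockwise inverse of P^T; a right inverse is enough to identify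
    \<open>minv\<close>.\<close>
  let ?X = "four_block_mat ((1 / sqrt t) \<cdot>\<^sub>m R) (0\<^sub>m K l) (0\<^sub>m l K) (sqrt t \<cdot>\<^sub>m 1\<^sub>m l)"
  let ?N = "four_block_mat (sqrt t \<cdot>\<^sub>m 1\<^sub>m K) (0\<^sub>m K l) ((- sqrt t) \<cdot>\<^sub>m E) ((1 / sqrt t) \<cdot>\<^sub>m 1\<^sub>m l)"
  have st: "sqrt t \<noteq> 0" "sqrt t * sqrt t = t" using t by auto
  have PT: "transpose_mat (P_mat m l t) = four_block_mat (sqrt t \<cdot>\<^sub>m transpose_mat J)
      (0\<^sub>m K l) (0\<^sub>m l K) ((1 / sqrt t) \<cdot>\<^sub>m 1\<^sub>m l)"
    using J unfolding P_mat_def K_def[symmetric] J_def[symmetric]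
    by (subst transpose_four_block_mat[of _ K K _ l _ l]) (auto intro!: cong_four_block_mat eq_matI)
  have X: "?X \<in> carrier_mat (K + l) (K + l)" using R by simp
  have N: "?N \<in> carrier_mat (K + l) (K + l)" using E by simp
  have "transpose_mat (P_mat m l t) * ?X = 1\<^sub>m (K + l)"
    unfolding PT using R JT
    by (subst block_lower_mult)
      (use t in \<open>auto simp: smult_mult_smult[OF JT R] smult_mult_smult[of _ l l _ l] JR st(1) one_smult_mat\<close>)
  then have "minv (transpose_mat (P_mat m l t)) = ?X"
    using JT by (intro minv_eqI[OF _ X]) (simp_all add: PT)
  moreover have "?X * ?N = four_block_mat R (0\<^sub>m K l) ((- t) \<cdot>\<^sub>m E) (1\<^sub>m l)"
    using R E st
    by (subst block_lower_mult)
      (auto simp: smult_mult_smult[of _ K K _ K] smult_mult_smult[of _ l l _ l] smult_mult_smult[of _ l l _ K])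
  ultimately show ?thesis
    unfolding M_mat_def N_mat_def K_def[symmetric] E_def[symmetric] R_def[symmetric]
    by (simp add: mult_smult_distrib[OF X N])
qed

lemma M_mat_append:
  assumes t: "t > 0" and p: "p \<in> carrier_vec ((m - 1) * l)" and q: "q \<in> carrier_vec l"
  shows "M_mat m l \<gamma> t *\<^sub>v (p @\<^sub>v q)
    = (\<gamma> \<cdot>\<^sub>v (JT_inv m l *\<^sub>v p)) @\<^sub>v (\<gamma> \<cdot>\<^sub>v (q - t \<cdot>\<^sub>v (I_row m l *\<^sub>v p)))"
proof -
  let ?K = "(m - 1) * l"
  let ?M = "four_block_mat (JT_inv m l) (0\<^sub>m ?K l) ((- t) \<cdot>\<^sub>m I_row m l) (1\<^sub>m l)"
  have M: "?M \<in> carrier_mat (?K + l) (?K + l)" using JT_inv(1)[of m l] by simp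
  have E: "(- t) \<cdot>\<^sub>m I_row m l \<in> carrier_mat l ?K" by simp
  have pq: "p @\<^sub>v q \<in> carrier_vec (?K + l)" using p q by simp
  define e where "e = I_row m l *\<^sub>v p"
  have e: "e \<in> carrier_vec l" unfolding e_def by (rule mult_mat_vec_carrier[OF I_row_carrier p])
  have "?M *\<^sub>v (p @\<^sub>v q) = (JT_inv m l *\<^sub>v p) @\<^sub>v (((- t) \<cdot>\<^sub>m I_row m l) *\<^sub>v p + 1\<^sub>m l *\<^sub>v q)"
    by (rule block_lower_mult_append[OF JT_inv(1) E one_carrier_mat p q])
  also have "((- t) \<cdot>\<^sub>m I_row m l) *\<^sub>v p + 1\<^sub>m l *\<^sub>v q = q - t \<cdot>\<^sub>v e"
    unfolding smult_mat_mult_vec[OF I_row_carrier p] e_def[symmetric] using q e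
    by (intro eq_vecI) auto
  finally show ?thesis
    unfolding M_mat_eq[OF t] smult_mat_mult_vec[OF M pq] e_def by (simp add: smult_append_vec)
qed

lemma Q_mat_append:
  assumes p: "p \<in> carrier_vec ((m - 1) * l)" and q: "q \<in> carrier_vec l"
  shows "Q_mat m l t *\<^sub>v (p @\<^sub>v q)
    = (t \<cdot>\<^sub>v (J_mat m l *\<^sub>v p)) @\<^sub>v ((1 / t) \<cdot>\<^sub>v q - I_row m l *\<^sub>v p)"
proof -
  let ?K = "(m - 1) * l"
  have J: "t \<cdot>\<^sub>m J_mat m l \<in> carrier_mat ?K ?K" and D: "(1 / t) \<cdot>\<^sub>m 1\<^sub>m l \<in> carrier_mat l l"
    and E: "- I_row m l \<in> carrier_mat l ?K" by simp_all
  define e where "e = I_row m l *\<^sub>v p"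
  have e: "e \<in> carrier_vec l" unfolding e_def by (rule mult_mat_vec_carrier[OF I_row_carrier p])
  have "(- I_row m l) *\<^sub>v p = - e"
    unfolding e_def using p carrier_matD(2)[OF I_row_carrier] by (intro uminus_mult_mat_vec) simp
  then have "(- I_row m l) *\<^sub>v p + ((1 / t) \<cdot>\<^sub>m 1\<^sub>m l) *\<^sub>v q = (1 / t) \<cdot>\<^sub>v q - e"
    unfolding smult_mat_mult_vec[OF one_carrier_mat q] using q e
    by (intro eq_vecI) auto
  then show ?thesis
    unfolding Q_mat_def block_lower_mult_append[OF J E D p q] smult_mat_mult_vec[OF J_mat_carrier p] e_def
    by simp
qed

lemma J_JT_carrier: "J_mat m l * transpose_mat (J_mat m l) \<in> carrier_mat ((m - 1) * l) ((m - 1) * l)"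
  by (rule mult_carrier_mat[of _ _ "(m - 1) * l"]) simp_all

lemma H0_mat_append:
  assumes p: "p \<in> carrier_vec ((m - 1) * l)" and q: "q \<in> carrier_vec l"
  shows "H0_mat m l \<gamma> \<beta> a *\<^sub>v (p @\<^sub>v q)
    = ((\<beta> / \<gamma>) \<cdot>\<^sub>v (J_mat m l *\<^sub>v (transpose_mat (J_mat m l) *\<^sub>v p))) @\<^sub>v ((a / \<gamma>) \<cdot>\<^sub>v q)"
proof -
  let ?K = "(m - 1) * l" and ?J = "J_mat m l"
  let ?A = "\<beta> \<cdot>\<^sub>m (?J * transpose_mat ?J)" and ?D = "a \<cdot>\<^sub>m 1\<^sub>m l"
  have A: "?A \<in> carrier_mat ?K ?K" and D: "?D \<in> carrier_mat l l"
    using J_JT_carrier[of m l] by simp_all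
  have pq: "p @\<^sub>v q \<in> carrier_vec (?K + l)" using p q by simp
  have JT: "transpose_mat ?J \<in> carrier_mat ?K ?K" by simp
  have 1: "?A *\<^sub>v p = \<beta> \<cdot>\<^sub>v (?J *\<^sub>v (transpose_mat ?J *\<^sub>v p))"
    unfolding smult_mat_mult_vec[OF J_JT_carrier p] assoc_mult_mat_vec[OF J_mat_carrier JT p] ..
  have 2: "0\<^sub>m l ?K *\<^sub>v p + ?D *\<^sub>v q = a \<cdot>\<^sub>v q"
    unfolding smult_mat_mult_vec[OF one_carrier_mat q] zero_mult_mat_vec[OF p] using q by simp
  show ?thesis
    unfolding H0_mat_def smult_mat_mult_vec[OF four_block_carrier_mat[OF A D] pq]
      block_lower_mult_append[OF A zero_carrier_mat D p q] 1 2
    by (simp add: smult_append_vec smult_smult_assoc)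
qed

lemma H0_mat_carrier: "H0_mat m l \<gamma> \<beta> a \<in> carrier_mat ((m - 1) * l + l) ((m - 1) * l + l)"
  unfolding H0_mat_def using J_JT_carrier[of m l]
  by (intro smult_carrier_mat four_block_carrier_mat) simp_all

lemma sqnorm_H0_mat:
  assumes p: "p \<in> carrier_vec ((m - 1) * l)" and q: "q \<in> carrier_vec l"
  shows "sqnorm_wrt (H0_mat m l \<gamma> \<beta> a) (p @\<^sub>v q)
    = (\<beta> * ((transpose_mat (J_mat m l) *\<^sub>v p) \<bullet> (transpose_mat (J_mat m l) *\<^sub>v p)) + a * (q \<bullet> q)) / \<gamma>"
proof -
  let ?K = "(m - 1) * l" and ?J = "J_mat m l"
  have JT: "transpose_mat ?J \<in> carrier_mat ?K ?K" by simp
  have c: "transpose_mat ?J *\<^sub>v p \<in> carrier_vec ?K" by (rule mult_mat_vec_carrier[OF JT p])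
  have c': "?J *\<^sub>v (transpose_mat ?J *\<^sub>v p) \<in> carrier_vec ?K" by (rule mult_mat_vec_carrier[OF J_mat_carrier c])
  have "p \<bullet> (?J *\<^sub>v (transpose_mat ?J *\<^sub>v p)) = (transpose_mat ?J *\<^sub>v p) \<bullet> (transpose_mat ?J *\<^sub>v p)"
    by (rule mat_vec_adjoint[OF J_mat_carrier c p])
  then show ?thesis
    unfolding sqnorm_wrt_def H0_mat_append[OF p q] using p q c'
    by (subst scalar_prod_append[of _ ?K _ l]) (simp_all add: add_divide_distrib)
qed

text \<open>P P^T is block diagonal with blocks t J J^T and I/t, so P P^T / \<gamma> is an instance
  of \<open>H0_mat\<close>. Hence one family of matrices provides both H^k and H_0^k, and all norms
  are computed by the same formula.\<close>

lemma Q_eq_H_M: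
  assumes t: "t > 0" and g: "\<gamma> \<noteq> 0"
  shows "Q_mat m l t = H0_mat m l \<gamma> t (1 / t) * M_mat m l \<gamma> t"
proof -
  define K where "K = (m - 1) * l"
  define J where "J = J_mat m l"
  define E where "E = I_row m l"
  define R where "R = JT_inv m l"
  have J: "J \<in> carrier_mat K K" and E: "E \<in> carrier_mat l K" and R: "R \<in> carrier_mat K K"
    and JR: "transpose_mat J * R = 1\<^sub>m K"
    using J_mat_carrier I_row_carrier JT_inv by (auto simp: K_def J_def E_def R_def)
  have JT: "transpose_mat J \<in> carrier_mat K K" using J by simp
  have JJ: "J * transpose_mat J \<in> carrier_mat K K" using J JT by simp
  let ?H = "four_block_mat (t \<cdot>\<^sub>m (J * transpose_mat J)) (0\<^sub>m K l) (0\<^sub>m l K) ((1 / t) \<cdot>\<^sub>m 1\<^sub>m l)"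
  let ?M = "four_block_mat R (0\<^sub>m K l) ((- t) \<cdot>\<^sub>m E) (1\<^sub>m l)"
  have H: "?H \<in> carrier_mat (K + l) (K + l)" and M: "?M \<in> carrier_mat (K + l) (K + l)"
    using JJ R by simp_all
  have JJR: "J * transpose_mat J * R = J"
    using assoc_mult_mat[OF J JT R] JR J by simp
  have "((1 / t) \<cdot>\<^sub>m 1\<^sub>m l) * ((- t) \<cdot>\<^sub>m E) = - E"
    unfolding smult_mult_smult[OF one_carrier_mat E] using t E by (intro eq_matI) auto
  then have "?H * ?M = four_block_mat (t \<cdot>\<^sub>m J) (0\<^sub>m K l) (- E) ((1 / t) \<cdot>\<^sub>m 1\<^sub>m l)"
    using JJ R E by (subst block_lower_mult) (simp_all add: mult_smult_assoc_mat[OF JJ R] JJR)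
  moreover have "((1 / \<gamma>) \<cdot>\<^sub>m ?H) * (\<gamma> \<cdot>\<^sub>m ?M) = ?H * ?M"
    using smult_mult_smult[OF H M, of "1 / \<gamma>" \<gamma>] g by (simp add: one_smult_mat)
  ultimately show ?thesis
    unfolding H0_mat_def M_mat_eq[OF t] Q_mat_def K_def J_def E_def R_def by simp
qed

text \<open>As H M = Q, the subtracted form pairs M d with Q d, and no separate knowledge of the
  metric is needed.\<close>

lemma sqnorm_G_mat:
  assumes M: "M \<in> carrier_mat n n" and H: "H \<in> carrier_mat n n" and Q: "Q = H * M"
    and d: "d \<in> carrier_vec n"
  shows "sqnorm_wrt (G_mat Q M H) d = 2 * (d \<bullet> (Q *\<^sub>v d)) - (M *\<^sub>v d) \<bullet> (Q *\<^sub>v d)"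
proof -
  have Qc: "Q \<in> carrier_mat n n" using H M Q by simp
  then have Qd: "Q *\<^sub>v d \<in> carrier_vec n" using d by simp
  have MH: "transpose_mat M * H * M = transpose_mat M * Q"
    using assoc_mult_mat[of "transpose_mat M" n n H n M n] M H Q by simp
  have "transpose_mat M * Q \<in> carrier_mat n n" using M Qc by (intro mult_carrier_mat[of _ _ n]) auto
  then have "G_mat Q M H *\<^sub>v d = transpose_mat Q *\<^sub>v d + Q *\<^sub>v d - (transpose_mat M * Q) *\<^sub>v d"
    unfolding G_mat_def MH using Qc d
    by (subst minus_mult_distrib_mat_vec[of _ n n]) (auto simp: add_mult_distrib_mat_vec[of _ n n])
  also have "(transpose_mat M * Q) *\<^sub>v d = transpose_mat M *\<^sub>v (Q *\<^sub>v d)"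
    using M Qc d by (intro assoc_mult_mat_vec[of _ n n _ n]) auto
  finally have G: "G_mat Q M H *\<^sub>v d = transpose_mat Q *\<^sub>v d + Q *\<^sub>v d - transpose_mat M *\<^sub>v (Q *\<^sub>v d)" .
  have c: "transpose_mat Q *\<^sub>v d \<in> carrier_vec n" "transpose_mat M *\<^sub>v (Q *\<^sub>v d) \<in> carrier_vec n"
    using M Qc d Qd by (auto intro!: mult_mat_vec_carrier)
  have 1: "d \<bullet> (transpose_mat Q *\<^sub>v d) = d \<bullet> (Q *\<^sub>v d)"
    using mat_vec_adjoint[OF Qc d d] c(1) d by (simp add: comm_scalar_prod[of d n])
  have 2: "d \<bullet> (transpose_mat M *\<^sub>v (Q *\<^sub>v d)) = (M *\<^sub>v d) \<bullet> (Q *\<^sub>v d)"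
    using mat_vec_adjoint[OF M d Qd] c(2) d M Qd
    by (simp add: comm_scalar_prod[of d n] comm_scalar_prod[of "Q *\<^sub>v d" n])
  have "sqnorm_wrt (G_mat Q M H) d
      = d \<bullet> (transpose_mat Q *\<^sub>v d) + d \<bullet> (Q *\<^sub>v d) - d \<bullet> (transpose_mat M *\<^sub>v (Q *\<^sub>v d))"
    unfolding sqnorm_wrt_def G
    using scalar_prod_minus_distrib[of d n "transpose_mat Q *\<^sub>v d + Q *\<^sub>v d"]
      scalar_prod_add_distrib[of d n "transpose_mat Q *\<^sub>v d"] d c Qd by simp
  then show ?thesis using 1 2 by simp
qed

text \<open>An exact identity: in the expansion of the new distance the term that is quadratic in M
  d is cancelled by the G-norm, and the cross term with v - v' combines with 2 d Q d to the right
  hand side.\<close>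

lemma sqnorm_telescope:
  assumes M: "M \<in> carrier_mat n n" and H: "H \<in> carrier_mat n n" and Q: "Q = H * M"
    and sym: "\<And>x y. x \<in> carrier_vec n \<Longrightarrow> y \<in> carrier_vec n \<Longrightarrow> x \<bullet> (H *\<^sub>v y) = y \<bullet> (H *\<^sub>v x)"
    and v: "v \<in> carrier_vec n" and vt: "vt \<in> carrier_vec n" and v': "v' \<in> carrier_vec n"
  shows "sqnorm_wrt H (v - M *\<^sub>v (v - vt) - v') - sqnorm_wrt H (v - v') + sqnorm_wrt (G_mat Q M H) (v - vt)
    = 2 * ((v' - vt) \<bullet> (Q *\<^sub>v (v - vt)))"
proof -
  define d where "d = v - vt"
  define e where "e = M *\<^sub>v d"
  define w where "w = v - v'"
  define q where "q = Q *\<^sub>v d"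
  have d: "d \<in> carrier_vec n" using v vt by (simp add: d_def)
  have e: "e \<in> carrier_vec n" using M d by (simp add: e_def)
  have w: "w \<in> carrier_vec n" using v v' by (simp add: w_def)
  have q: "q \<in> carrier_vec n" unfolding q_def Q using H M d by (intro mult_mat_vec_carrier[of _ n n]) auto
  have He: "H *\<^sub>v e = q"
    unfolding e_def q_def Q using assoc_mult_mat_vec[OF H M d] by simp
  have Hw: "H *\<^sub>v w \<in> carrier_vec n" using H w by simp
  have ve: "v - e - v' = w - e"
    unfolding w_def using v v' e by (intro eq_vecI) auto
  have "sqnorm_wrt H (w - e) = w \<bullet> (H *\<^sub>v w) - 2 * (w \<bullet> q) + e \<bullet> q"
    unfolding sqnorm_wrt_def mult_minus_distrib_mat_vec[OF H w e] He
    using w e q H sym[OF e w] He by (simp add: ip_simps)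
  moreover have "sqnorm_wrt (G_mat Q M H) d = 2 * (d \<bullet> q) - e \<bullet> q"
    unfolding sqnorm_G_mat[OF M H Q d] q_def e_def ..
  moreover have "(v' - vt) \<bullet> q = d \<bullet> q - w \<bullet> q"
    using v vt v' q by (simp add: d_def w_def ip_simps)
  ultimately show ?thesis
    unfolding d_def[symmetric] e_def[symmetric] w_def[symmetric] q_def[symmetric] ve
    by (simp add: sqnorm_wrt_def)
qed

lemma H0_mat_symmetric:
  assumes "x \<in> carrier_vec ((m - 1) * l + l)" "y \<in> carrier_vec ((m - 1) * l + l)"
  shows "x \<bullet> (H0_mat m l \<gamma> \<beta> a *\<^sub>v y) = y \<bullet> (H0_mat m l \<gamma> \<beta> a *\<^sub>v x)"
proof -
  let ?K = "(m - 1) * l" and ?J = "J_mat m l"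
  have JT: "transpose_mat ?J \<in> carrier_mat ?K ?K" by simp
  obtain p q where x: "x = p @\<^sub>v q" "p \<in> carrier_vec ?K" "q \<in> carrier_vec l"
    using assms(1) vec_first_last_append[of x ?K l] by (metis vec_first_carrier vec_last_carrier)
  obtain p' q' where y: "y = p' @\<^sub>v q'" "p' \<in> carrier_vec ?K" "q' \<in> carrier_vec l"
    using assms(2) vec_first_last_append[of y ?K l] by (metis vec_first_carrier vec_last_carrier)
  have c: "transpose_mat ?J *\<^sub>v p \<in> carrier_vec ?K" "transpose_mat ?J *\<^sub>v p' \<in> carrier_vec ?K"
    using x y by (auto intro!: mult_mat_vec_carrier[OF JT])
  then have c': "?J *\<^sub>v (transpose_mat ?J *\<^sub>v p) \<in> carrier_vec ?K" "?J *\<^sub>v (transpose_mat ?J *\<^sub>v p') \<in> carrier_vec ?K"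
    by (auto intro!: mult_mat_vec_carrier[OF J_mat_carrier])
  show ?thesis
    unfolding x(1) y(1) H0_mat_append[OF x(2,3)] H0_mat_append[OF y(2,3)]
    using x(2,3) y(2,3) c c' mat_vec_adjoint[OF J_mat_carrier c(1) y(2)] mat_vec_adjoint[OF J_mat_carrier c(2) x(2)]
    by (simp add: scalar_prod_append[of _ ?K _ l] comm_scalar_prod[of q l q']
        comm_scalar_prod[OF c])
qed

lemma append_vec_minus:
  assumes "p \<in> carrier_vec k" "p' \<in> carrier_vec k" "q \<in> carrier_vec l" "q' \<in> carrier_vec l"
  shows "(p @\<^sub>v q) - (p' @\<^sub>v q') = (p - p') @\<^sub>v (q - q' :: real vec)"
  using assms by (intro eq_vecI) auto

lemma sum_1_split: "1 \<le> (m::nat) \<Longrightarrow> (\<Sum>j=1..m. g j :: real) = g 1 + (\<Sum>j=2..m. g j)"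
  using sum.atLeast_Suc_atMost[of 1 m g] by (simp add: numeral_2_eq_2 One_nat_def)

text \<open>One coordinate of the residual at the linearisation point of block \<open>j\<close>:
  \<open>a\<close> are the new blocks and \<open>w\<close> the old ones. The proximal correction
  \<open>a j - w j\<close> also switches block \<open>j\<close> to its new value, so exactly the
  blocks 2..j deviate from the sum defining \<open>lamt\<close>.\<close>

lemma sum_switch:
  fixes a w :: "nat \<Rightarrow> real"
  assumes j: "j \<in> {1..m}"
  shows "(\<Sum>i=1..m. if i < j then a i else w i) + a j - w j
    = a 1 + (\<Sum>i=2..m. w i) - (\<Sum>i=2..j. w i - a i)"
proof -
  have m: "1 \<le> m" "1 \<le> j" using j by auto
  have "(\<Sum>i=1..m. if i < j then a i else w i) = (\<Sum>i=1..m. w i) - (\<Sum>i=1..m. if i < j then w i - a i else 0)"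
    unfolding sum_subtractf[symmetric] by (intro sum.cong) auto
  also have "(\<Sum>i=1..m. if i < j then w i - a i else 0) = (\<Sum>i\<in>{1..j} - {j}. w i - a i)"
    using j by (intro sum.mono_neutral_cong_right) auto
  also have "\<dots> = (\<Sum>i=1..j. w i - a i) - (w j - a j)"
    using j by (subst sum_diff1) auto
  finally show ?thesis
    unfolding sum_1_split[OF m(1)] sum_1_split[OF m(2)] by simp
qed

section \<open>One iteration of the algorithm\<close>

locale alg4 =
  fixes m l :: nat and n :: "nat \<Rightarrow> nat"
    and f :: "nat \<Rightarrow> real vec \<Rightarrow> real" and A :: "nat \<Rightarrow> real mat" and b :: "real vec"
    and \<gamma> :: real and \<tau> \<beta> :: "int \<Rightarrow> real"
    and xbr xt xba :: "int \<Rightarrow> blocks"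
    and lam :: "int \<Rightarrow> real vec"
  assumes problem: "problem_P3 m l n f A b"
    and gamma: "0 < \<gamma>" "\<gamma> \<le> 1"
    and algorithm: "algorithm4 m l n f A b \<gamma> \<tau> \<beta> xbr xt xba lam"
begin

abbreviation t where "t k \<equiv> \<tau> k * \<beta> k"
abbreviation res where "res \<equiv> residual m l A b"
definition lamt where
  "lamt k = lam k - t k \<cdot>\<^sub>v (A 1 *\<^sub>v xt k 1 + A_sum l A {2..m} (xba k) - b)"
abbreviation v where "v k \<equiv> v_vec m l A (xba k) (lam k)"
abbreviation vt where "vt k \<equiv> v_vec m l A (xt k) (lamt k)"
definition dl where "dl k j = A j *\<^sub>v xba k j - A j *\<^sub>v xt k j"
definition c where "c k = (1 - \<gamma>) * (1 - \<tau> k) * \<beta> k"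
text \<open>The multiplier of block \<open>j\<close>: minus A_j^T times \<open>s k j\<close> is a
  subgradient of \<open>f j\<close> at \<open>xbr k j\<close>. For \<open>j = 1\<close> the sum is
  empty.\<close>

definition s where "s k j = c k \<cdot>\<^sub>v res (xbr (k - 1)) - lamt k - t k \<cdot>\<^sub>v vsum l (dl k) {2..j}"

lemma m_ge_2: "m \<ge> 2" and l_pos: "l > 0" and b_carrier: "b \<in> carrier_vec l"
  and A_carrier: "j \<in> {1..m} \<Longrightarrow> A j \<in> carrier_mat l (n j)"
  and f_convex: "j \<in> {1..m} \<Longrightarrow> convex_fun (n j) (f j)"
  using problem by (auto simp: problem_P3_def)

lemma step:
  assumes "k \<ge> 0"
  shows "xbr k \<in> block_space m n" "xba (k + 1) \<in> block_space m n" "\<beta> k > 0"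
    "j \<in> {1..m} \<Longrightarrow> is_arg_min
      (\<lambda>y. f j y + y \<bullet> partial_gradient_phi m l n A b (\<beta> k) j
          (\<lambda>i. if i < j then xbr k i else (1 - \<tau> k) \<cdot>\<^sub>v xbr (k - 1) i + \<tau> k \<cdot>\<^sub>v xba k i)
          (lam k + (\<gamma> * (1 - \<tau> k) * \<beta> k) \<cdot>\<^sub>v res (xbr (k - 1)))
        + \<beta> k / 2 * sqnorm_wrt (transpose_mat (A j) * A j)
            (y - ((1 - \<tau> k) \<cdot>\<^sub>v xbr (k - 1) j + \<tau> k \<cdot>\<^sub>v xba k j)))
      (\<lambda>y. y \<in> carrier_vec (n j)) (xbr k j)"
    "j \<in> {1..m} \<Longrightarrow> xt k j = (1 / \<tau> k) \<cdot>\<^sub>v xbr k j - ((1 - \<tau> k) / \<tau> k) \<cdot>\<^sub>v xbr (k - 1) j"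
    "stack m l (\<lambda>j. A j *\<^sub>v xba (k + 1) j) = stack m l (\<lambda>j. A j *\<^sub>v xba k j)
      - \<gamma> \<cdot>\<^sub>v (JT_inv m l *\<^sub>v stack m l (\<lambda>j. A j *\<^sub>v xba k j - A j *\<^sub>v xt k j))"
    "lam (k + 1) = lam k - (\<gamma> * \<tau> k * \<beta> k) \<cdot>\<^sub>v res (xt k)"
proof -
  note alg = algorithm[unfolded algorithm4_def Let_def, THEN conjunct2, THEN conjunct2, THEN conjunct2,
      rule_format, OF assms]
  show "xbr k \<in> block_space m n" "xba (k + 1) \<in> block_space m n" "\<beta> k > 0" using alg by auto
  note alg' = alg[THEN conjunct2, THEN conjunct2, THEN conjunct2]
  from alg'[THEN conjunct1] show "j \<in> {1..m} \<Longrightarrow> is_arg_min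
      (\<lambda>y. f j y + y \<bullet> partial_gradient_phi m l n A b (\<beta> k) j
          (\<lambda>i. if i < j then xbr k i else (1 - \<tau> k) \<cdot>\<^sub>v xbr (k - 1) i + \<tau> k \<cdot>\<^sub>v xba k i)
          (lam k + (\<gamma> * (1 - \<tau> k) * \<beta> k) \<cdot>\<^sub>v res (xbr (k - 1)))
        + \<beta> k / 2 * sqnorm_wrt (transpose_mat (A j) * A j)
            (y - ((1 - \<tau> k) \<cdot>\<^sub>v xbr (k - 1) j + \<tau> k \<cdot>\<^sub>v xba k j)))
      (\<lambda>y. y \<in> carrier_vec (n j)) (xbr k j)" by (rule bspec)
  from alg'[THEN conjunct2, THEN conjunct1]
  show "j \<in> {1..m} \<Longrightarrow> xt k j = (1 / \<tau> k) \<cdot>\<^sub>v xbr k j - ((1 - \<tau> k) / \<tau> k) \<cdot>\<^sub>v xbr (k - 1) j"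
    by (rule bspec)
  from alg'[THEN conjunct2, THEN conjunct2, THEN conjunct2, THEN conjunct1]
  show "stack m l (\<lambda>j. A j *\<^sub>v xba (k + 1) j) = stack m l (\<lambda>j. A j *\<^sub>v xba k j)
      - \<gamma> \<cdot>\<^sub>v (JT_inv m l *\<^sub>v stack m l (\<lambda>j. A j *\<^sub>v xba k j - A j *\<^sub>v xt k j))" .
  from alg'[THEN conjunct2, THEN conjunct2, THEN conjunct2, THEN conjunct2]
  show "lam (k + 1) = lam k - (\<gamma> * \<tau> k * \<beta> k) \<cdot>\<^sub>v res (xt k)" .
qed

lemma init: "xbr (- 1) \<in> block_space m n" "xba 0 \<in> block_space m n" "lam 0 \<in> carrier_vec l"
  using algorithm unfolding algorithm4_def by blast+

lemma xbr_mem: "k \<ge> - 1 \<Longrightarrow> xbr k \<in> block_space m n"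
  using step(1)[of k] init(1) by (cases "k = - 1") auto

lemma xba_mem: "k \<ge> 0 \<Longrightarrow> xba k \<in> block_space m n"
  using step(2)[of "k - 1"] init(2) by (cases "k = 0") auto

lemma mem_blockD: "x \<in> block_space m n \<Longrightarrow> j \<in> {1..m} \<Longrightarrow> x j \<in> carrier_vec (n j)"
  by (simp add: block_space_def)

lemma xt_mem: "k \<ge> 0 \<Longrightarrow> xt k \<in> block_space m n"
  unfolding block_space_def
proof (intro CollectI ballI)
  fix j assume k: "k \<ge> 0" and j: "j \<in> {1..m}"
  then show "xt k j \<in> carrier_vec (n j)"
    using mem_blockD[OF xbr_mem j, of k] mem_blockD[OF xbr_mem j, of "k - 1"] step(5)[OF k j] by simp
qed

lemma A_mult_carrier: "x \<in> block_space m n \<Longrightarrow> j \<in> {1..m} \<Longrightarrow> A j *\<^sub>v x j \<in> carrier_vec l"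
  by (rule mult_mat_vec_carrier[OF A_carrier mem_blockD])

lemma res_carrier: "res x \<in> carrier_vec l"
  by (rule carrier_vecI) (use b_carrier in \<open>simp add: residual_def\<close>)

lemma res_index:
  assumes "x \<in> block_space m n" "p < l"
  shows "res x $ p = (\<Sum>j=1..m. (A j *\<^sub>v x j) $ p) - b $ p"
  unfolding residual_def A_sum_def using vsum_index[OF _ A_mult_carrier[OF assms(1)] assms(2), of "{1..m}"]
    b_carrier assms(2) by simp

lemma lam_carrier: "k \<ge> 0 \<Longrightarrow> lam k \<in> carrier_vec l"
proof (cases "k = 0")
  case True
  then show ?thesis using init(3) by simp
next
  case False
  assume "k \<ge> 0"
  with False have "k - 1 \<ge> 0" by simp
  from step(7)[OF this] show ?thesis
    by (intro carrier_vecI) (use carrier_vecD[OF res_carrier] in simp)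
qed

lemma tail_mem: "j \<in> {2..m} \<Longrightarrow> j \<in> {1..m}" by auto

lemma one_mem: "1 \<in> {1..m}" using m_ge_2 by auto

lemma m_mem: "m \<in> {1..m}" using m_ge_2 by auto

lemma lamt_carrier: "lamt k \<in> carrier_vec l"
  by (rule carrier_vecI) (use b_carrier in \<open>simp add: lamt_def\<close>)

lemma dl_carrier: "k \<ge> 0 \<Longrightarrow> j \<in> {1..m} \<Longrightarrow> dl k j \<in> carrier_vec l"
  unfolding dl_def using A_mult_carrier[OF xba_mem] A_mult_carrier[OF xt_mem] by simp

lemma vsum_dl_carrier: "k \<ge> 0 \<Longrightarrow> j \<in> {1..m} \<Longrightarrow> vsum l (dl k) {2..j} \<in> carrier_vec l"
  by (intro vsum_carrier dl_carrier) auto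

lemma s_carrier: "k \<ge> 0 \<Longrightarrow> j \<in> {1..m} \<Longrightarrow> s k j \<in> carrier_vec l"
  unfolding s_def by (rule carrier_vecI) (use vsum_dl_carrier[of k j] in simp)

lemma lamt_index:
  assumes k: "k \<ge> 0" and p: "p < l"
  shows "lamt k $ p = lam k $ p - t k * ((A 1 *\<^sub>v xt k 1) $ p + (\<Sum>j=2..m. (A j *\<^sub>v xba k j) $ p) - b $ p)"
proof -
  have "A_sum l A {2..m} (xba k) \<in> carrier_vec l"
    unfolding A_sum_def by (intro vsum_carrier A_mult_carrier xba_mem k tail_mem)
  moreover have "A_sum l A {2..m} (xba k) $ p = (\<Sum>j=2..m. (A j *\<^sub>v xba k j) $ p)"
    unfolding A_sum_def by (intro vsum_index A_mult_carrier xba_mem k tail_mem p) auto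
  ultimately show ?thesis
    unfolding lamt_def using p lam_carrier[OF k] b_carrier A_mult_carrier[OF xt_mem[OF k] one_mem] by simp
qed

lemma vsum_dl_index:
  assumes k: "k \<ge> 0" and j: "j \<in> {1..m}" and p: "p < l"
  shows "vsum l (dl k) {2..j} $ p = (\<Sum>i=2..j. (A i *\<^sub>v xba k i) $ p - (A i *\<^sub>v xt k i) $ p)"
proof -
  have im: "i \<in> {1..m}" if "i \<in> {2..j}" for i using that j by auto
  have "vsum l (dl k) {2..j} $ p = (\<Sum>i=2..j. dl k i $ p)"
    by (intro vsum_index dl_carrier k im p) auto
  also have "\<dots> = (\<Sum>i=2..j. (A i *\<^sub>v xba k i) $ p - (A i *\<^sub>v xt k i) $ p)"
    using carrier_vecD[OF A_mult_carrier[OF xt_mem[OF k] im]] p by (intro sum.cong) (auto simp: dl_def)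
  finally show ?thesis .
qed

lemma xbr_eq:
  assumes k: "k \<ge> 0" and tau: "0 < \<tau> k" and j: "j \<in> {1..m}"
  shows "xbr k j = (1 - \<tau> k) \<cdot>\<^sub>v xbr (k - 1) j + \<tau> k \<cdot>\<^sub>v xt k j"
  using step(5)[OF k j] tau mem_blockD[OF xbr_mem j, of k] mem_blockD[OF xbr_mem j, of "k - 1"] k
  by (intro eq_vecI) (auto simp: field_simps)

lemma A_xbr_index:
  assumes k: "k \<ge> 0" and tau: "0 < \<tau> k" and j: "j \<in> {1..m}" and p: "p < l"
  shows "(A j *\<^sub>v xbr k j) $ p = (1 - \<tau> k) * (A j *\<^sub>v xbr (k - 1) j) $ p + \<tau> k * (A j *\<^sub>v xt k j) $ p"
proof -
  have x: "xbr (k - 1) j \<in> carrier_vec (n j)" "xt k j \<in> carrier_vec (n j)"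
    using mem_blockD[OF xbr_mem j, of "k - 1"] mem_blockD[OF xt_mem j] k by auto
  have "A j *\<^sub>v xbr k j = (1 - \<tau> k) \<cdot>\<^sub>v (A j *\<^sub>v xbr (k - 1) j) + \<tau> k \<cdot>\<^sub>v (A j *\<^sub>v xt k j)"
    unfolding xbr_eq[OF k tau j] using x
    by (simp add: mult_add_distrib_mat_vec[OF A_carrier[OF j]] mult_mat_vec[OF A_carrier[OF j]])
  then show ?thesis using p A_carrier[OF j] by (simp del: index_mult_mat_vec)
qed

text \<open>The residual is affine and the weights add up to 1, so \<open>b\<close> is
  reproduced.\<close>

lemma res_recursion:
  assumes k: "k \<ge> 0" and tau: "0 < \<tau> k"
  shows "res (xbr k) = (1 - \<tau> k) \<cdot>\<^sub>v res (xbr (k - 1)) + \<tau> k \<cdot>\<^sub>v res (xt k)"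
proof (rule eq_vecI)
  show "dim_vec (res (xbr k)) = dim_vec ((1 - \<tau> k) \<cdot>\<^sub>v res (xbr (k - 1)) + \<tau> k \<cdot>\<^sub>v res (xt k))"
    using carrier_vecD[OF res_carrier] by simp
  fix p assume "p < dim_vec ((1 - \<tau> k) \<cdot>\<^sub>v res (xbr (k - 1)) + \<tau> k \<cdot>\<^sub>v res (xt k))"
  then have p: "p < l" using carrier_vecD[OF res_carrier] by simp
  have xm: "xbr (k - 1) \<in> block_space m n" using xbr_mem k by simp
  have "res (xbr k) $ p = (\<Sum>j=1..m. (1 - \<tau> k) * (A j *\<^sub>v xbr (k - 1) j) $ p + \<tau> k * (A j *\<^sub>v xt k j) $ p) - b $ p"
    unfolding res_index[OF step(1)[OF k] p]
    by (intro arg_cong2[where f = "(-)"] sum.cong refl A_xbr_index k tau p)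
  also have "\<dots> = (1 - \<tau> k) * res (xbr (k - 1)) $ p + \<tau> k * res (xt k) $ p"
    unfolding res_index[OF xt_mem[OF k] p] res_index[OF xm p] sum.distrib sum_distrib_left[symmetric]
    by (simp only: algebra_simps)
  finally show "res (xbr k) $ p = ((1 - \<tau> k) \<cdot>\<^sub>v res (xbr (k - 1)) + \<tau> k \<cdot>\<^sub>v res (xt k)) $ p"
    using p carrier_vecD[OF res_carrier] by simp
qed

text \<open>This is the multiplier row of Q applied to v - vt. \<open>lamt\<close> is formed with
  the old blocks 2..m, and subtracting the sum of the differences \<open>dl\<close> replaces them by
  the new ones.\<close>

lemma res_xt_eq:
  assumes k: "k \<ge> 0" and t: "0 < t k"
  shows "(1 / t k) \<cdot>\<^sub>v (lam k - lamt k) - vsum l (dl k) {2..m} = res (xt k)"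
proof (rule eq_vecI)
  note cs = carrier_vecD[OF res_carrier] carrier_vecD[OF lam_carrier[OF k]] carrier_vecD[OF lamt_carrier]
    carrier_vecD[OF vsum_dl_carrier[OF k m_mem]]
  show "dim_vec ((1 / t k) \<cdot>\<^sub>v (lam k - lamt k) - vsum l (dl k) {2..m}) = dim_vec (res (xt k))"
    by (simp add: cs)
  fix p assume "p < dim_vec (res (xt k))"
  then have p: "p < l" by (simp add: cs)
  have "((1 / t k) \<cdot>\<^sub>v (lam k - lamt k) - vsum l (dl k) {2..m}) $ p
      = (1 / t k) * (lam k $ p - lamt k $ p) - vsum l (dl k) {2..m} $ p"
    using p by (simp add: cs)
  also have "(1 / t k) * (lam k $ p - lamt k $ p)
      = (A 1 *\<^sub>v xt k 1) $ p + (\<Sum>j=2..m. (A j *\<^sub>v xba k j) $ p) - b $ p"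
  proof -
    have "(1 / u) * (x - (x - u * y)) = y" if "0 < u" for u x y :: real using that by simp
    from this[OF t] show ?thesis unfolding lamt_index[OF k p] .
  qed
  also have "\<dots> - vsum l (dl k) {2..m} $ p = res (xt k) $ p"
    unfolding vsum_dl_index[OF k m_mem p] res_index[OF xt_mem[OF k] p]
    using sum_1_split[of m "\<lambda>j. (A j *\<^sub>v xt k j) $ p"] m_ge_2 by (simp add: sum_subtractf del: index_mult_mat_vec)
  finally show "((1 / t k) \<cdot>\<^sub>v (lam k - lamt k) - vsum l (dl k) {2..m}) $ p = res (xt k) $ p" .
qed

text \<open>The penalty gradient and the proximal derivative share the factor A_j^T, so they merge
  into one vector. The old residual enters with weight (1 - \<tau>)\<beta> from the penalty, and the
  extrapolated multiplier takes back the \<gamma>-fraction, which leaves the weight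
  \<open>c k\<close>.\<close>

lemma subproblem_multiplier:
  fixes k :: int and j :: nat
  defines "xh \<equiv> \<lambda>i. (1 - \<tau> k) \<cdot>\<^sub>v xbr (k - 1) i + \<tau> k \<cdot>\<^sub>v xba k i"
  defines "X \<equiv> \<lambda>i. if i < j then xbr k i else xh i"
  assumes k: "k \<ge> 0" and tau: "0 < \<tau> k" and j: "j \<in> {1..m}"
  shows "(\<beta> k \<cdot>\<^sub>v res X - (lam k + (\<gamma> * (1 - \<tau> k) * \<beta> k) \<cdot>\<^sub>v res (xbr (k - 1))))
      + \<beta> k \<cdot>\<^sub>v (A j *\<^sub>v (xbr k j - xh j)) = s k j"
proof (rule eq_vecI)
  note cs = carrier_vecD[OF res_carrier] carrier_vecD[OF lam_carrier[OF k]] carrier_vecD[OF lamt_carrier]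
    carrier_vecD[OF vsum_dl_carrier[OF k j]] carrier_matD[OF A_carrier]
  have xm: "xbr (k - 1) \<in> block_space m n" using xbr_mem k by simp
  have xh: "xh \<in> block_space m n"
    using mem_blockD[OF xm] mem_blockD[OF xba_mem[OF k]] by (auto simp: xh_def block_space_def)
  then have X: "X \<in> block_space m n" using step(1)[OF k] by (auto simp: X_def block_space_def)
  show "dim_vec ((\<beta> k \<cdot>\<^sub>v res X - (lam k + (\<gamma> * (1 - \<tau> k) * \<beta> k) \<cdot>\<^sub>v res (xbr (k - 1))))
      + \<beta> k \<cdot>\<^sub>v (A j *\<^sub>v (xbr k j - xh j))) = dim_vec (s k j)"
    using j by (simp add: s_def cs)
  fix p assume "p < dim_vec (s k j)"
  then have p: "p < l" by (simp add: s_def cs)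
  define al where "al = (\<lambda>i. (A i *\<^sub>v xbr (k - 1) i) $ p)"
  define a where "a = (\<lambda>i. (A i *\<^sub>v xt k i) $ p)"
  define w where "w = (\<lambda>i. (A i *\<^sub>v xba k i) $ p)"
  have xb: "(A i *\<^sub>v xbr k i) $ p = (1 - \<tau> k) * al i + \<tau> k * a i" if "i \<in> {1..m}" for i
    using A_xbr_index[OF k tau that p] by (simp add: al_def a_def)
  have Axh: "(A i *\<^sub>v xh i) $ p = (1 - \<tau> k) * al i + \<tau> k * w i" if i: "i \<in> {1..m}" for i
  proof -
    have "A i *\<^sub>v xh i = (1 - \<tau> k) \<cdot>\<^sub>v (A i *\<^sub>v xbr (k - 1) i) + \<tau> k \<cdot>\<^sub>v (A i *\<^sub>v xba k i)"
      unfolding xh_def using mem_blockD[OF xm i] mem_blockD[OF xba_mem[OF k] i]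
      by (simp add: mult_add_distrib_mat_vec[OF A_carrier[OF i]] mult_mat_vec[OF A_carrier[OF i]])
    then show ?thesis using p A_carrier[OF i] by (simp add: al_def w_def del: index_mult_mat_vec)
  qed
  have resX: "res X $ p = (1 - \<tau> k) * (\<Sum>i=1..m. al i) + \<tau> k * (\<Sum>i=1..m. if i < j then a i else w i) - b $ p"
  proof -
    have "(\<Sum>i=1..m. (A i *\<^sub>v X i) $ p) = (\<Sum>i=1..m. (1 - \<tau> k) * al i + \<tau> k * (if i < j then a i else w i))"
      using xb Axh by (intro sum.cong) (auto simp: X_def)
    then show ?thesis unfolding res_index[OF X p] by (simp add: sum.distrib sum_distrib_left)
  qed
  have dif: "(A j *\<^sub>v (xbr k j - xh j)) $ p = \<tau> k * (a j - w j)"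
    unfolding mult_minus_distrib_mat_vec[OF A_carrier[OF j] mem_blockD[OF step(1)[OF k] j] mem_blockD[OF xh j]]
    using p j xb[OF j] Axh[OF j] by (simp add: cs algebra_simps del: index_mult_mat_vec)
  have r: "res (xbr (k - 1)) $ p = (\<Sum>i=1..m. al i) - b $ p"
    unfolding res_index[OF xm p] al_def ..
  have lt: "lamt k $ p = lam k $ p - t k * (a 1 + (\<Sum>i=2..m. w i) - b $ p)"
    unfolding lamt_index[OF k p] a_def w_def ..
  have vs: "vsum l (dl k) {2..j} $ p = (\<Sum>i=2..j. w i - a i)"
    unfolding vsum_dl_index[OF k j p] a_def w_def ..
  have "((\<beta> k \<cdot>\<^sub>v res X - (lam k + (\<gamma> * (1 - \<tau> k) * \<beta> k) \<cdot>\<^sub>v res (xbr (k - 1))))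
      + \<beta> k \<cdot>\<^sub>v (A j *\<^sub>v (xbr k j - xh j))) $ p
    = \<beta> k * res X $ p - (lam k $ p + \<gamma> * (1 - \<tau> k) * \<beta> k * res (xbr (k - 1)) $ p)
      + \<beta> k * (A j *\<^sub>v (xbr k j - xh j)) $ p"
    using p j by (simp add: cs del: index_mult_mat_vec)
  \<comment> \<open>All differences are put next to the mixed sum so that \<open>sum_switch\<close>
    applies; afterwards \<open>b\<close> is split with weights 1 - \<tau> and \<tau>.\<close>
  also have "\<dots> = \<beta> k * ((1 - \<tau> k) * (\<Sum>i=1..m. al i) - b $ p
      + \<tau> k * ((\<Sum>i=1..m. if i < j then a i else w i) + a j - w j))
      - (lam k $ p + \<gamma> * (1 - \<tau> k) * \<beta> k * ((\<Sum>i=1..m. al i) - b $ p))"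
    unfolding resX dif r by (simp add: algebra_simps)
  also have "\<dots> = c k * ((\<Sum>i=1..m. al i) - b $ p)
      - (lam k $ p - t k * (a 1 + (\<Sum>i=2..m. w i) - b $ p)) - t k * (\<Sum>i=2..j. w i - a i)"
    unfolding sum_switch[OF j] c_def by (simp add: algebra_simps)
  also have "\<dots> = s k j $ p" using p by (simp add: s_def cs r lt vs)
  finally show "((\<beta> k \<cdot>\<^sub>v res X - (lam k + (\<gamma> * (1 - \<tau> k) * \<beta> k) \<cdot>\<^sub>v res (xbr (k - 1))))
      + \<beta> k \<cdot>\<^sub>v (A j *\<^sub>v (xbr k j - xh j))) $ p = s k j $ p" .
qed

lemma block_optimality:
  assumes k: "k \<ge> 0" and tau: "0 < \<tau> k" and j: "j \<in> {1..m}" and y: "y \<in> carrier_vec (n j)"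
  shows "0 \<le> f j y - f j (xbr k j) + (A j *\<^sub>v (y - xbr k j)) \<bullet> s k j"
proof -
  let ?xh = "\<lambda>i. (1 - \<tau> k) \<cdot>\<^sub>v xbr (k - 1) i + \<tau> k \<cdot>\<^sub>v xba k i"
  let ?X = "\<lambda>i. if i < j then xbr k i else ?xh i"
  let ?lamh = "lam k + (\<gamma> * (1 - \<tau> k) * \<beta> k) \<cdot>\<^sub>v res (xbr (k - 1))"
  have xm: "xbr (k - 1) \<in> block_space m n" using xbr_mem k by simp
  have xh: "?xh \<in> block_space m n"
    using mem_blockD[OF xm] mem_blockD[OF xba_mem[OF k]] by (auto simp: block_space_def)
  then have X: "?X \<in> block_space m n" using step(1)[OF k] by (auto simp: block_space_def)
  have lamh: "?lamh \<in> carrier_vec l" using lam_carrier[OF k] res_carrier by simp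
  have g: "partial_gradient_phi m l n A b (\<beta> k) j ?X ?lamh
      = transpose_mat (A j) *\<^sub>v (\<beta> k \<cdot>\<^sub>v res ?X - ?lamh)"
    by (rule partial_gradient_phi_eq[OF A_carrier b_carrier X lamh j])
  define q where "q = \<beta> k \<cdot>\<^sub>v res ?X - ?lamh"
  have q: "q \<in> carrier_vec l" unfolding q_def using lamh res_carrier by simp
  have AT: "transpose_mat (A j) \<in> carrier_mat (n j) l" using A_carrier[OF j] by simp
  have x: "xbr k j \<in> carrier_vec (n j)" using mem_blockD[OF step(1)[OF k] j] .
  have yx: "y - xbr k j \<in> carrier_vec (n j)" using y x by simp
  have u: "A j *\<^sub>v (y - xbr k j) \<in> carrier_vec l" using A_carrier[OF j] yx by simp
  have e: "A j *\<^sub>v (xbr k j - ?xh j) \<in> carrier_vec l"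
    using A_carrier[OF j] x mem_blockD[OF xh j] by (intro mult_mat_vec_carrier[of _ _ "n j"]) auto
  have ATq: "transpose_mat (A j) *\<^sub>v q \<in> carrier_vec (n j)" using AT q by simp
  have "0 \<le> f j y - f j (xbr k j) + (y - xbr k j) \<bullet> (transpose_mat (A j) *\<^sub>v q)
      + \<beta> k * ((A j *\<^sub>v (y - xbr k j)) \<bullet> (A j *\<^sub>v (xbr k j - ?xh j)))"
    by (rule prox_step_optimality[OF A_carrier[OF j] f_convex[OF j] ATq mem_blockD[OF xh j]
          step(4)[OF k j, unfolded g, folded q_def] y])
  also have "(y - xbr k j) \<bullet> (transpose_mat (A j) *\<^sub>v q) = (A j *\<^sub>v (y - xbr k j)) \<bullet> q"
    using mat_vec_adjoint[OF A_carrier[OF j] yx q] u q yx ATq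
    by (simp add: comm_scalar_prod[of q l] comm_scalar_prod[of "transpose_mat (A j) *\<^sub>v q" "n j"])
  finally have "0 \<le> f j y - f j (xbr k j) + ((A j *\<^sub>v (y - xbr k j)) \<bullet> q
      + (A j *\<^sub>v (y - xbr k j)) \<bullet> (\<beta> k \<cdot>\<^sub>v (A j *\<^sub>v (xbr k j - ?xh j))))"
    using u e by (simp add: add.assoc)
  also have "(A j *\<^sub>v (y - xbr k j)) \<bullet> q + (A j *\<^sub>v (y - xbr k j)) \<bullet> (\<beta> k \<cdot>\<^sub>v (A j *\<^sub>v (xbr k j - ?xh j)))
      = (A j *\<^sub>v (y - xbr k j)) \<bullet> (q + \<beta> k \<cdot>\<^sub>v (A j *\<^sub>v (xbr k j - ?xh j)))"
    using u e q by (intro scalar_prod_add_distrib[symmetric, of _ l]) auto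
  also have "q + \<beta> k \<cdot>\<^sub>v (A j *\<^sub>v (xbr k j - ?xh j)) = s k j"
    unfolding q_def by (rule subproblem_multiplier[OF k tau j])
  finally show ?thesis .
qed

end

section \<open>Triangular sums, the update of v, the descent inequality and the G-norm\<close>

lemma sum_triangle:
  fixes x :: "nat \<Rightarrow> real"
  shows "2 * (\<Sum>j=2..m. x j * (\<Sum>i=2..j. x i)) = (\<Sum>j=2..m. (x j)\<^sup>2) + (\<Sum>j=2..m. x j)\<^sup>2"
proof (induction m)
  case (Suc m)
  show ?case
  proof (cases "Suc m \<ge> 2")
    case True
    then have "m \<noteq> 0" by simp
    from True have "(\<Sum>j=2..Suc m. g j) = (\<Sum>j=2..m. g j) + g (Suc m)" for g :: "nat \<Rightarrow> real"
      by simp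
    with Suc.IH \<open>m \<noteq> 0\<close> show ?thesis by (simp add: power2_eq_square algebra_simps)
  qed simp
qed simp

text \<open>In matrix terms J + J^T = I + E^T E, where E is \<open>I_row\<close>; this is the primal
  part of the symmetrised Q.\<close>

lemma vsum_triangle:
  fixes w :: "nat \<Rightarrow> real vec"
  assumes w: "\<And>j. j \<in> {2..m} \<Longrightarrow> w j \<in> carrier_vec l"
  shows "2 * (\<Sum>j=2..m. w j \<bullet> vsum l w {2..j})
    = (\<Sum>j=2..m. w j \<bullet> w j) + vsum l w {2..m} \<bullet> vsum l w {2..m}"
proof -
  have sub: "i \<in> {2..m}" if "j \<in> {2..m}" "i \<in> {2..j}" for i j using that by auto
  have dot: "x \<bullet> y = (\<Sum>p<l. x $ p * y $ p)" if "y \<in> carrier_vec l" for x y :: "real vec"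
    using that by (simp add: scalar_prod_def lessThan_atLeast0)
  have c: "vsum l w {2..j} \<in> carrier_vec l" if "j \<in> {2..m}" for j
    by (intro vsum_carrier w sub[OF that])
  have i: "vsum l w {2..j} $ p = (\<Sum>i=2..j. w i $ p)" if "j \<in> {2..m}" "p < l" for j p
    using that sub by (intro vsum_index w) auto
  have cm: "vsum l w {2..m} \<in> carrier_vec l" by (intro vsum_carrier w)
  have im: "vsum l w {2..m} $ p = (\<Sum>i=2..m. w i $ p)" if "p < l" for p
    using that by (intro vsum_index w) auto
  have "(\<Sum>j=2..m. w j \<bullet> vsum l w {2..j}) = (\<Sum>j=2..m. \<Sum>p<l. w j $ p * (\<Sum>i=2..j. w i $ p))"
    by (intro sum.cong refl) (simp add: dot[OF c] i)
  also have "\<dots> = (\<Sum>p<l. \<Sum>j=2..m. w j $ p * (\<Sum>i=2..j. w i $ p))" by (rule sum.swap)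
  finally have "2 * (\<Sum>j=2..m. w j \<bullet> vsum l w {2..j})
      = (\<Sum>p<l. 2 * (\<Sum>j=2..m. w j $ p * (\<Sum>i=2..j. w i $ p)))" by (simp only: sum_distrib_left)
  also have "\<dots> = (\<Sum>p<l. \<Sum>j=2..m. (w j $ p)\<^sup>2) + (\<Sum>p<l. (\<Sum>j=2..m. w j $ p)\<^sup>2)"
    unfolding sum_triangle sum.distrib ..
  also have "(\<Sum>p<l. \<Sum>j=2..m. (w j $ p)\<^sup>2) = (\<Sum>j=2..m. \<Sum>p<l. (w j $ p)\<^sup>2)" by (rule sum.swap)
  also have "\<dots> = (\<Sum>j=2..m. w j \<bullet> w j)"
    by (intro sum.cong refl) (simp add: dot[OF w] power2_eq_square)
  also have "(\<Sum>p<l. (\<Sum>j=2..m. w j $ p)\<^sup>2) = vsum l w {2..m} \<bullet> vsum l w {2..m}"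
    by (simp add: dot[OF cm] im power2_eq_square)
  finally show ?thesis .
qed

context alg4
begin

lemma v_vec_carrier: "lam' \<in> carrier_vec l \<Longrightarrow> v_vec m l A x lam' \<in> carrier_vec ((m - 1) * l + l)"
  by (simp add: v_vec_def)

lemma v_vec_minus:
  assumes "x \<in> block_space m n" "y \<in> block_space m n" "lam1 \<in> carrier_vec l" "lam2 \<in> carrier_vec l"
  shows "v_vec m l A x lam1 - v_vec m l A y lam2
    = stack m l (\<lambda>j. A j *\<^sub>v x j - A j *\<^sub>v y j) @\<^sub>v (lam1 - lam2)"
  unfolding v_vec_def append_vec_minus[OF stack_carrier stack_carrier assms(3,4)]
  by (subst stack_minus[OF A_mult_carrier[OF assms(1) tail_mem] A_mult_carrier[OF assms(2) tail_mem]]) auto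

lemma v_minus_vt:
  assumes "k \<ge> 0"
  shows "v k - vt k = stack m l (dl k) @\<^sub>v (lam k - lamt k)"
proof -
  have "dl k = (\<lambda>j. A j *\<^sub>v xba k j - A j *\<^sub>v xt k j)" by (simp add: fun_eq_iff dl_def)
  with v_vec_minus[OF xba_mem[OF assms] xt_mem[OF assms] lam_carrier[OF assms] lamt_carrier, of k]
  show ?thesis by simp
qed

lemma J_dl: "k \<ge> 0 \<Longrightarrow> J_mat m l *\<^sub>v stack m l (dl k) = stack m l (\<lambda>j. vsum l (dl k) {2..j})"
  by (rule J_mat_stack) (rule dl_carrier[OF _ tail_mem])

lemma I_row_dl: "k \<ge> 0 \<Longrightarrow> I_row m l *\<^sub>v stack m l (dl k) = vsum l (dl k) {2..m}"
  by (rule I_row_stack) (rule dl_carrier[OF _ tail_mem])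

lemma Q_v_minus_vt:
  assumes k: "k \<ge> 0" and t: "0 < t k"
  shows "Q_mat m l (t k) *\<^sub>v (v k - vt k)
    = (t k \<cdot>\<^sub>v stack m l (\<lambda>j. vsum l (dl k) {2..j})) @\<^sub>v res (xt k)"
proof -
  have q: "lam k - lamt k \<in> carrier_vec l" using lam_carrier[OF k] lamt_carrier by simp
  show ?thesis
    unfolding v_minus_vt[OF k] Q_mat_append[OF stack_carrier q] res_xt_eq[OF k t, symmetric]
      J_dl[OF k] I_row_dl[OF k] ..
qed

lemma M_v_minus_vt:
  assumes k: "k \<ge> 0" and t: "0 < t k"
  shows "M_mat m l \<gamma> (t k) *\<^sub>v (v k - vt k)
    = (\<gamma> \<cdot>\<^sub>v (JT_inv m l *\<^sub>v stack m l (dl k))) @\<^sub>v ((\<gamma> * t k) \<cdot>\<^sub>v res (xt k))"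
proof -
  have q: "lam k - lamt k \<in> carrier_vec l" using lam_carrier[OF k] lamt_carrier by simp
  have vs: "vsum l (dl k) {2..m} \<in> carrier_vec l" by (rule vsum_dl_carrier[OF k m_mem])
  have "(lam k - lamt k) - t k \<cdot>\<^sub>v vsum l (dl k) {2..m} = t k \<cdot>\<^sub>v res (xt k)"
    unfolding res_xt_eq[OF k t, symmetric] using t vs q
    by (intro eq_vecI) (auto simp: right_diff_distrib carrier_vecD[OF lamt_carrier])
  then show ?thesis
    unfolding v_minus_vt[OF k] M_mat_append[OF t stack_carrier q] I_row_dl[OF k]
    by (simp add: smult_smult_assoc)
qed

lemma v_update:
  assumes k: "k \<ge> 0" and t: "0 < t k"
  shows "v (k + 1) = v k - M_mat m l \<gamma> (t k) *\<^sub>v (v k - vt k)"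
proof -
  have R: "\<gamma> \<cdot>\<^sub>v (JT_inv m l *\<^sub>v stack m l (dl k)) \<in> carrier_vec ((m - 1) * l)"
    using mult_mat_vec_carrier[OF JT_inv(1) stack_carrier] by simp
  have r: "(\<gamma> * t k) \<cdot>\<^sub>v res (xt k) \<in> carrier_vec l" using res_carrier by simp
  show ?thesis
    unfolding M_v_minus_vt[OF k t] unfolding v_vec_def append_vec_minus[OF stack_carrier R lam_carrier[OF k] r]
      step(6)[OF k] step(7)[OF k] by (simp add: mult.assoc dl_def[abs_def])
qed

text \<open>The term (lam' - lamt) paired with the residual of \<open>xt\<close> occurs both in the
  F-part and in the multiplier row of Q and cancels. What is left separates over the blocks, so the
  claim reduces to one inequality per block, for arbitrary \<open>lam'\<close>.\<close>

lemma inner_identity: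
  assumes k: "k \<ge> 0" and t: "0 < t k" and x: "x \<in> block_space m n" and lam': "lam' \<in> carrier_vec l"
  shows "u_inner m (u_diff (x, lam') (xt k, lamt k)) (F_op m l A b (xt k, lamt k))
      + c k * (A_op m l A (\<lambda>i. x i - xt k i) \<bullet> res (xbr (k - 1)))
      - (v_vec m l A x lam' - vt k) \<bullet> (Q_mat m l (t k) *\<^sub>v (v k - vt k))
    = (\<Sum>j=1..m. (A j *\<^sub>v (x j - xt k j)) \<bullet> s k j)"
proof -
  define e where "e = (\<lambda>j. A j *\<^sub>v (x j - xt k j))"
  have xd: "x j - xt k j \<in> carrier_vec (n j)" if "j \<in> {1..m}" for j
    using mem_blockD[OF x that] mem_blockD[OF xt_mem[OF k] that] by simp
  have e: "e j \<in> carrier_vec l" if "j \<in> {1..m}" for j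
    unfolding e_def by (rule mult_mat_vec_carrier[OF A_carrier[OF that] xd[OF that]])
  have e_alt: "e j = A j *\<^sub>v x j - A j *\<^sub>v xt k j" if "j \<in> {1..m}" for j
    unfolding e_def by (rule mult_minus_distrib_mat_vec[OF A_carrier[OF that] mem_blockD[OF x that] mem_blockD[OF xt_mem[OF k] that]])
  have F: "u_inner m (u_diff (x, lam') (xt k, lamt k)) (F_op m l A b (xt k, lamt k))
      = - (\<Sum>j=1..m. e j \<bullet> lamt k) + (lam' - lamt k) \<bullet> res (xt k)"
  proof -
    have "(x j - xt k j) \<bullet> - (transpose_mat (A j) *\<^sub>v lamt k) = - (e j \<bullet> lamt k)" if j: "j \<in> {1..m}" for j
    proof -
      have AT: "transpose_mat (A j) *\<^sub>v lamt k \<in> carrier_vec (n j)"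
        using A_carrier[OF j] lamt_carrier by (intro mult_mat_vec_carrier[of _ _ l]) auto
      have "(x j - xt k j) \<bullet> (transpose_mat (A j) *\<^sub>v lamt k) = (transpose_mat (A j) *\<^sub>v lamt k) \<bullet> (x j - xt k j)"
        by (rule comm_scalar_prod[OF xd[OF j] AT])
      also have "\<dots> = lamt k \<bullet> e j"
        unfolding e_def by (rule mat_vec_adjoint[OF A_carrier[OF j] xd[OF j] lamt_carrier, symmetric])
      also have "\<dots> = e j \<bullet> lamt k" by (rule comm_scalar_prod[OF lamt_carrier e[OF j]])
      finally show ?thesis using carrier_vecD[OF xd[OF j]] carrier_vecD[OF AT]
        by (subst scalar_prod_uminus_right) auto
    qed
    then show ?thesis by (simp add: u_inner_def u_diff_def F_op_def sum_negf)
  qed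
  have Ar: "A_op m l A (\<lambda>i. x i - xt k i) \<bullet> res (xbr (k - 1)) = (\<Sum>j=1..m. e j \<bullet> res (xbr (k - 1)))"
    unfolding A_sum_def e_def[symmetric] by (intro vsum_scalar_left e res_carrier) auto
  have q: "lam' - lamt k \<in> carrier_vec l" using lam' lamt_carrier by simp
  have V: "v_vec m l A x lam' - vt k = stack m l e @\<^sub>v (lam' - lamt k)"
    unfolding v_vec_minus[OF x xt_mem[OF k] lam' lamt_carrier]
    using stack_cong[of m e "\<lambda>j. A j *\<^sub>v x j - A j *\<^sub>v xt k j" l, OF e_alt[OF tail_mem]] by simp
  have vs: "vsum l (dl k) {2..j} \<in> carrier_vec l" if "j \<in> {1..m}" for j
    by (rule vsum_dl_carrier[OF k that])
  have Q: "(v_vec m l A x lam' - vt k) \<bullet> (Q_mat m l (t k) *\<^sub>v (v k - vt k))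
      = t k * (\<Sum>j=2..m. e j \<bullet> vsum l (dl k) {2..j}) + (lam' - lamt k) \<bullet> res (xt k)"
    unfolding V Q_v_minus_vt[OF k t]
  proof (subst scalar_prod_append[OF stack_carrier q _ res_carrier])
    show "stack m l e \<bullet> (t k \<cdot>\<^sub>v stack m l (\<lambda>j. vsum l (dl k) {2..j})) + (lam' - lamt k) \<bullet> res (xt k)
        = t k * (\<Sum>j=2..m. e j \<bullet> vsum l (dl k) {2..j}) + (lam' - lamt k) \<bullet> res (xt k)"
      using stack_scalar_prod[where w = e, OF vs[OF tail_mem]]
        scalar_prod_smult_distrib[OF stack_carrier stack_carrier] by simp
  qed simp
  have sj: "e j \<bullet> s k j = c k * (e j \<bullet> res (xbr (k - 1))) - e j \<bullet> lamt k - t k * (e j \<bullet> vsum l (dl k) {2..j})"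
    if j: "j \<in> {1..m}" for j
    unfolding s_def using e[OF j] lamt_carrier vs[OF j] carrier_vecD[OF res_carrier]
    by (simp add: ip_simps)
  have "(\<Sum>j=1..m. e j \<bullet> s k j) = c k * (\<Sum>j=1..m. e j \<bullet> res (xbr (k - 1)))
      - (\<Sum>j=1..m. e j \<bullet> lamt k) - t k * (\<Sum>j=1..m. e j \<bullet> vsum l (dl k) {2..j})"
    using sum.cong[OF refl sj, of "{1..m}" "\<lambda>j. j"] by (simp add: sum_subtractf sum_distrib_left)
  \<comment> \<open>Q has no row for block 1; the corresponding summand is zero because its inner
    sum is empty.\<close>
  also have "(\<Sum>j=1..m. e j \<bullet> vsum l (dl k) {2..j}) = (\<Sum>j=2..m. e j \<bullet> vsum l (dl k) {2..j})"
  proof -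
    have "vsum l (dl k) {2..1} = 0\<^sub>v l" by (simp add: finsum_vec_empty)
    then show ?thesis using sum_1_split[of m] m_ge_2 e[OF one_mem] by simp
  qed
  finally show ?thesis unfolding F Ar Q by (simp add: e_def)
qed

text \<open>\<open>E\<close> is an additional gain in the last block: zero in the first regime, the
  cocoercivity term in the second. This lets both regimes share the summation over the
  blocks.\<close>

lemma descent_inequality:
  assumes k: "k \<ge> 0" and tau: "0 < \<tau> k" and x: "x \<in> block_space m n" and lam': "lam' \<in> carrier_vec l"
    and blocks: "\<And>j. j \<in> {1..m} \<Longrightarrow> (if j = m then E else 0)
      \<le> \<tau> k * f j (x j) + (1 - \<tau> k) * f j (xbr (k - 1) j) - f j (xbr k j)
        + \<tau> k * ((A j *\<^sub>v (x j - xt k j)) \<bullet> s k j)"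
  shows "E + \<tau> k * ((v_vec m l A x lam' - vt k) \<bullet> (Q_mat m l (t k) *\<^sub>v (v k - vt k)))
    \<le> \<tau> k * objective m f x + (1 - \<tau> k) * objective m f (xbr (k - 1)) - objective m f (xbr k)
      + \<tau> k * (u_inner m (u_diff (x, lam') (xt k, lamt k)) (F_op m l A b (xt k, lamt k))
          + c k * (A_op m l A (\<lambda>i. x i - xt k i) \<bullet> res (xbr (k - 1))))"
proof -
  have t: "0 < t k" using tau step(3)[OF k] by simp
  have "E = (\<Sum>j=1..m. if j = m then E else 0)" using m_ge_2 by (simp add: sum.delta)
  also have "\<dots> \<le> (\<Sum>j=1..m. \<tau> k * f j (x j) + (1 - \<tau> k) * f j (xbr (k - 1) j) - f j (xbr k j)
        + \<tau> k * ((A j *\<^sub>v (x j - xt k j)) \<bullet> s k j))"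
    by (intro sum_mono blocks)
  also have "\<dots> = \<tau> k * objective m f x + (1 - \<tau> k) * objective m f (xbr (k - 1)) - objective m f (xbr k)
      + \<tau> k * (\<Sum>j=1..m. (A j *\<^sub>v (x j - xt k j)) \<bullet> s k j)"
    unfolding objective_def by (simp add: sum.distrib sum_subtractf sum_distrib_left)
  finally show ?thesis
    unfolding inner_identity[OF k t x lam', symmetric] by (simp add: algebra_simps)
qed

lemma extrapolated_minus:
  assumes k: "k \<ge> 0" and tau: "0 < \<tau> k" and j: "j \<in> {1..m}" and x: "x \<in> block_space m n"
  shows "(1 - \<tau> k) \<cdot>\<^sub>v xbr (k - 1) j + \<tau> k \<cdot>\<^sub>v x j - xbr k j = \<tau> k \<cdot>\<^sub>v (x j - xt k j)"
proof -
  have "xbr (k - 1) j \<in> carrier_vec (n j)" using mem_blockD[OF xbr_mem j, of "k - 1"] k by simp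
  then show ?thesis
    unfolding xbr_eq[OF k tau j] using mem_blockD[OF x j] mem_blockD[OF xt_mem[OF k] j]
    by (intro eq_vecI) (auto simp: algebra_simps)
qed

lemma block_inequality:
  assumes k: "k \<ge> 0" and tau: "0 < \<tau> k" "\<tau> k < 1" and j: "j \<in> {1..m}" and x: "x \<in> block_space m n"
  shows "0 \<le> \<tau> k * f j (x j) + (1 - \<tau> k) * f j (xbr (k - 1) j) - f j (xbr k j)
        + \<tau> k * ((A j *\<^sub>v (x j - xt k j)) \<bullet> s k j)"
proof -
  let ?y = "(1 - \<tau> k) \<cdot>\<^sub>v xbr (k - 1) j + \<tau> k \<cdot>\<^sub>v x j"
  have xb: "xbr (k - 1) j \<in> carrier_vec (n j)" using mem_blockD[OF xbr_mem j, of "k - 1"] k by simp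
  have xj: "x j \<in> carrier_vec (n j)" by (rule mem_blockD[OF x j])
  have d: "x j - xt k j \<in> carrier_vec (n j)" using xj mem_blockD[OF xt_mem[OF k] j] by simp
  have y: "?y \<in> carrier_vec (n j)" using xb xj by simp
  have "0 \<le> f j ?y - f j (xbr k j) + (A j *\<^sub>v (?y - xbr k j)) \<bullet> s k j"
    by (rule block_optimality[OF k tau(1) j y])
  also have "A j *\<^sub>v (?y - xbr k j) = \<tau> k \<cdot>\<^sub>v (A j *\<^sub>v (x j - xt k j))"
    unfolding extrapolated_minus[OF k tau(1) j x] by (rule mult_mat_vec[OF A_carrier[OF j] d])
  also have "\<dots> \<bullet> s k j = \<tau> k * ((A j *\<^sub>v (x j - xt k j)) \<bullet> s k j)"
    by (rule smult_scalar_prod_distrib[OF mult_mat_vec_carrier[OF A_carrier[OF j] d] s_carrier[OF k j]])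
  also have "f j ?y \<le> (1 - \<tau> k) * f j (xbr (k - 1) j) + \<tau> k * f j (x j)"
  proof -
    have "0 \<le> \<tau> k \<and> \<tau> k \<le> 1" using tau by simp
    with f_convex[OF j] xb xj show ?thesis unfolding convex_fun_def by blast
  qed
  finally show ?thesis by simp
qed

lemma sqnorm_H0_v:
  assumes "x \<in> block_space m n" "y \<in> block_space m n" "lam1 \<in> carrier_vec l" "lam2 \<in> carrier_vec l"
  shows "sqnorm_wrt (H0_mat m l \<gamma> B a) (v_vec m l A x lam1 - v_vec m l A y lam2)
    = (B * (vnorm (transpose_mat (J_mat m l) *\<^sub>v stack m l (\<lambda>j. A j *\<^sub>v x j - A j *\<^sub>v y j)))\<^sup>2
       + a * (vnorm (lam1 - lam2))\<^sup>2) / \<gamma>"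
proof -
  have q: "lam1 - lam2 \<in> carrier_vec l" using assms by simp
  show ?thesis unfolding v_vec_minus[OF assms] sqnorm_H0_mat[OF stack_carrier q] vnorm_sq ..
qed

lemma telescope:
  assumes k: "k \<ge> 0" and t: "0 < t k" and v': "v' \<in> carrier_vec ((m - 1) * l + l)"
  shows "sqnorm_wrt (H0_mat m l \<gamma> (t k) (1 / t k)) (v (k + 1) - v')
      - sqnorm_wrt (H0_mat m l \<gamma> (t k) (1 / t k)) (v k - v')
      + sqnorm_wrt (G_mat (Q_mat m l (t k)) (M_mat m l \<gamma> (t k)) (H0_mat m l \<gamma> (t k) (1 / t k))) (v k - vt k)
    = 2 * ((v' - vt k) \<bullet> (Q_mat m l (t k) *\<^sub>v (v k - vt k)))"
proof -
  have M: "M_mat m l \<gamma> (t k) \<in> carrier_mat ((m - 1) * l + l) ((m - 1) * l + l)"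
    unfolding M_mat_eq[OF t] using JT_inv(1)[of m l] by simp
  have Q: "Q_mat m l (t k) = H0_mat m l \<gamma> (t k) (1 / t k) * M_mat m l \<gamma> (t k)"
    by (rule Q_eq_H_M[OF t]) (use gamma in simp)
  show ?thesis
    unfolding v_update[OF k t]
    by (rule sqnorm_telescope[OF M H0_mat_carrier Q H0_mat_symmetric v_vec_carrier[OF lam_carrier[OF k]]
          v_vec_carrier[OF lamt_carrier] v'])
qed

text \<open>With S the sum and P the squared norm of the block differences and r the residual, the
  G-norm is exactly (1 - \<gamma>) t P + t |S + r|^2 + (1 - \<gamma>) t |r|^2. The first two terms
  are dropped.\<close>

lemma G_lower_bound:
  assumes k: "k \<ge> 0" and t: "0 < t k"
  shows "(1 - \<gamma>) * t k * (vnorm (res (xt k)))\<^sup>2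
    \<le> sqnorm_wrt (G_mat (Q_mat m l (t k)) (M_mat m l \<gamma> (t k)) (H0_mat m l \<gamma> (t k) (1 / t k))) (v k - vt k)"
proof -
  define p where "p = stack m l (dl k)"
  define q where "q = lam k - lamt k"
  define r where "r = res (xt k)"
  define S where "S = vsum l (dl k) {2..m}"
  define P where "P = (\<Sum>j=2..m. dl k j \<bullet> dl k j)"
  let ?W = "stack m l (\<lambda>j. vsum l (dl k) {2..j})"
  let ?R = "JT_inv m l *\<^sub>v p"
  have p: "p \<in> carrier_vec ((m - 1) * l)" by (simp add: p_def)
  have q: "q \<in> carrier_vec l" using lam_carrier[OF k] lamt_carrier by (simp add: q_def)
  have r: "r \<in> carrier_vec l" by (simp add: r_def res_carrier)
  have S: "S \<in> carrier_vec l" unfolding S_def by (rule vsum_dl_carrier[OF k m_mem])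
  have R: "?R \<in> carrier_vec ((m - 1) * l)" by (rule mult_mat_vec_carrier[OF JT_inv(1) p])
  have M: "M_mat m l \<gamma> (t k) \<in> carrier_mat ((m - 1) * l + l) ((m - 1) * l + l)"
    unfolding M_mat_eq[OF t] using JT_inv(1)[of m l] by simp
  have Q: "Q_mat m l (t k) = H0_mat m l \<gamma> (t k) (1 / t k) * M_mat m l \<gamma> (t k)"
    by (rule Q_eq_H_M[OF t]) (use gamma in simp)
  have d: "v k - vt k \<in> carrier_vec ((m - 1) * l + l)"
    using v_vec_carrier[OF lam_carrier[OF k]] v_vec_carrier[OF lamt_carrier] by simp
  have JW: "J_mat m l *\<^sub>v p = ?W" unfolding p_def by (rule J_mat_stack[OF dl_carrier[OF k tail_mem]])
  have pp: "p \<bullet> p = P" unfolding p_def P_def by (rule stack_scalar_prod[OF dl_carrier[OF k tail_mem]])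
  have RW: "?R \<bullet> ?W = P" using JT_inv_J[OF p] by (simp add: JW pp)
  have "2 * (\<Sum>j=2..m. dl k j \<bullet> vsum l (dl k) {2..j}) = P + S \<bullet> S"
    unfolding P_def S_def by (rule vsum_triangle[OF dl_carrier[OF k tail_mem]])
  then have pW: "2 * (p \<bullet> ?W) = P + S \<bullet> S"
    unfolding p_def by (subst stack_scalar_prod[OF vsum_dl_carrier[OF k tail_mem]])
  have "(1 / t k) \<cdot>\<^sub>v q - S = r" unfolding q_def S_def r_def by (rule res_xt_eq[OF k t])
  then have qr: "q \<bullet> r = t k * (S \<bullet> r + r \<bullet> r)"
  proof -
    assume eq: "(1 / t k) \<cdot>\<^sub>v q - S = r"
    have "r \<bullet> r = (1 / t k) * (q \<bullet> r) - S \<bullet> r"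
      using arg_cong[OF eq, of "\<lambda>z. z \<bullet> r"] q S r by (simp add: ip_simps)
    moreover have "z = u * (y + x)" if "x = (1 / u) * z - y" "0 < u" for u x y z :: real
      using that by simp
    ultimately show ?thesis using t by blast
  qed
  have dQ: "(v k - vt k) \<bullet> (Q_mat m l (t k) *\<^sub>v (v k - vt k)) = t k * (p \<bullet> ?W) + q \<bullet> r"
    unfolding Q_v_minus_vt[OF k t] unfolding v_minus_vt[OF k] p_def[symmetric] q_def[symmetric] r_def[symmetric]
    using p q r by (subst scalar_prod_append[OF p q _ r]) auto
  have MQ: "(M_mat m l \<gamma> (t k) *\<^sub>v (v k - vt k)) \<bullet> (Q_mat m l (t k) *\<^sub>v (v k - vt k))
      = \<gamma> * t k * P + \<gamma> * t k * (r \<bullet> r)"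
    unfolding Q_v_minus_vt[OF k t] M_v_minus_vt[OF k t] p_def[symmetric] r_def[symmetric]
    using R r RW by (subst scalar_prod_append[of _ "(m - 1) * l" _ l]) auto
  have "0 \<le> P" unfolding P_def by (intro sum_nonneg scalar_prod_self_nonneg)
  then have P: "0 \<le> (1 - \<gamma>) * t k * P" using gamma t by simp
  have "0 \<le> (S + r) \<bullet> (S + r)" by (rule scalar_prod_self_nonneg)
  also have "(S + r) \<bullet> (S + r) = S \<bullet> S + 2 * (S \<bullet> r) + r \<bullet> r"
    using S r by (simp add: ip_simps comm_scalar_prod[of r l S])
  finally have Sr: "0 \<le> t k * (S \<bullet> S + 2 * (S \<bullet> r) + r \<bullet> r)" using t by simp
  have "2 * (t k * (p \<bullet> ?W) + q \<bullet> r) - (\<gamma> * t k * P + \<gamma> * t k * (r \<bullet> r))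
      = (1 - \<gamma>) * t k * P + t k * (S \<bullet> S + 2 * (S \<bullet> r) + r \<bullet> r) + (1 - \<gamma>) * t k * (r \<bullet> r)"
  proof -
    have "2 * (t k * (p \<bullet> ?W)) = t k * (P + S \<bullet> S)" by (simp add: pW[symmetric])
    then show ?thesis unfolding qr by (simp add: algebra_simps)
  qed
  then show ?thesis
    unfolding sqnorm_G_mat[OF M H0_mat_carrier Q d] dQ MQ vnorm_sq r_def[symmetric] using P Sr by linarith
qed

end

section \<open>Smooth last block\<close>

context alg4
begin

lemma gradient_last_block:
  assumes lip: "gradient_Lipschitz (n m) (f m) L" and k: "k \<ge> 0" and tau: "0 < \<tau> k"
  shows "gradient (n m) (f m) (xbr k m) = - (transpose_mat (A m) *\<^sub>v s k m)"
proof -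
  have x: "xbr k m \<in> carrier_vec (n m)" by (rule mem_blockD[OF step(1)[OF k] m_mem])
  have AT: "transpose_mat (A m) *\<^sub>v s k m \<in> carrier_vec (n m)"
    using A_carrier[OF m_mem] s_carrier[OF k m_mem] by (intro mult_mat_vec_carrier[of _ _ l]) auto
  then have G: "- (transpose_mat (A m) *\<^sub>v s k m) \<in> carrier_vec (n m)" by simp
  have "- (transpose_mat (A m) *\<^sub>v s k m) = gradient (n m) (f m) (xbr k m)"
  proof (rule subgradient_eq_gradient[OF gradient_Lipschitz_has_gradient[OF lip x] x G])
    fix y :: "real vec" assume y: "y \<in> carrier_vec (n m)"
    have d: "y - xbr k m \<in> carrier_vec (n m)" using x y by simp
    have Ad: "A m *\<^sub>v (y - xbr k m) \<in> carrier_vec l" by (rule mult_mat_vec_carrier[OF A_carrier[OF m_mem] d])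
    have "(A m *\<^sub>v (y - xbr k m)) \<bullet> s k m = (transpose_mat (A m) *\<^sub>v s k m) \<bullet> (y - xbr k m)"
      using mat_vec_adjoint[OF A_carrier[OF m_mem] d s_carrier[OF k m_mem]]
      by (simp add: comm_scalar_prod[OF Ad s_carrier[OF k m_mem]])
    moreover have "- (transpose_mat (A m) *\<^sub>v s k m) \<bullet> (y - xbr k m)
        = - ((transpose_mat (A m) *\<^sub>v s k m) \<bullet> (y - xbr k m))"
      by (rule scalar_prod_uminus_left) (simp only: carrier_vecD[OF AT] carrier_vecD[OF d])
    ultimately show "- (transpose_mat (A m) *\<^sub>v s k m) \<bullet> (y - xbr k m) \<le> f m y - f m (xbr k m)"
      using block_optimality[OF k tau m_mem y] by linarith
  qed
  then show ?thesis by simp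
qed

text \<open>Both inequalities are based at \<open>xbr k\<close>: the cocoercive one towards
  \<open>x\<close> with weight \<tau>, the plain gradient one towards the previous iterate with
  weight 1 - \<tau>. The weighted displacement is \<tau>(x - xt), and the optimality condition turns
  the gradient into the multiplier \<open>s k m\<close>.\<close>

lemma smooth_block_inequality:
  assumes lip: "gradient_Lipschitz (n m) (f m) L"
    and k: "k \<ge> 0" and tau: "0 < \<tau> k" "\<tau> k < 1" and x: "x \<in> block_space m n"
  shows "\<tau> k * (1 / (2 * L) * (vnorm (gradient (n m) (f m) (xbr k m) - gradient (n m) (f m) (x m)))\<^sup>2)
    \<le> \<tau> k * f m (x m) + (1 - \<tau> k) * f m (xbr (k - 1) m) - f m (xbr k m)
        + \<tau> k * ((A m *\<^sub>v (x m - xt k m)) \<bullet> s k m)"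
proof -
  define g where "g = gradient (n m) (f m) (xbr k m)"
  define N where "N = 1 / (2 * L) * (vnorm (g - gradient (n m) (f m) (x m)))\<^sup>2"
  have xb: "xbr k m \<in> carrier_vec (n m)" by (rule mem_blockD[OF step(1)[OF k] m_mem])
  have xp: "xbr (k - 1) m \<in> carrier_vec (n m)" using mem_blockD[OF xbr_mem m_mem, of "k - 1"] k by simp
  have xm: "x m \<in> carrier_vec (n m)" by (rule mem_blockD[OF x m_mem])
  have d: "x m - xt k m \<in> carrier_vec (n m)" using xm mem_blockD[OF xt_mem[OF k] m_mem] by simp
  have hg: "has_gradient (n m) (f m) g (xbr k m)"
    unfolding g_def by (rule gradient_Lipschitz_has_gradient[OF lip xb])
  then have g: "g \<in> carrier_vec (n m)" by (simp add: has_gradient_def)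
  have 1: "f m (xbr k m) + g \<bullet> (x m - xbr k m) + N \<le> f m (x m)"
    using gradient_cocoercive[OF f_convex[OF m_mem] lip xb xm] unfolding N_def g_def vnorm_sq .
  have 2: "g \<bullet> (xbr (k - 1) m - xbr k m) \<le> f m (xbr (k - 1) m) - f m (xbr k m)"
    by (rule convex_gradient_ineq[OF f_convex[OF m_mem] hg xb xp])
  have Ad: "A m *\<^sub>v (x m - xt k m) \<in> carrier_vec l" by (rule mult_mat_vec_carrier[OF A_carrier[OF m_mem] d])
  have AT: "transpose_mat (A m) *\<^sub>v s k m \<in> carrier_vec (n m)"
    using A_carrier[OF m_mem] s_carrier[OF k m_mem] by (intro mult_mat_vec_carrier[of _ _ l]) auto
  have gd: "g \<bullet> (x m - xt k m) = - ((A m *\<^sub>v (x m - xt k m)) \<bullet> s k m)"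
  proof -
    have "g \<bullet> (x m - xt k m) = - ((transpose_mat (A m) *\<^sub>v s k m) \<bullet> (x m - xt k m))"
      unfolding g_def gradient_last_block[OF lip k tau(1)]
      by (rule scalar_prod_uminus_left) (simp only: carrier_vecD[OF AT] carrier_vecD[OF d])
    also have "(transpose_mat (A m) *\<^sub>v s k m) \<bullet> (x m - xt k m) = (A m *\<^sub>v (x m - xt k m)) \<bullet> s k m"
      using mat_vec_adjoint[OF A_carrier[OF m_mem] d s_carrier[OF k m_mem]]
      by (simp add: comm_scalar_prod[OF Ad s_carrier[OF k m_mem]])
    finally show ?thesis .
  qed
  have "\<tau> k * (g \<bullet> (x m - xt k m)) = g \<bullet> (\<tau> k \<cdot>\<^sub>v (x m - xt k m))" using g d by simp
  also have "\<dots> = (1 - \<tau> k) * (g \<bullet> xbr (k - 1) m) + \<tau> k * (g \<bullet> x m) - g \<bullet> xbr k m"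
    unfolding extrapolated_minus[OF k tau(1) m_mem x, symmetric] using g xb xp xm by (simp add: ip_simps)
  also have "\<dots> = (1 - \<tau> k) * (g \<bullet> (xbr (k - 1) m - xbr k m)) + \<tau> k * (g \<bullet> (x m - xbr k m))"
    unfolding scalar_prod_minus_distrib[OF g xp xb] scalar_prod_minus_distrib[OF g xm xb]
    by (simp add: left_diff_distrib right_diff_distrib)
  finally have 3: "(1 - \<tau> k) * (g \<bullet> (xbr (k - 1) m - xbr k m)) + \<tau> k * (g \<bullet> (x m - xbr k m))
      = - (\<tau> k * ((A m *\<^sub>v (x m - xt k m)) \<bullet> s k m))" unfolding gd by simp
  have combine: "u * N \<le> u * F + (1 - u) * F' - F0 + u * W"
    if "F0 + p + N \<le> F" "q \<le> F' - F0" "(1 - u) * q + u * p = - (u * W)" "0 < u" "u < 1"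
    for u N F F' F0 W p q :: real
  proof -
    have "u * (F0 + p + N) \<le> u * F" "(1 - u) * q \<le> (1 - u) * (F' - F0)"
      using that by (intro mult_left_mono; simp)+
    then show ?thesis using that(3) by (simp add: algebra_simps)
  qed
  from combine[OF 1 2 3 tau] show ?thesis unfolding g_def N_def .
qed

lemma saddle_feasible:
  assumes "saddle_point m l n f A b xs lams"
  shows "xs \<in> block_space m n" "lams \<in> carrier_vec l" "res xs = 0\<^sub>v l"
proof -
  show "xs \<in> block_space m n" and lams: "lams \<in> carrier_vec l" using assms by (auto simp: saddle_point_def)
  have r: "res xs \<in> carrier_vec l" by (rule res_carrier)
  \<comment> \<open>This test multiplier raises the Lagrangian by the squared norm of the residual,
    which maximality in the multiplier forbids unless it is zero.\<close>
  have "lams - res xs \<in> carrier_vec l" using lams r by simp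
  then have "lagrangian m l f A b xs (lams - res xs) \<le> lagrangian m l f A b xs lams"
    using assms unfolding saddle_point_def by blast
  then have "res xs \<bullet> res xs \<le> 0"
    using lams r by (simp add: lagrangian_def ip_simps)
  then have "res xs \<bullet> res xs = 0" using scalar_prod_self_nonneg[of "res xs"] by simp
  then show "res xs = 0\<^sub>v l" by (rule scalar_prod_self_eq_0[OF r])
qed

lemma saddle_lagrangian_gap:
  assumes S: "saddle_point m l n f A b xs lams" and x: "x \<in> block_space m n"
  shows "objective m f xs \<le> objective m f x - lams \<bullet> res x"
proof -
  have "lagrangian m l f A b xs lams \<le> lagrangian m l f A b x lams"
    using S x unfolding saddle_point_def by blast
  then show ?thesis using saddle_feasible[OF S] by (simp add: lagrangian_def)
qed

text \<open>Changing only block \<open>m\<close> of the saddle point turns the minimality of the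
  Lagrangian into a subgradient inequality for \<open>f m\<close>.\<close>

lemma saddle_gradient:
  assumes S: "saddle_point m l n f A b xs lams" and lip: "gradient_Lipschitz (n m) (f m) L"
  shows "gradient (n m) (f m) (xs m) = transpose_mat (A m) *\<^sub>v lams"
proof -
  note xs = saddle_feasible(1)[OF S] and lams = saddle_feasible(2)[OF S]
  have xm: "xs m \<in> carrier_vec (n m)" by (rule mem_blockD[OF xs m_mem])
  have AT: "transpose_mat (A m) *\<^sub>v lams \<in> carrier_vec (n m)"
    using A_carrier[OF m_mem] lams by (intro mult_mat_vec_carrier[of _ _ l]) auto
  have "transpose_mat (A m) *\<^sub>v lams = gradient (n m) (f m) (xs m)"
  proof (rule subgradient_eq_gradient[OF gradient_Lipschitz_has_gradient[OF lip xm] xm AT])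
    fix y :: "real vec" assume y: "y \<in> carrier_vec (n m)"
    let ?x = "xs(m := y)"
    have X: "?x \<in> block_space m n" using xs y by (auto simp: block_space_def)
    have d: "y - xs m \<in> carrier_vec (n m)" using xm y by simp
    have Ad: "A m *\<^sub>v (y - xs m) \<in> carrier_vec l" by (rule mult_mat_vec_carrier[OF A_carrier[OF m_mem] d])
    have split: "(\<Sum>j=1..m. g j :: real) = g m + (\<Sum>j\<in>{1..m} - {m}. g j)" for g
      by (rule sum.remove[OF _ m_mem]) simp
    have "(\<Sum>j\<in>{1..m} - {m}. f j (?x j)) = (\<Sum>j\<in>{1..m} - {m}. f j (xs j))"
      by (intro sum.cong) auto
    then have obj: "objective m f ?x - objective m f xs = f m y - f m (xs m)"
      unfolding objective_def split by simp
    have "res ?x = A m *\<^sub>v (y - xs m)"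
    proof (rule eq_vecI)
      show "dim_vec (res ?x) = dim_vec (A m *\<^sub>v (y - xs m))"
        using carrier_vecD[OF res_carrier] carrier_vecD[OF Ad] by simp
      fix p assume "p < dim_vec (A m *\<^sub>v (y - xs m))"
      then have p: "p < l" using carrier_vecD[OF Ad] by simp
      have "(\<Sum>j\<in>{1..m} - {m}. (A j *\<^sub>v ?x j) $ p) = (\<Sum>j\<in>{1..m} - {m}. (A j *\<^sub>v xs j) $ p)"
        by (intro sum.cong) auto
      then have "res ?x $ p - res xs $ p = (A m *\<^sub>v y) $ p - (A m *\<^sub>v xs m) $ p"
        unfolding res_index[OF X p] res_index[OF xs p] split by (simp del: index_mult_mat_vec)
      moreover have "res xs $ p = 0" using saddle_feasible(3)[OF S] p by simp
      moreover have "(A m *\<^sub>v (y - xs m)) $ p = (A m *\<^sub>v y) $ p - (A m *\<^sub>v xs m) $ p"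
        unfolding mult_minus_distrib_mat_vec[OF A_carrier[OF m_mem] y xm]
        using p A_carrier[OF m_mem] by (simp del: index_mult_mat_vec)
      ultimately show "res ?x $ p = (A m *\<^sub>v (y - xs m)) $ p" by simp
    qed
    then have "lams \<bullet> res ?x = (transpose_mat (A m) *\<^sub>v lams) \<bullet> (y - xs m)"
      using mat_vec_adjoint[OF A_carrier[OF m_mem] d lams] by simp
    then show "(transpose_mat (A m) *\<^sub>v lams) \<bullet> (y - xs m) \<le> f m y - f m (xs m)"
      using saddle_lagrangian_gap[OF S X] obj by linarith
  qed
  then show ?thesis by simp
qed

text \<open>Feasibility makes A(xs - xt) the negative residual of \<open>xt\<close>; in the F-part
  the two occurrences of \<open>lamt\<close> then cancel.\<close>

lemma saddle_inner:
  assumes S: "saddle_point m l n f A b xs lams" and k: "k \<ge> 0"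
  shows "y \<in> carrier_vec l \<Longrightarrow> A_op m l A (\<lambda>i. xs i - xt k i) \<bullet> y = - (res (xt k) \<bullet> y)"
    and "u_inner m (u_diff (xs, lams) (xt k, lamt k)) (F_op m l A b (xt k, lamt k)) = lams \<bullet> res (xt k)"
proof -
  note xs = saddle_feasible(1)[OF S] and lams = saddle_feasible(2)[OF S]
  have d: "xs j - xt k j \<in> carrier_vec (n j)" if "j \<in> {1..m}" for j
    using mem_blockD[OF xs that] mem_blockD[OF xt_mem[OF k] that] by simp
  define e where "e = (\<lambda>j. A j *\<^sub>v (xs j - xt k j))"
  have e: "e j \<in> carrier_vec l" if "j \<in> {1..m}" for j
    unfolding e_def by (rule mult_mat_vec_carrier[OF A_carrier[OF that] d[OF that]])
  have sum_e: "vsum l e {1..m} = - res (xt k)"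
  proof (rule eq_vecI)
    have c: "vsum l e {1..m} \<in> carrier_vec l" by (intro vsum_carrier e)
    then show "dim_vec (vsum l e {1..m}) = dim_vec (- res (xt k))" using carrier_vecD[OF res_carrier] by simp
    fix p assume "p < dim_vec (- res (xt k))"
    then have p: "p < l" using carrier_vecD[OF res_carrier] by simp
    have "vsum l e {1..m} $ p = (\<Sum>j=1..m. e j $ p)" by (intro vsum_index e p) auto
    also have "\<dots> = (\<Sum>j=1..m. (A j *\<^sub>v xs j) $ p - (A j *\<^sub>v xt k j) $ p)"
    proof (rule sum.cong[OF refl])
      fix j assume j: "j \<in> {1..m}"
      show "e j $ p = (A j *\<^sub>v xs j) $ p - (A j *\<^sub>v xt k j) $ p"
        unfolding e_def mult_minus_distrib_mat_vec[OF A_carrier[OF j] mem_blockD[OF xs j] mem_blockD[OF xt_mem[OF k] j]]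
        using p A_carrier[OF j] by (simp del: index_mult_mat_vec)
    qed
    also have "\<dots> = res xs $ p - res (xt k) $ p"
      unfolding res_index[OF xs p] res_index[OF xt_mem[OF k] p] by (simp add: sum_subtractf)
    also have "\<dots> = (- res (xt k)) $ p"
      using p saddle_feasible(3)[OF S] carrier_vecD[OF res_carrier] by simp
    finally show "vsum l e {1..m} $ p = (- res (xt k)) $ p" .
  qed
  have neg: "- res (xt k) \<bullet> y = - (res (xt k) \<bullet> y)" if "y \<in> carrier_vec l" for y
    by (rule scalar_prod_uminus_left) (simp only: carrier_vecD[OF that] carrier_vecD[OF res_carrier])
  show "A_op m l A (\<lambda>i. xs i - xt k i) \<bullet> y = - (res (xt k) \<bullet> y)" if "y \<in> carrier_vec l"
    unfolding A_sum_def e_def[symmetric] sum_e by (rule neg[OF that])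
  have "(xs j - xt k j) \<bullet> - (transpose_mat (A j) *\<^sub>v lamt k) = - (e j \<bullet> lamt k)" if j: "j \<in> {1..m}" for j
  proof -
    have AT: "transpose_mat (A j) *\<^sub>v lamt k \<in> carrier_vec (n j)"
      using A_carrier[OF j] lamt_carrier by (intro mult_mat_vec_carrier[of _ _ l]) auto
    have "(xs j - xt k j) \<bullet> (transpose_mat (A j) *\<^sub>v lamt k) = (transpose_mat (A j) *\<^sub>v lamt k) \<bullet> (xs j - xt k j)"
      by (rule comm_scalar_prod[OF d[OF j] AT])
    also have "\<dots> = lamt k \<bullet> e j"
      unfolding e_def by (rule mat_vec_adjoint[OF A_carrier[OF j] d[OF j] lamt_carrier, symmetric])
    also have "\<dots> = e j \<bullet> lamt k" by (rule comm_scalar_prod[OF lamt_carrier e[OF j]])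
    finally show ?thesis using carrier_vecD[OF d[OF j]] carrier_vecD[OF AT]
      by (subst scalar_prod_uminus_right) auto
  qed
  then have "u_inner m (u_diff (xs, lams) (xt k, lamt k)) (F_op m l A b (xt k, lamt k))
      = - (\<Sum>j=1..m. e j \<bullet> lamt k) + (lams - lamt k) \<bullet> res (xt k)"
    by (simp add: u_inner_def u_diff_def F_op_def sum_negf)
  also have "(\<Sum>j=1..m. e j \<bullet> lamt k) = vsum l e {1..m} \<bullet> lamt k"
    by (intro vsum_scalar_left[symmetric] e lamt_carrier) auto
  also have "\<dots> = - (res (xt k) \<bullet> lamt k)" unfolding sum_e by (rule neg[OF lamt_carrier])
  also have "- (- (res (xt k) \<bullet> lamt k)) + (lams - lamt k) \<bullet> res (xt k) = lams \<bullet> res (xt k)"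
    using minus_scalar_prod_distrib[OF lams lamt_carrier[of k] res_carrier[of "xt k"]]
      comm_scalar_prod[OF lamt_carrier[of k] res_carrier[of "xt k"]] by simp
  finally show "u_inner m (u_diff (xs, lams) (xt k, lamt k)) (F_op m l A b (xt k, lamt k)) = lams \<bullet> res (xt k)" .
qed

end

text \<open>The factor of \<open>y (k + 1)\<close> in the decrease of \<open>y\<^sup>2 / B + \<sigma>'' y\<close> is increasing in \<open>k\<close> and
  nonnegative at \<open>k = 0\<close>, so it is bounded away from zero from \<open>k = 1\<close> on.\<close>

lemma weighted_residuals_bounded:
  fixes X En y D m P R :: "nat \<Rightarrow> real" and B \<gamma> \<sigma> :: real
  assumes B: "B > 0" and gamma: "0 < \<gamma>" and sigma: "0 \<le> \<sigma>"
    and En: "\<And>i. 0 \<le> En i" "\<And>i. X i \<le> En i - En (Suc i)"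
    and y: "\<And>i. 0 < y i" "\<And>i. (y (Suc i))\<^sup>2 = (y i)\<^sup>2 + y (Suc i)"
    and D: "\<And>i. D i = (y i)\<^sup>2 / B + \<sigma> * y i - ((y (Suc i))\<^sup>2 / B + \<sigma> * (1 - \<gamma>) * y (Suc i))"
      "0 \<le> D 0"
    and X: "\<And>i. D i * m (Suc i) / \<gamma> \<le> X i" "\<And>i. R i - \<sigma> * y i * P i \<le> X i"
    and P: "\<And>i. P i \<le> 2 / \<gamma>\<^sup>2 * (m (Suc i) + m i)"
    and m: "\<And>i. 0 \<le> m i" and R: "\<And>i. 0 \<le> R i"
  shows "\<exists>C. \<forall>N. (\<Sum>i<N. R i) \<le> C"
proof -
  have y_less: "y i < y (Suc i)" for i
    using y(1)[of "Suc i"] y(2)[of i] y(1)[of i] by (intro power2_less_imp_less[of "y i"]) auto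
  have y_mono: "y i \<le> y j" if "i \<le> j" for i j
    using that by (rule lift_Suc_mono_le[rotated]) (simp add: y_less less_imp_le)
  define d where "d = \<gamma> * \<sigma> - 1 / B"
  \<comment> \<open>From (y' - y)(y' + y) = y'. It expresses the \<sigma>-part of \<open>D i\<close>
    through \<open>y (Suc i)\<close> as well, so that this factor can be taken out.\<close>
  have y_diff: "y (Suc i) - y i = y (Suc i) / (y (Suc i) + y i)" for i
    using y(1)[of i] y(1)[of "Suc i"] y(2)[of i] by (simp add: field_simps power2_eq_square)
  have D_eq: "D i = y (Suc i) * (d - \<sigma> / (y (Suc i) + y i))" for i
  proof -
    have "D i = - (y (Suc i) / B) - \<sigma> * (y (Suc i) - y i) + \<sigma> * \<gamma> * y (Suc i)"
      unfolding D(1) y(2) by (simp add: algebra_simps add_divide_distrib)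
    then show ?thesis unfolding y_diff d_def by (simp add: algebra_simps)
  qed
  have d0: "\<sigma> / (y 1 + y 0) \<le> d"
    using D(2) y(1)[of 1] by (auto simp: D_eq zero_le_mult_iff One_nat_def)
  \<comment> \<open>For \<sigma> = 0 the bound \<open>d0\<close> would read 0 \<le> - 1 / B.\<close>
  have "\<sigma> \<noteq> 0" using d0 B by (auto simp: d_def)
  with sigma have sp: "\<sigma> > 0" by simp
  \<comment> \<open>The increase of the bracket in \<open>D\<close> from index 0 to index 1. At
    index 0 the bracket may vanish, so the lower bound by \<open>h\<close> starts at index
    1.\<close>
  define h where "h = \<sigma> / (y 1 + y 0) - \<sigma> / (y 2 + y 1)"
  have h: "h > 0"
  proof -
    have "y 0 < y 2" using y_less[of 0] y_less[of 1] by (simp add: numeral_2_eq_2 One_nat_def)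
    then have "\<sigma> / (y 2 + y 1) < \<sigma> / (y 1 + y 0)"
      using sp y(1)[of 0] y(1)[of 1] y(1)[of 2] by (intro divide_strict_left_mono) auto
    then show ?thesis by (simp add: h_def)
  qed
  have D_ge: "h * y (Suc i) \<le> D i" if "i \<ge> 1" for i
  proof -
    have "y 2 + y 1 \<le> y (Suc i) + y i" using that by (intro add_mono y_mono) auto
    then have "\<sigma> / (y (Suc i) + y i) \<le> \<sigma> / (y 2 + y 1)"
      using sp y(1)[of 1] y(1)[of 2] by (intro divide_left_mono mult_pos_pos) auto
    then have "h \<le> d - \<sigma> / (y (Suc i) + y i)" using d0 by (simp add: h_def)
    from mult_right_mono[OF this, of "y (Suc i)"] show ?thesis
      using y(1)[of "Suc i"] by (simp add: D_eq mult.commute)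
  qed
  have ym: "y (Suc i) * m (Suc i) \<le> \<gamma> / h * X i" if "i \<ge> 1" for i
  proof -
    have "h * y (Suc i) * m (Suc i) \<le> D i * m (Suc i)"
      by (intro mult_right_mono D_ge that m)
    also have "\<dots> \<le> \<gamma> * X i" using X(1)[of i] gamma by (simp add: field_simps)
    finally show ?thesis using h by (simp add: field_simps)
  qed
  \<comment> \<open>The product of the factors met on the way from \<open>P\<close> to
    \<open>X\<close>: the coefficient \<sigma>, the factor in the bound for \<open>P\<close>, and
    the constant of \<open>ym\<close>.\<close>
  define K where "K = \<sigma> * (2 / \<gamma>\<^sup>2) * (\<gamma> / h)"
  have K: "0 \<le> K" using sigma gamma h by (simp add: K_def)
  have R_le: "R (Suc i) \<le> X (Suc i) + K * (X (Suc i) + X i)" if "i \<ge> 1" for i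
  proof -
    have "y (Suc i) * m (Suc (Suc i)) \<le> y (Suc (Suc i)) * m (Suc (Suc i))"
      by (intro mult_right_mono y_mono m) auto
    also have "\<dots> \<le> \<gamma> / h * X (Suc i)" by (rule ym) simp
    finally have "y (Suc i) * (m (Suc (Suc i)) + m (Suc i)) \<le> \<gamma> / h * (X (Suc i) + X i)"
      using ym[OF that] by (simp add: algebra_simps)
    then have "\<sigma> * (2 / \<gamma>\<^sup>2) * (y (Suc i) * (m (Suc (Suc i)) + m (Suc i))) \<le> K * (X (Suc i) + X i)"
      unfolding K_def mult.assoc[of _ "\<gamma> / h"] using sigma by (intro mult_left_mono) auto
    moreover have "\<sigma> * y (Suc i) * P (Suc i) \<le> \<sigma> * y (Suc i) * (2 / \<gamma>\<^sup>2 * (m (Suc (Suc i)) + m (Suc i)))"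
      using sigma y(1)[of "Suc i"] by (intro mult_left_mono P) auto
    ultimately show ?thesis using X(2)[of "Suc i"] by (simp add: ac_simps)
  qed
  \<comment> \<open>\<open>R_le\<close> uses \<open>ym\<close> at two consecutive indices and so is
    available only from \<open>R 2\<close> on; \<open>R 0\<close> and \<open>R 1\<close> are carried
    along unestimated. Two shifted copies of the energy telescope.\<close>
  have sum_le: "(\<Sum>i<Suc (Suc N). R i)
      \<le> R 0 + R 1 + (1 + K) * (En 2 - En (Suc (Suc N))) + K * (En 1 - En (Suc N))" for N
  proof (induction N)
    case 0
    show ?case by (simp add: numeral_2_eq_2 One_nat_def)
  next
    case (Suc N)
    have "R (Suc (Suc N)) \<le> (1 + K) * X (Suc (Suc N)) + K * X (Suc N)"
      using R_le[of "Suc N"] by (simp add: algebra_simps)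
    also have "\<dots> \<le> (1 + K) * (En (Suc (Suc N)) - En (Suc (Suc (Suc N)))) + K * (En (Suc N) - En (Suc (Suc N)))"
      using En(2)[of "Suc (Suc N)"] En(2)[of "Suc N"] K by (intro add_mono mult_left_mono) auto
    finally show ?case using Suc.IH by (simp add: algebra_simps)
  qed
  have "(\<Sum>i<N. R i) \<le> R 0 + R 1 + (1 + K) * En 2 + K * En 1" for N
  proof -
    have "(\<Sum>i<N. R i) \<le> (\<Sum>i<Suc (Suc N). R i)" using R by (intro sum_mono2) auto
    also note sum_le[of N]
    also have "R 0 + R 1 + (1 + K) * (En 2 - En (Suc (Suc N))) + K * (En 1 - En (Suc N))
        \<le> R 0 + R 1 + (1 + K) * En 2 + K * En 1"
      using En(1) K by (intro add_mono mult_left_mono) auto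
    finally show ?thesis .
  qed
  then show ?thesis by blast
qed

section \<open>The two parameter regimes\<close>

lemma sum_nat_step:
  assumes "k \<ge> (0 :: int)"
  shows "(\<Sum>i<nat (k + 1). g (int i) :: real) = (\<Sum>i<nat k. g (int i)) + g k"
proof -
  have "nat (k + 1) = Suc (nat k)" using assms by simp
  then show ?thesis using assms by simp
qed

context alg4
begin

text \<open>Positivity of \<tau> comes from \<open>\<beta> k > 0\<close> and B > 0, and \<tau> < 1
  from the positivity of the previous term in the recursion. Constancy of t makes every metric of
  this regime independent of \<open>k\<close>.\<close>

lemma inverse_tau_regime:
  fixes B :: real
  assumes B: "B > 0" and tm: "0 < \<tau> (- 1)" "\<tau> (- 1) < 1"
    and par: "\<And>k. k \<ge> 0 \<Longrightarrow> \<beta> k = B / \<tau> k" "\<And>k. k \<ge> 0 \<Longrightarrow> 1 / \<tau> (k - 1) = (1 - \<tau> k) / \<tau> k"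
  shows "\<And>k. k \<ge> 0 \<Longrightarrow> 0 < \<tau> k" "\<And>k. k \<ge> 0 \<Longrightarrow> \<tau> k < 1" "\<And>k. k \<ge> 0 \<Longrightarrow> t k = B"
proof -
  show pos: "0 < \<tau> k" if "k \<ge> 0" for k
    using step(3)[OF that] par(1)[OF that] B by (simp add: zero_less_divide_iff)
  show "\<tau> k < 1" if k: "k \<ge> 0" for k
  proof -
    have "0 < \<tau> (k - 1)" using tm pos[of "k - 1"] k by (cases "k = 0") auto
    then have "0 < (1 - \<tau> k) / \<tau> k" using par(2)[OF k, symmetric] by simp
    then show ?thesis using pos[OF k] by (simp add: zero_less_divide_iff)
  qed
  show "t k = B" if "k \<ge> 0" for k using pos[OF that] par(1)[OF that] by simp
qed

lemma inverse_tau_descent: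
  fixes B :: real
  assumes B: "B > 0" and tm: "0 < \<tau> (- 1)" "\<tau> (- 1) < 1"
    and par: "\<And>k. k \<ge> 0 \<Longrightarrow> \<beta> k = B / \<tau> k" "\<And>k. k \<ge> 0 \<Longrightarrow> 1 / \<tau> (k - 1) = (1 - \<tau> k) / \<tau> k"
    and k: "k \<ge> 0" and x: "x \<in> block_space m n" and lam': "lam' \<in> carrier_vec l"
  shows "1 / \<tau> k * (objective m f x - objective m f (xbr k))
           - 1 / \<tau> (k - 1) * (objective m f x - objective m f (xbr (k - 1)))
           + u_inner m (u_diff (x, lam') (xt k, lamt k)) (F_op m l A b (xt k, lamt k))
           + (1 - \<gamma>) * (1 - \<tau> k) * \<beta> k *
               (A_op m l A (\<lambda>i. x i - xt k i) \<bullet> res (xbr (k - 1)))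
           \<ge> (v_vec m l A x lam' - vt k) \<bullet> (Q_mat m l (t k) *\<^sub>v (v k - vt k))"
proof -
  have tau: "0 < \<tau> k" "\<tau> k < 1"
    by (rule inverse_tau_regime(1)[OF B tm par k] inverse_tau_regime(2)[OF B tm par k]; assumption)+
  have "0 + \<tau> k * ((v_vec m l A x lam' - vt k) \<bullet> (Q_mat m l (t k) *\<^sub>v (v k - vt k)))
    \<le> \<tau> k * objective m f x + (1 - \<tau> k) * objective m f (xbr (k - 1)) - objective m f (xbr k)
      + \<tau> k * (u_inner m (u_diff (x, lam') (xt k, lamt k)) (F_op m l A b (xt k, lamt k))
          + c k * (A_op m l A (\<lambda>i. x i - xt k i) \<bullet> res (xbr (k - 1))))"
  proof (rule descent_inequality[OF k tau(1) x lam'])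
    fix j assume j: "j \<in> {1..m}"
    then show "(if j = m then 0 else 0)
      \<le> \<tau> k * f j (x j) + (1 - \<tau> k) * f j (xbr (k - 1) j) - f j (xbr k j)
        + \<tau> k * ((A j *\<^sub>v (x j - xt k j)) \<bullet> s k j)"
      using block_inequality[OF k tau j x] by simp
  qed
  \<comment> \<open>Division by u = \<tau>, stated for plain reals so that the field arithmetic does
    not act on the large terms.\<close>
  moreover have "W \<le> 1 / u * (X - Z) - (1 - u) / u * (X - Y) + U + C * V"
    if "0 + u * W \<le> u * X + (1 - u) * Y - Z + u * (U + C * V)" "0 < u" for u W X Y Z U C V :: real
  proof -
    have "u * (1 / u * (X - Z) - (1 - u) / u * (X - Y) + U + C * V)
        = u * X + (1 - u) * Y - Z + u * (U + C * V)"
      using that(2) by (simp add: field_simps)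
    then have "u * W \<le> u * (1 / u * (X - Z) - (1 - u) / u * (X - Y) + U + C * V)"
      using that(1) by linarith
    then show ?thesis using that(2) by simp
  qed
  ultimately show ?thesis unfolding par(2)[OF k] c_def[symmetric] using tau(1) by blast
qed

text \<open>Since H^k and H_0^k are the same constant matrix, the distances cancel and only the
  G-norm has to dominate the increments of \<Theta>. The increments are nonnegative, so their
  partial sums serve as \<Theta>.\<close>

lemma inverse_tau_metric:
  fixes B :: real
  assumes B: "B > 0" and tm: "0 < \<tau> (- 1)" "\<tau> (- 1) < 1"
    and par: "\<And>k. k \<ge> 0 \<Longrightarrow> \<beta> k = B / \<tau> k" "\<And>k. k \<ge> 0 \<Longrightarrow> 1 / \<tau> (k - 1) = (1 - \<tau> k) / \<tau> k"
  shows "\<exists>(H :: int \<Rightarrow> real mat) (\<Theta> :: int \<Rightarrow> real).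
           (\<forall>k\<ge>0. H k \<in> carrier_mat ((m - 1) * l + l) ((m - 1) * l + l) \<and>
              Q_mat m l (t k) = H k * M_mat m l \<gamma> (t k)) \<and>
           (\<forall>k\<ge>0. \<Theta> k \<ge> 0 \<and>
              \<Theta> (k + 1) - \<Theta> k \<ge> (1 - \<gamma>) * \<tau> k * \<beta> k * (vnorm (res (xt k)))\<^sup>2) \<and>
           (\<forall>k\<ge>0. \<forall>x'\<in>feasible_set m l n A b. \<forall>lam'\<in>carrier_vec l.
              (let v' = v_vec m l A x' lam'; G = G_mat (Q_mat m l (t k)) (M_mat m l \<gamma> (t k)) (H k);
                   H0 = (\<lambda>k::int. H0_mat m l \<gamma> B (1 / B)) in
               sqnorm_wrt (H k) (v (k + 1) - v') - sqnorm_wrt (H k) (v k - v')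
                 + sqnorm_wrt G (v k - vt k)
               \<ge> sqnorm_wrt (H0 (k + 1)) (v (k + 1) - v') - sqnorm_wrt (H0 k) (v k - v')
                 + \<Theta> (k + 1) - \<Theta> k))"
proof -
  have tB: "t k = B" if "k \<ge> 0" for k
    by (rule inverse_tau_regime(3)[OF B tm par that])
  define g where "g = (\<lambda>k. (1 - \<gamma>) * B * (vnorm (res (xt k)))\<^sup>2)"
  define T where "T = (\<lambda>k. \<Sum>i<nat k. g (int i))"
  have g0: "0 \<le> g k" for k using gamma B by (simp add: g_def)
  have T: "T (k + 1) - T k = g k" if "k \<ge> 0" for k using sum_nat_step[OF that, of g] by (simp add: T_def)
  have "(1 - \<gamma>) * \<tau> k * \<beta> k * (vnorm (res (xt k)))\<^sup>2 = g k" if "k \<ge> 0" for k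
    unfolding g_def tB[OF that, symmetric] by (simp only: mult.assoc)
  moreover have "0 \<le> T k" for k unfolding T_def by (intro sum_nonneg g0)
  moreover have "g k \<le> sqnorm_wrt (G_mat (Q_mat m l (t k)) (M_mat m l \<gamma> (t k)) (H0_mat m l \<gamma> B (1 / B))) (v k - vt k)"
    if k: "k \<ge> 0" for k
    using G_lower_bound[OF k] unfolding tB[OF k] g_def using B by blast
  moreover have "Q_mat m l (t k) = H0_mat m l \<gamma> B (1 / B) * M_mat m l \<gamma> (t k)" if "k \<ge> 0" for k
    using Q_eq_H_M[OF B, of \<gamma> m l] gamma tB[OF that] by simp
  ultimately show ?thesis
    by (intro exI[of _ "\<lambda>_. H0_mat m l \<gamma> B (1 / B)"] exI[of _ T])
      (simp add: H0_mat_carrier T Let_def)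
qed

end

section \<open>The smooth regime: step weights, the constants sigma and the descent
  inequality\<close>

locale alg4_smooth = alg4 +
  fixes L B \<sigma>' \<sigma>'' :: real
  assumes lip: "gradient_Lipschitz (n m) (f m) L"
    and B: "B > 0" and betaB: "\<And>k. k \<ge> 0 \<Longrightarrow> \<beta> k = B" and kappa: "(1 - \<gamma>) * B \<le> 1"
    and tm: "0 < \<tau> (- 1)" "\<tau> (- 1) < 1"
    and tau_pos: "\<And>k. k \<ge> 0 \<Longrightarrow> 0 < \<tau> k"
    and tau_rec: "\<And>k. k \<ge> 0 \<Longrightarrow> 1 / (\<tau> (k - 1))\<^sup>2 = (1 - \<tau> k) / (\<tau> k)\<^sup>2"
    and sigma': "\<sigma>' = sigma_min (A m * transpose_mat (A m)) / L"
    and sigma'': "\<sigma>'' = \<sigma>' - \<sigma>'\<^sup>2 / (\<sigma>' + 1)"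
    and weights: "\<And>k. k \<ge> 0 \<Longrightarrow> 1 / (B * (\<tau> k)\<^sup>2) + \<sigma>'' / \<tau> k
                \<ge> 1 / (B * (\<tau> (k + 1))\<^sup>2) + \<sigma>'' * (1 - \<gamma>) / \<tau> (k + 1)"
begin

lemma L_pos: "L > 0" using lip by (simp add: gradient_Lipschitz_def)

lemma tau_lt_1: assumes "k \<ge> 0" shows "\<tau> k < 1"
proof -
  have "0 < \<tau> (k - 1)" using tm tau_pos[of "k - 1"] assms by (cases "k = 0") auto
  then have "0 < (1 - \<tau> k) / (\<tau> k)\<^sup>2" using tau_rec[OF assms, symmetric] by simp
  then show ?thesis using tau_pos[OF assms] by (simp add: zero_less_divide_iff)
qed

lemma tau_prev_pos: "k \<ge> 0 \<Longrightarrow> 0 < \<tau> (k - 1)"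
  using tm tau_pos[of "k - 1"] by (cases "k = 0") auto

lemma t_pos: "k \<ge> 0 \<Longrightarrow> 0 < t k" using tau_pos betaB B by simp

lemma gram_last_block:
  "A m * transpose_mat (A m) \<in> carrier_mat l l"
  "transpose_mat (A m * transpose_mat (A m)) = A m * transpose_mat (A m)"
  "w \<in> carrier_vec l \<Longrightarrow> w \<bullet> ((A m * transpose_mat (A m)) *\<^sub>v w) = (vnorm (transpose_mat (A m) *\<^sub>v w))\<^sup>2"
proof -
  note Am = A_carrier[OF m_mem]
  have AT: "transpose_mat (A m) \<in> carrier_mat (n m) l" using Am by simp
  show "A m * transpose_mat (A m) \<in> carrier_mat l l" by (rule mult_carrier_mat[OF Am AT])
  show "transpose_mat (A m * transpose_mat (A m)) = A m * transpose_mat (A m)"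
    using transpose_mult[OF Am AT] by simp
  show "w \<bullet> ((A m * transpose_mat (A m)) *\<^sub>v w) = (vnorm (transpose_mat (A m) *\<^sub>v w))\<^sup>2"
    if w: "w \<in> carrier_vec l"
    unfolding assoc_mult_mat_vec[OF Am AT w] vnorm_sq
    by (rule mat_vec_adjoint[OF Am mult_mat_vec_carrier[OF AT w] w])
qed

lemma sigma'_nonneg: "0 \<le> \<sigma>'"
  unfolding sigma' using sigma_min_nonneg[OF gram_last_block(1,2) l_pos] gram_last_block(3) L_pos by simp

lemma sigma''_eq: "\<sigma>'' = \<sigma>' / (\<sigma>' + 1)"
  unfolding sigma'' using sigma'_nonneg by (simp add: field_simps power2_eq_square)

lemma sigma''_nonneg: "0 \<le> \<sigma>''"
  unfolding sigma''_eq using sigma'_nonneg by simp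

lemma sigma'_bound:
  assumes "w \<in> carrier_vec l"
  shows "\<sigma>' * (vnorm w)\<^sup>2 \<le> 1 / L * (vnorm (transpose_mat (A m) *\<^sub>v w))\<^sup>2"
proof -
  have "sigma_min (A m * transpose_mat (A m)) * (vnorm w)\<^sup>2 \<le> (vnorm (transpose_mat (A m) *\<^sub>v w))\<^sup>2"
    using sigma_min_le_Rayleigh[OF gram_last_block(1,2) assms] unfolding gram_last_block(3)[OF assms] vnorm_sq .
  then show ?thesis unfolding sigma' using L_pos by (simp add: field_simps)
qed

text \<open>The general descent inequality with the cocoercivity term as gain, divided by the square
  of \<tau>; the recursion for \<tau> turns the weight of the previous iterate into the stated
  one.\<close>

lemma smooth_descent:
  assumes k: "k \<ge> 0" and x: "x \<in> block_space m n" and lam': "lam' \<in> carrier_vec l"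
  shows "1 / (\<tau> k)\<^sup>2 * (objective m f x - objective m f (xbr k))
           - 1 / (\<tau> (k - 1))\<^sup>2 * (objective m f x - objective m f (xbr (k - 1)))
           + 1 / \<tau> k * u_inner m (u_diff (x, lam') (xt k, lamt k)) (F_op m l A b (xt k, lamt k))
           + (1 - \<gamma>) * (1 - \<tau> k) * \<beta> k / \<tau> k *
               (A_op m l A (\<lambda>i. x i - xt k i) \<bullet> res (xbr (k - 1)))
           \<ge> 1 / \<tau> k *
               ((v_vec m l A x lam' - vt k) \<bullet> (Q_mat m l (t k) *\<^sub>v (v k - vt k))
                + 1 / L / 2 * sqnorm_wrt (1\<^sub>m (n m))
                    (gradient (n m) (f m) (xbr k m) - gradient (n m) (f m) (x m)))"
proof -
  define dz where "dz = gradient (n m) (f m) (xbr k m) - gradient (n m) (f m) (x m)"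
  have "gradient (n m) (f m) (xbr k m) \<in> carrier_vec (n m)" "gradient (n m) (f m) (x m) \<in> carrier_vec (n m)"
    using gradient_Lipschitz_has_gradient[OF lip mem_blockD[OF step(1)[OF k] m_mem]]
      gradient_Lipschitz_has_gradient[OF lip mem_blockD[OF x m_mem]] by (auto simp: has_gradient_def)
  then have "dz \<in> carrier_vec (n m)" by (simp add: dz_def)
  then have sq: "1 / L / 2 * sqnorm_wrt (1\<^sub>m (n m)) dz = 1 / (2 * L) * (vnorm dz)\<^sup>2"
    by (simp add: sqnorm_wrt_def vnorm_sq)
  have "\<tau> k * (1 / (2 * L) * (vnorm dz)\<^sup>2)
      + \<tau> k * ((v_vec m l A x lam' - vt k) \<bullet> (Q_mat m l (t k) *\<^sub>v (v k - vt k)))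
    \<le> \<tau> k * objective m f x + (1 - \<tau> k) * objective m f (xbr (k - 1)) - objective m f (xbr k)
      + \<tau> k * (u_inner m (u_diff (x, lam') (xt k, lamt k)) (F_op m l A b (xt k, lamt k))
          + c k * (A_op m l A (\<lambda>i. x i - xt k i) \<bullet> res (xbr (k - 1))))"
  proof (rule descent_inequality[OF k tau_pos[OF k] x lam'])
    fix j assume j: "j \<in> {1..m}"
    show "(if j = m then \<tau> k * (1 / (2 * L) * (vnorm dz)\<^sup>2) else 0)
      \<le> \<tau> k * f j (x j) + (1 - \<tau> k) * f j (xbr (k - 1) j) - f j (xbr k j)
        + \<tau> k * ((A j *\<^sub>v (x j - xt k j)) \<bullet> s k j)"
    proof (cases "j = m")
      case True
      then show ?thesis
        using smooth_block_inequality[OF lip k tau_pos[OF k] tau_lt_1[OF k] x] by (simp only: dz_def if_True refl)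
    next
      case False
      then show ?thesis
        using block_inequality[OF k tau_pos[OF k] tau_lt_1[OF k] j x] by (simp only: if_False)
    qed
  qed
  moreover have "1 / u * (W + N) \<le> 1 / u\<^sup>2 * (X - Z) - (1 - u) / u\<^sup>2 * (X - Y) + 1 / u * U + C / u * V"
    if "u * N + u * W \<le> u * X + (1 - u) * Y - Z + u * (U + C * V)" "0 < u" for u W X Y Z U C V N :: real
  proof -
    have "u\<^sup>2 * (1 / u\<^sup>2 * (X - Z) - (1 - u) / u\<^sup>2 * (X - Y) + 1 / u * U + C / u * V)
        = u * X + (1 - u) * Y - Z + u * (U + C * V)"
      using that(2) by (simp add: field_simps power2_eq_square)
    moreover have "u\<^sup>2 * (1 / u * (W + N)) = u * N + u * W"
      using that(2) by (simp add: field_simps power2_eq_square)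
    ultimately have "u\<^sup>2 * (1 / u * (W + N))
        \<le> u\<^sup>2 * (1 / u\<^sup>2 * (X - Z) - (1 - u) / u\<^sup>2 * (X - Y) + 1 / u * U + C / u * V)"
      using that(1) by linarith
    then show ?thesis by (rule mult_left_le_imp_le) (use that(2) in simp)
  qed
  ultimately show ?thesis
    unfolding tau_rec[OF k] c_def[symmetric] dz_def[symmetric] sq using tau_pos[OF k] by blast
qed

end

section \<open>Norm inequalities and the slack at a saddle point\<close>

lemma vnorm_sq_add:
  assumes "x \<in> carrier_vec l" "y \<in> carrier_vec l"
  shows "(vnorm (a \<cdot>\<^sub>v x + c \<cdot>\<^sub>v y))\<^sup>2 = a\<^sup>2 * (vnorm x)\<^sup>2 + 2 * a * c * (x \<bullet> y) + c\<^sup>2 * (vnorm y)\<^sup>2"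
  unfolding vnorm_sq using assms
  by (simp add: ip_simps comm_scalar_prod[of y l x] power2_eq_square algebra_simps)

lemma vnorm_sq_convex:
  assumes x: "x \<in> carrier_vec l" and y: "y \<in> carrier_vec l" and a: "0 \<le> a" "a \<le> 1"
  shows "(vnorm ((1 - a) \<cdot>\<^sub>v x + a \<cdot>\<^sub>v y))\<^sup>2 \<le> (1 - a) * (vnorm x)\<^sup>2 + a * (vnorm y)\<^sup>2"
proof -
  have "0 \<le> (vnorm (1 \<cdot>\<^sub>v x + (- 1) \<cdot>\<^sub>v y))\<^sup>2" by simp
  also have "\<dots> = (vnorm x)\<^sup>2 - 2 * (x \<bullet> y) + (vnorm y)\<^sup>2" unfolding vnorm_sq_add[OF x y] by simp
  finally have "0 \<le> a * (1 - a) * ((vnorm x)\<^sup>2 - 2 * (x \<bullet> y) + (vnorm y)\<^sup>2)" using a by simp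
  then show ?thesis unfolding vnorm_sq_add[OF x y] by (simp add: power2_eq_square algebra_simps)
qed

text \<open>S/(S + 1) is the parallel sum of S and 1, the minimum of the right hand side over
  \<open>q\<close> for a unit vector \<open>p\<close>. The gap, times S + 1, is the squared norm of
  S p - (S + 1) q.\<close>

lemma parallel_sum_bound:
  assumes p: "p \<in> carrier_vec l" and q: "q \<in> carrier_vec l" and S: "(0 :: real) \<le> S"
  shows "S / (S + 1) * (vnorm p)\<^sup>2 \<le> S * (vnorm (p - q))\<^sup>2 + (vnorm q)\<^sup>2"
proof -
  have pq: "(vnorm (p - q))\<^sup>2 = (vnorm p)\<^sup>2 - 2 * (p \<bullet> q) + (vnorm q)\<^sup>2"
  proof -
    have "p - q = 1 \<cdot>\<^sub>v p + (- 1) \<cdot>\<^sub>v q" using p q by (intro eq_vecI) auto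
    then show ?thesis using vnorm_sq_add[OF p q, of 1 "- 1"] by simp
  qed
  have "0 \<le> (vnorm (S \<cdot>\<^sub>v p + (- (S + 1)) \<cdot>\<^sub>v q))\<^sup>2" by simp
  also have "\<dots> = S\<^sup>2 * (vnorm p)\<^sup>2 - 2 * S * (S + 1) * (p \<bullet> q) + (S + 1)\<^sup>2 * (vnorm q)\<^sup>2"
    unfolding vnorm_sq_add[OF p q] by (simp add: power2_eq_square algebra_simps)
  also have "\<dots> = (S + 1) * (S * (vnorm (p - q))\<^sup>2 + (vnorm q)\<^sup>2) - S * (vnorm p)\<^sup>2"
    unfolding pq by (simp add: power2_eq_square algebra_simps)
  finally show ?thesis using S by (simp add: field_simps)
qed

context alg4_smooth
begin

text \<open>For the last block the partial sum is complete, and \<open>lamt\<close> plus t times it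
  is lam minus t times the residual of \<open>xt\<close>. The block differences disappear, so the
  gradient at \<open>xbr k m\<close> depends only on multipliers and residuals.\<close>

lemma last_block_multiplier:
  assumes k: "k \<ge> 0" and lams: "lams \<in> carrier_vec l"
  shows "- s k m - lams = (lam k - t k \<cdot>\<^sub>v res (xt k) - lams) - c k \<cdot>\<^sub>v res (xbr (k - 1))"
proof (rule eq_vecI)
  note cs = carrier_vecD[OF res_carrier] carrier_vecD[OF lam_carrier[OF k]] carrier_vecD[OF lamt_carrier]
    carrier_vecD[OF vsum_dl_carrier[OF k m_mem]] carrier_vecD[OF lams]
  show "dim_vec (- s k m - lams) = dim_vec ((lam k - t k \<cdot>\<^sub>v res (xt k) - lams) - c k \<cdot>\<^sub>v res (xbr (k - 1)))"
    by (simp add: cs)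
  fix p assume "p < dim_vec ((lam k - t k \<cdot>\<^sub>v res (xt k) - lams) - c k \<cdot>\<^sub>v res (xbr (k - 1)))"
  then have p: "p < l" by (simp add: cs)
  have "res (xt k) $ p = (1 / t k) * (lam k $ p - lamt k $ p) - vsum l (dl k) {2..m} $ p"
    using p by (simp add: res_xt_eq[OF k t_pos[OF k], symmetric] cs)
  moreover have "u * r = x - w" if "r = (1 / u) * x - y" "u * y = w" "0 < u" for u r x y w :: real
    using that by (simp add: right_diff_distrib)
  ultimately have "t k * res (xt k) $ p = lam k $ p - lamt k $ p - t k * vsum l (dl k) {2..m} $ p"
    using t_pos[OF k] by blast
  then show "(- s k m - lams) $ p
      = ((lam k - t k \<cdot>\<^sub>v res (xt k) - lams) - c k \<cdot>\<^sub>v res (xbr (k - 1))) $ p"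
    using p by (simp add: s_def cs)
qed

text \<open>\<open>Lk\<close> is the prescribed lower bound on the increments of \<open>\<Theta>\<close>, \<open>Uk\<close> the largest increment that the
  final inequality allows at a saddle point, and \<open>Dk\<close> the slack in the hypothesis on \<open>\<tau>\<close>.\<close>

definition yk where "yk k = 1 / \<tau> k"
definition Lk where
  "Lk k = (1 - \<gamma>) * \<beta> k * ((vnorm (res (xt k)))\<^sup>2 - \<tau> k / (\<tau> (k - 1))\<^sup>2 * (vnorm (res (xbr (k - 1))))\<^sup>2)"
abbreviation Hk where "Hk k \<equiv> H0_mat m l \<gamma> (t k) (1 / t k)"
abbreviation H0 where "H0 k \<equiv> H0_mat m l \<gamma> B (1 / (B * (\<tau> k)\<^sup>2) + \<sigma>'' * (1 - \<gamma>) / \<tau> k)"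
abbreviation Gk where "Gk k \<equiv> G_mat (Q_mat m l (t k)) (M_mat m l \<gamma> (t k)) (Hk k)"
definition Uk where
  "Uk xs lams k = 1 / \<tau> k *
      (sqnorm_wrt (Hk k) (v (k + 1) - v_vec m l A xs lams)
       + 1 / L * sqnorm_wrt (1\<^sub>m (n m)) (gradient (n m) (f m) (xbr k m) - gradient (n m) (f m) (xs m))
       - sqnorm_wrt (Hk k) (v k - v_vec m l A xs lams)
       + sqnorm_wrt (Gk k) (v k - vt k))
    - (sqnorm_wrt (H0 (k + 1)) (v (k + 1) - v_vec m l A xs lams)
       - sqnorm_wrt (H0 k) (v k - v_vec m l A xs lams))"
definition Dk where
  "Dk k = (yk k)\<^sup>2 / B + \<sigma>'' * yk k - ((yk (k + 1))\<^sup>2 / B + \<sigma>'' * (1 - \<gamma>) * yk (k + 1))"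

lemma Dk_nonneg: "k \<ge> 0 \<Longrightarrow> 0 \<le> Dk k"
  using weights[of k] by (simp add: Dk_def yk_def power_divide field_simps)

lemma yk_pos: "k \<ge> - 1 \<Longrightarrow> 0 < yk k"
  using tau_prev_pos[of "k + 1"] by (simp add: yk_def)

lemma yk_rec:
  assumes "k \<ge> 0"
  shows "(yk k)\<^sup>2 = (yk (k - 1))\<^sup>2 + yk k"
proof -
  have "1 / (\<tau> (k - 1))\<^sup>2 = 1 / (\<tau> k)\<^sup>2 - 1 / \<tau> k"
    unfolding tau_rec[OF assms] using tau_pos[OF assms] by (simp add: field_simps power2_eq_square)
  then show ?thesis by (simp add: yk_def power_divide)
qed

lemma yk_ge_1: "k \<ge> 0 \<Longrightarrow> 1 \<le> yk k"
  using tau_pos[of k] tau_lt_1[of k] by (simp add: yk_def)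

text \<open>By the recursion, \<tau> times the square of the previous \<open>yk\<close> is (1 -
  \<tau>)/\<tau>, that is, \<open>yk k - 1\<close>.\<close>

lemma Lk_eq:
  assumes k: "k \<ge> 0"
  shows "Lk k = (1 - \<gamma>) * B * ((vnorm (res (xt k)))\<^sup>2 - (yk k - 1) * (vnorm (res (xbr (k - 1))))\<^sup>2)"
proof -
  have "\<tau> k / (\<tau> (k - 1))\<^sup>2 = \<tau> k * (1 / (\<tau> (k - 1))\<^sup>2)" by simp
  also have "\<dots> = yk k - 1"
    unfolding tau_rec[OF k] yk_def using tau_pos[OF k] by (simp add: field_simps power2_eq_square)
  finally show ?thesis unfolding Lk_def betaB[OF k] by simp
qed

text \<open>\<open>yk k\<close> times H^k and H_0^k have the same primal block, so only multiplier
  terms survive. The G-norm supplies the positive part of \<open>Lk\<close> exactly, the gradient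
  term supplies \<sigma>' |p - q|^2, and since lam(k+1) - lams is a convex combination of lam(k) -
  lams and p, the remaining \<sigma>''-terms cost at most \<sigma>'' y |p|^2.\<close>

lemma slack_bound:
  assumes S: "saddle_point m l n f A b xs lams" and k: "k \<ge> 0"
  defines "p \<equiv> lam k - t k \<cdot>\<^sub>v res (xt k) - lams"
  defines "q \<equiv> c k \<cdot>\<^sub>v res (xbr (k - 1))"
  shows "yk k * (\<sigma>' * (vnorm (p - q))\<^sup>2)
      + (1 - \<gamma>) * B * ((yk k - 1) * (vnorm (res (xbr (k - 1))))\<^sup>2)
      + Dk k * (vnorm (lam (k + 1) - lams))\<^sup>2 / \<gamma> - \<sigma>'' * yk k * (vnorm p)\<^sup>2
    \<le> Uk xs lams k - Lk k"
proof -
  note xs = saddle_feasible(1)[OF S] and lams = saddle_feasible(2)[OF S]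
  have k1: "k + 1 \<ge> 0" using k by simp
  have tau: "0 < \<tau> k" "0 < \<tau> (k + 1)" using tau_pos k by auto
  have p: "p \<in> carrier_vec l" and q: "q \<in> carrier_vec l"
    using lam_carrier[OF k] lams res_carrier by (auto simp: p_def q_def)
  define J1 where "J1 = (vnorm (transpose_mat (J_mat m l) *\<^sub>v stack m l (\<lambda>j. A j *\<^sub>v xba (k + 1) j - A j *\<^sub>v xs j)))\<^sup>2"
  define J0 where "J0 = (vnorm (transpose_mat (J_mat m l) *\<^sub>v stack m l (\<lambda>j. A j *\<^sub>v xba k j - A j *\<^sub>v xs j)))\<^sup>2"
  define m1 where "m1 = (vnorm (lam (k + 1) - lams))\<^sup>2"
  define m0 where "m0 = (vnorm (lam k - lams))\<^sup>2"
  define G where "G = sqnorm_wrt (Gk k) (v k - vt k)"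
  define R where "R = (vnorm (res (xt k)))\<^sup>2"
  define Z where "Z = 1 / L * sqnorm_wrt (1\<^sub>m (n m)) (gradient (n m) (f m) (xbr k m) - gradient (n m) (f m) (xs m))"
  note sq1 = sqnorm_H0_v[OF xba_mem[OF k1] xs lam_carrier[OF k1] lams, folded J1_def m1_def]
  note sq0 = sqnorm_H0_v[OF xba_mem[OF k] xs lam_carrier[OF k] lams, folded J0_def m0_def]
  have U: "Uk xs lams k = yk k * Z + yk k * G + (Dk k * m1 - \<sigma>'' * yk k * m1 + \<sigma>'' * (1 - \<gamma>) * yk k * m0) / \<gamma>"
  proof -
    \<comment> \<open>An identity of plain reals: \<open>u\<close>, \<open>u1\<close> stand for
      \<tau> at k and k + 1, \<open>g\<close> for \<gamma>, \<open>j1\<close>, \<open>j0\<close> for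
      the primal and \<open>n1\<close>, \<open>n0\<close> for the multiplier distances,
      \<open>s2\<close> for \<sigma>''. The primal distances cancel because t = \<tau> B.\<close>
    have "1 / u * ((u * B * j1 + 1 / (u * B) * n1) / g + Zz - (u * B * j0 + 1 / (u * B) * n0) / g + Gg)
        - ((B * j1 + (1 / (B * u1\<^sup>2) + s2 * (1 - g) / u1) * n1) / g
         - (B * j0 + (1 / (B * u\<^sup>2) + s2 * (1 - g) / u) * n0) / g)
      = 1 / u * Zz + 1 / u * Gg + (((1 / u)\<^sup>2 / B + s2 * (1 / u) - ((1 / u1)\<^sup>2 / B + s2 * (1 - g) * (1 / u1))) * n1
         - s2 * (1 / u) * n1 + s2 * (1 - g) * (1 / u) * n0) / g"
      if "0 < u" "0 < u1" "0 < g" for u u1 g j1 j0 n1 n0 Zz Gg s2 :: real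
    proof -
      have e1: "1 / u * (u * B * j + 1 / (u * B) * w) = B * j + (1 / u)\<^sup>2 / B * w" for j w
        using that B by (simp add: field_simps power2_eq_square)
      have scale: "1 / u * ((u * B * j1 + 1 / (u * B) * n1) / g + Zz - (u * B * j0 + 1 / (u * B) * n0) / g + Gg)
          = (B * j1 + (1 / u)\<^sup>2 / B * n1) / g + 1 / u * Zz - (B * j0 + (1 / u)\<^sup>2 / B * n0) / g + 1 / u * Gg"
        unfolding e1[symmetric] by (simp add: algebra_simps add_divide_distrib diff_divide_distrib)
      have weights: "1 / (B * w\<^sup>2) = (1 / w)\<^sup>2 / B" "s2 * (1 - g) / w = s2 * (1 - g) * (1 / w)" for w
        by (simp_all add: power_divide)
      have "(B * j1 + a * n1) / g + zz - (B * j0 + a * n0) / g + gg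
          - ((B * j1 + (a1 + e1) * n1) / g - (B * j0 + (a + e) * n0) / g)
        = zz + gg + ((a + h - (a1 + e1)) * n1 - h * n1 + e * n0) / g" for a a1 e e1 h zz gg :: real
        by (simp add: add_divide_distrib diff_divide_distrib algebra_simps)
      then show ?thesis unfolding scale unfolding weights .
    qed
    from this[OF tau gamma(1)] show ?thesis
      unfolding Uk_def G_def[symmetric] Z_def[symmetric] unfolding Dk_def yk_def sq1 sq0 betaB[OF k] .
  qed
  have G: "(1 - \<gamma>) * B * R \<le> yk k * G"
  proof -
    have "(1 - \<gamma>) * t k * R \<le> G" unfolding R_def G_def by (rule G_lower_bound[OF k t_pos[OF k]])
    from mult_left_mono[OF this, of "yk k"] yk_pos[of k] k
    have "yk k * ((1 - \<gamma>) * t k * R) \<le> yk k * G" by simp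
    moreover have "yk k * ((1 - \<gamma>) * t k * R) = (1 - \<gamma>) * B * R"
      unfolding yk_def betaB[OF k] using tau by simp
    ultimately show ?thesis by simp
  qed
  have Z: "\<sigma>' * (vnorm (p - q))\<^sup>2 \<le> Z"
  proof -
    have AT: "transpose_mat (A m) \<in> carrier_mat (n m) l" using A_carrier[OF m_mem] by simp
    have sc: "s k m \<in> carrier_vec l" by (rule s_carrier[OF k m_mem])
    have c: "transpose_mat (A m) *\<^sub>v w \<in> carrier_vec (n m)" if "w \<in> carrier_vec l" for w
      by (rule mult_mat_vec_carrier[OF AT that])
    have ns: "- (transpose_mat (A m) *\<^sub>v s k m) = transpose_mat (A m) *\<^sub>v (- s k m)"
    proof -
      have "- s k m = (- 1) \<cdot>\<^sub>v s k m" by (intro eq_vecI) auto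
      then have "transpose_mat (A m) *\<^sub>v (- s k m) = (- 1) \<cdot>\<^sub>v (transpose_mat (A m) *\<^sub>v s k m)"
        using mult_mat_vec[OF AT sc, of "- 1"] by simp
      also have "\<dots> = - (transpose_mat (A m) *\<^sub>v s k m)" by (intro eq_vecI) auto
      finally show ?thesis by simp
    qed
    have "gradient (n m) (f m) (xbr k m) - gradient (n m) (f m) (xs m) = transpose_mat (A m) *\<^sub>v (- s k m - lams)"
      unfolding gradient_last_block[OF lip k tau(1)] saddle_gradient[OF S lip] ns
      using mult_minus_distrib_mat_vec[OF AT _ lams, of "- s k m"] sc by simp
    also have "- s k m - lams = p - q" unfolding p_def q_def by (rule last_block_multiplier[OF k lams])
    finally have dz: "gradient (n m) (f m) (xbr k m) - gradient (n m) (f m) (xs m) = transpose_mat (A m) *\<^sub>v (p - q)" .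
    have pq: "p - q \<in> carrier_vec l" using p q by simp
    have "sqnorm_wrt (1\<^sub>m (n m)) (transpose_mat (A m) *\<^sub>v (p - q)) = (vnorm (transpose_mat (A m) *\<^sub>v (p - q)))\<^sup>2"
      using c[OF pq] by (simp add: sqnorm_wrt_def vnorm_sq)
    then show ?thesis unfolding Z_def dz using sigma'_bound[OF pq] by simp
  qed
  have yp: "0 < yk k" using yk_pos k by simp
  \<comment> \<open>The multiplier update is a relaxation: with weight \<gamma> it moves to the full
    step, whose distance vector is \<open>p\<close>. Convexity of the squared norm needs \<gamma>
    \<le> 1.\<close>
  have m1_le: "m1 \<le> (1 - \<gamma>) * m0 + \<gamma> * (vnorm p)\<^sup>2"
  proof -
    have "lam (k + 1) - lams = (1 - \<gamma>) \<cdot>\<^sub>v (lam k - lams) + \<gamma> \<cdot>\<^sub>v p"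
      unfolding step(7)[OF k] p_def using lam_carrier[OF k] lams carrier_vecD[OF res_carrier]
      by (intro eq_vecI) (auto simp: algebra_simps)
    then show ?thesis
      unfolding m1_def m0_def using vnorm_sq_convex[of "lam k - lams" l p \<gamma>] lam_carrier[OF k] lams p gamma by simp
  qed
  have "- \<sigma>'' * yk k * (vnorm p)\<^sup>2 \<le> (- \<sigma>'' * yk k * m1 + \<sigma>'' * (1 - \<gamma>) * yk k * m0) / \<gamma>"
  proof -
    have "0 \<le> \<sigma>'' * yk k" using sigma''_nonneg yp by simp
    from mult_left_mono[OF m1_le this]
    have "\<sigma>'' * yk k * m1 \<le> \<sigma>'' * (1 - \<gamma>) * yk k * m0 + \<gamma> * (\<sigma>'' * yk k * (vnorm p)\<^sup>2)"
      by (simp add: algebra_simps)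
    then show ?thesis using gamma by (simp add: field_simps)
  qed
  moreover have "(Dk k * m1 - \<sigma>'' * yk k * m1 + \<sigma>'' * (1 - \<gamma>) * yk k * m0) / \<gamma>
      = Dk k * m1 / \<gamma> + (- \<sigma>'' * yk k * m1 + \<sigma>'' * (1 - \<gamma>) * yk k * m0) / \<gamma>"
    by (simp add: add_divide_distrib diff_divide_distrib)
  moreover have "yk k * (\<sigma>' * (vnorm (p - q))\<^sup>2) \<le> yk k * Z" using Z yp by simp
  ultimately show ?thesis
    unfolding U Lk_eq[OF k] m1_def[symmetric] R_def[symmetric] right_diff_distrib[of "(1 - \<gamma>) * B"] using G by linarith
qed

text \<open>With u = (1 - \<gamma>) B the factor y c^2 is u (y - 1) times u (1 - \<tau>), and the
  last factor is at most 1. This is where (1 - \<gamma>) B \<le> 1 enters.\<close>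

lemma extrapolation_weight:
  assumes k: "k \<ge> 0"
  shows "yk k * (vnorm (c k \<cdot>\<^sub>v res (xbr (k - 1))))\<^sup>2
    \<le> (1 - \<gamma>) * B * ((yk k - 1) * (vnorm (res (xbr (k - 1))))\<^sup>2)"
proof -
  define u where "u = (1 - \<gamma>) * B"
  have u: "0 \<le> u" "u \<le> 1" using gamma B kappa by (auto simp: u_def)
  have tau: "0 < \<tau> k" "\<tau> k < 1" using tau_pos tau_lt_1 k by auto
  have "yk k * (c k)\<^sup>2 = u * (yk k - 1) * (u * (1 - \<tau> k))"
    unfolding c_def betaB[OF k] yk_def u_def using tau by (simp add: field_simps power2_eq_square)
  also have "\<dots> \<le> u * (yk k - 1) * 1"
  proof (intro mult_left_mono)
    show "u * (1 - \<tau> k) \<le> 1" using u tau by (intro mult_le_one) auto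
    show "0 \<le> u * (yk k - 1)" using u yk_ge_1[OF k] by simp
  qed
  finally have "yk k * (c k)\<^sup>2 * (vnorm (res (xbr (k - 1))))\<^sup>2
      \<le> u * (yk k - 1) * 1 * (vnorm (res (xbr (k - 1))))\<^sup>2" by (rule mult_right_mono) simp
  then show ?thesis by (simp add: vnorm_smult power_mult_distrib u_def mult.assoc)
qed

text \<open>The gradient and residual terms together absorb the negative term in |p|^2. The
  \<open>Dk\<close> term is kept, although it is nonnegative, because its sum is what controls the
  multipliers.\<close>

lemma slack_ge_dual:
  assumes S: "saddle_point m l n f A b xs lams" and k: "k \<ge> 0"
  shows "Dk k * (vnorm (lam (k + 1) - lams))\<^sup>2 / \<gamma> \<le> Uk xs lams k - Lk k"
proof -
  let ?p = "lam k - t k \<cdot>\<^sub>v res (xt k) - lams" and ?q = "c k \<cdot>\<^sub>v res (xbr (k - 1))"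
  have p: "?p \<in> carrier_vec l" and q: "?q \<in> carrier_vec l"
    using lam_carrier[OF k] saddle_feasible(2)[OF S] res_carrier by auto
  have "\<sigma>'' * (vnorm ?p)\<^sup>2 \<le> \<sigma>' * (vnorm (?p - ?q))\<^sup>2 + (vnorm ?q)\<^sup>2"
    unfolding sigma''_eq by (rule parallel_sum_bound[OF p q sigma'_nonneg])
  from mult_left_mono[OF this, of "yk k"] yk_pos[of k] k
  have "\<sigma>'' * yk k * (vnorm ?p)\<^sup>2 \<le> yk k * (\<sigma>' * (vnorm (?p - ?q))\<^sup>2) + yk k * (vnorm ?q)\<^sup>2"
    by (simp add: algebra_simps)
  then show ?thesis using slack_bound[OF S k] extrapolation_weight[OF k] by linarith
qed

lemma slack_nonneg:
  assumes S: "saddle_point m l n f A b xs lams" and k: "k \<ge> 0"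
  shows "Lk k \<le> Uk xs lams k"
proof -
  have "0 \<le> Dk k * (vnorm (lam (k + 1) - lams))\<^sup>2 / \<gamma>" using Dk_nonneg[OF k] gamma by simp
  then show ?thesis using slack_ge_dual[OF S k] by simp
qed

text \<open>The other reading of \<open>slack_bound\<close>: the residual term is kept and the
  gradient and \<open>Dk\<close> terms are dropped. The negative term in |p|^2 then stays and is
  summed by means of \<open>slack_ge_dual\<close>.\<close>

lemma slack_ge_residual:
  assumes S: "saddle_point m l n f A b xs lams" and k: "k \<ge> 0"
  shows "(1 - \<gamma>) * B * ((yk k - 1) * (vnorm (res (xbr (k - 1))))\<^sup>2)
      - \<sigma>'' * yk k * (vnorm (lam k - t k \<cdot>\<^sub>v res (xt k) - lams))\<^sup>2 \<le> Uk xs lams k - Lk k"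
proof -
  have "0 \<le> Dk k * (vnorm (lam (k + 1) - lams))\<^sup>2 / \<gamma>" using Dk_nonneg[OF k] gamma by simp
  moreover have "0 \<le> yk k * (\<sigma>' * z\<^sup>2)" for z using yk_pos[of k] k sigma'_nonneg by simp
  ultimately show ?thesis using slack_bound[OF S k] by (smt (verit))
qed

text \<open>The update solved for p: \<gamma> p is the new distance vector minus 1 - \<gamma> times
  the old one. It bounds |p|^2 by quantities that \<open>slack_ge_dual\<close> controls.\<close>

lemma multiplier_split:
  assumes k: "k \<ge> 0" and lams: "lams \<in> carrier_vec l"
  shows "(vnorm (lam k - t k \<cdot>\<^sub>v res (xt k) - lams))\<^sup>2
    \<le> 2 / \<gamma>\<^sup>2 * ((vnorm (lam (k + 1) - lams))\<^sup>2 + (vnorm (lam k - lams))\<^sup>2)"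
proof -
  let ?p = "lam k - t k \<cdot>\<^sub>v res (xt k) - lams"
  let ?x = "lam (k + 1) - lams" and ?y = "lam k - lams"
  have x: "?x \<in> carrier_vec l" and y: "?y \<in> carrier_vec l"
    using lam_carrier[of "k + 1"] lam_carrier[OF k] k lams by auto
  have "?p = (1 / \<gamma>) \<cdot>\<^sub>v ?x + (- ((1 - \<gamma>) / \<gamma>)) \<cdot>\<^sub>v ?y"
    unfolding step(7)[OF k] using lam_carrier[OF k] lams carrier_vecD[OF res_carrier] gamma
    by (intro eq_vecI) (auto simp: field_simps)
  then have "(vnorm ?p)\<^sup>2 = (1 / \<gamma>)\<^sup>2 * (vnorm ?x)\<^sup>2 + 2 * (1 / \<gamma>) * (- ((1 - \<gamma>) / \<gamma>)) * (?x \<bullet> ?y)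
      + (- ((1 - \<gamma>) / \<gamma>))\<^sup>2 * (vnorm ?y)\<^sup>2" using vnorm_sq_add[OF x y] by simp
  also have "\<dots> = 1 / \<gamma>\<^sup>2 * ((vnorm ?x)\<^sup>2 - 2 * (1 - \<gamma>) * (?x \<bullet> ?y) + (1 - \<gamma>)\<^sup>2 * (vnorm ?y)\<^sup>2)"
    using gamma by (simp add: power2_eq_square field_simps)
  also have "\<dots> \<le> 1 / \<gamma>\<^sup>2 * (2 * ((vnorm ?x)\<^sup>2 + (vnorm ?y)\<^sup>2))"
  proof (rule mult_left_mono)
    \<comment> \<open>The parallelogram trick: adding this square removes the inner product from the
      square with the opposite sign.\<close>
    have "0 \<le> (vnorm (1 \<cdot>\<^sub>v ?x + (1 - \<gamma>) \<cdot>\<^sub>v ?y))\<^sup>2" by simp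
    also have "\<dots> = (vnorm ?x)\<^sup>2 + 2 * (1 - \<gamma>) * (?x \<bullet> ?y) + (1 - \<gamma>)\<^sup>2 * (vnorm ?y)\<^sup>2"
      unfolding vnorm_sq_add[OF x y] by simp
    finally have 1: "0 \<le> (vnorm ?x)\<^sup>2 + 2 * (1 - \<gamma>) * (?x \<bullet> ?y) + (1 - \<gamma>)\<^sup>2 * (vnorm ?y)\<^sup>2" .
    have "(1 - \<gamma>)\<^sup>2 \<le> 1" using gamma by (simp add: power_le_one)
    then have 2: "(1 - \<gamma>)\<^sup>2 * (vnorm ?y)\<^sup>2 \<le> 1 * (vnorm ?y)\<^sup>2" by (rule mult_right_mono) simp
    from 1 2 show "(vnorm ?x)\<^sup>2 - 2 * (1 - \<gamma>) * (?x \<bullet> ?y) + (1 - \<gamma>)\<^sup>2 * (vnorm ?y)\<^sup>2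
        \<le> 2 * ((vnorm ?x)\<^sup>2 + (vnorm ?y)\<^sup>2)" by (smt (verit))
  qed (use gamma in simp)
  finally show ?thesis by simp
qed

section \<open>The energy at a saddle point and the construction of the potential\<close>

text \<open>The primal part has index k - 1 and the metric part index k: these are the data from
  which iteration k starts. The factor 2 is the one on the right hand side of
  \<open>telescope\<close>.\<close>

definition energy where
  "energy xs lams k = 2 * (yk (k - 1))\<^sup>2 * (objective m f (xbr (k - 1)) - objective m f xs - lams \<bullet> res (xbr (k - 1)))
    + (1 - \<gamma>) * B * (yk (k - 1))\<^sup>2 * (vnorm (res (xbr (k - 1))))\<^sup>2
    + sqnorm_wrt (H0 k) (v k - v_vec m l A xs lams)"

lemma energy_nonneg:
  assumes S: "saddle_point m l n f A b xs lams" and k: "k \<ge> 0"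
  shows "0 \<le> energy xs lams k"
proof -
  note xs = saddle_feasible(1)[OF S] and lams = saddle_feasible(2)[OF S]
  have xb: "xbr (k - 1) \<in> block_space m n" using xbr_mem k by simp
  have "0 \<le> objective m f (xbr (k - 1)) - objective m f xs - lams \<bullet> res (xbr (k - 1))"
    using saddle_lagrangian_gap[OF S xb] by simp
  moreover have "0 \<le> 1 / (B * (\<tau> k)\<^sup>2) + \<sigma>'' * (1 - \<gamma>) / \<tau> k"
    using B sigma''_nonneg gamma tau_pos[OF k] by simp
  then have "0 \<le> sqnorm_wrt (H0 k) (v k - v_vec m l A xs lams)"
    unfolding sqnorm_H0_v[OF xba_mem[OF k] xs lam_carrier[OF k] lams] using B gamma by simp
  ultimately show ?thesis unfolding energy_def using B gamma by simp
qed

text \<open>Everything telescopes through y r = (y - 1) r0 + rt. Paired with \<open>lams\<close> it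
  turns the F-part into a difference of weighted residual terms; squared, it gives the cross term (y
  - 1) rt r0 of the extrapolation, and what remains besides the difference of the weighted norms is
  \<open>Lk\<close>.\<close>

lemma energy_decrease:
  assumes S: "saddle_point m l n f A b xs lams" and k: "k \<ge> 0"
  shows "Uk xs lams k - Lk k \<le> energy xs lams k - energy xs lams (k + 1)"
proof -
  note xs = saddle_feasible(1)[OF S] and lams = saddle_feasible(2)[OF S]
  let ?v' = "v_vec m l A xs lams"
  define W where "W = (?v' - vt k) \<bullet> (Q_mat m l (t k) *\<^sub>v (v k - vt k))"
  define Z where "Z = 1 / L * sqnorm_wrt (1\<^sub>m (n m)) (gradient (n m) (f m) (xbr k m) - gradient (n m) (f m) (xs m))"
  define y where "y = yk k"
  define y0 where "y0 = yk (k - 1)"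
  define r where "r = res (xbr k)"
  define r0 where "r0 = res (xbr (k - 1))"
  define rt where "rt = res (xt k)"
  define S1 where "S1 = sqnorm_wrt (H0 (k + 1)) (v (k + 1) - ?v')"
  define S0 where "S0 = sqnorm_wrt (H0 k) (v k - ?v')"
  define F where "F = objective m f xs"
  define F1 where "F1 = objective m f (xbr k)"
  define F0 where "F0 = objective m f (xbr (k - 1))"
  have rc: "r \<in> carrier_vec l" "r0 \<in> carrier_vec l" "rt \<in> carrier_vec l"
    by (simp_all add: r_def r0_def rt_def res_carrier)
  have tau: "0 < \<tau> k" "\<tau> k < 1" using tau_pos tau_lt_1 k by auto
  have yy: "y\<^sup>2 = y0\<^sup>2 + y" unfolding y_def y0_def by (rule yk_rec[OF k])
  have U: "Uk xs lams k = y * (2 * W + Z) - (S1 - S0)"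
  proof -
    have "sqnorm_wrt (Hk k) (v (k + 1) - ?v') - sqnorm_wrt (Hk k) (v k - ?v') + sqnorm_wrt (Gk k) (v k - vt k) = 2 * W"
      unfolding W_def by (rule telescope[OF k t_pos[OF k] v_vec_carrier[OF lams]])
    then have "sqnorm_wrt (Hk k) (v (k + 1) - ?v') + Z - sqnorm_wrt (Hk k) (v k - ?v') + sqnorm_wrt (Gk k) (v k - vt k) = 2 * W + Z"
      by linarith
    then show ?thesis unfolding Uk_def Z_def[symmetric] S1_def[symmetric] S0_def[symmetric] y_def yk_def by simp
  qed
  have cy: "(1 - \<gamma>) * (1 - \<tau> k) * \<beta> k / \<tau> k = (1 - \<gamma>) * B * (y - 1)"
    unfolding betaB[OF k] y_def yk_def using tau by (simp add: field_simps)
  have "y * (W + Z / 2) \<le> y\<^sup>2 * (F - F1) - y0\<^sup>2 * (F - F0) + y * (lams \<bullet> rt) + (1 - \<gamma>) * B * (y - 1) * (- (rt \<bullet> r0))"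
    using smooth_descent[OF k xs lams]
    unfolding cy saddle_inner(1)[OF S k res_carrier] saddle_inner(2)[OF S k]
    unfolding W_def[symmetric] F_def[symmetric] F1_def[symmetric] F0_def[symmetric] r0_def[symmetric] rt_def[symmetric]
    by (simp add: Z_def y_def y0_def yk_def power_divide)
  then have 1: "y * (2 * W + Z) \<le> 2 * (y\<^sup>2 * (F - F1)) - 2 * (y0\<^sup>2 * (F - F0)) + 2 * (y * (lams \<bullet> rt))
      - (1 - \<gamma>) * B * (2 * (y - 1) * (rt \<bullet> r0))"
    by (simp add: algebra_simps)
  have rec: "y \<cdot>\<^sub>v r = (y - 1) \<cdot>\<^sub>v r0 + 1 \<cdot>\<^sub>v rt"
  proof -
    have "y * (1 - \<tau> k) = y - 1" "y * \<tau> k = 1"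
      using tau by (simp_all add: y_def yk_def field_simps)
    then show ?thesis
      unfolding r_def r0_def rt_def res_recursion[OF k tau(1)] using carrier_vecD[OF res_carrier]
      by (intro eq_vecI) (auto simp: distrib_left mult.assoc[symmetric])
  qed
  have ylr: "y * (lams \<bullet> rt) = y\<^sup>2 * (lams \<bullet> r) - y0\<^sup>2 * (lams \<bullet> r0)"
  proof -
    have "y * (lams \<bullet> r) = (y - 1) * (lams \<bullet> r0) + lams \<bullet> rt"
      using arg_cong[OF rec, of "\<lambda>z. lams \<bullet> z"] rc lams by (simp add: ip_simps)
    then have "y * (y * (lams \<bullet> r)) = y * ((y - 1) * (lams \<bullet> r0) + lams \<bullet> rt)" by simp
    moreover have "y * (y - 1) = y0\<^sup>2" using yy by (simp add: power2_eq_square algebra_simps)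
    ultimately show ?thesis by (simp add: power2_eq_square distrib_left mult.assoc[symmetric])
  qed
  have ynr: "y\<^sup>2 * (vnorm r)\<^sup>2 = (y - 1)\<^sup>2 * (vnorm r0)\<^sup>2 + 2 * (y - 1) * (rt \<bullet> r0) + (vnorm rt)\<^sup>2"
  proof -
    have "(vnorm (y \<cdot>\<^sub>v r))\<^sup>2 = (y - 1)\<^sup>2 * (vnorm r0)\<^sup>2 + 2 * (y - 1) * (rt \<bullet> r0) + (vnorm rt)\<^sup>2"
      unfolding rec vnorm_sq_add[OF rc(2,3)] by (simp add: comm_scalar_prod[OF rc(2,3)])
    then show ?thesis by (simp add: vnorm_smult power_mult_distrib)
  qed
  have Lk: "Lk k = (1 - \<gamma>) * B * ((vnorm rt)\<^sup>2 - (y - 1) * (vnorm r0)\<^sup>2)"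
    unfolding y_def r0_def rt_def by (rule Lk_eq[OF k])
  have E0: "energy xs lams k = 2 * (y0\<^sup>2 * (F0 - F - lams \<bullet> r0)) + (1 - \<gamma>) * B * (y0\<^sup>2 * (vnorm r0)\<^sup>2) + S0"
    unfolding energy_def F_def F0_def r0_def S0_def y0_def by (simp add: mult.assoc)
  have E1: "energy xs lams (k + 1) = 2 * (y\<^sup>2 * (F1 - F - lams \<bullet> r)) + (1 - \<gamma>) * B * (y\<^sup>2 * (vnorm r)\<^sup>2) + S1"
    unfolding energy_def F_def F1_def r_def S1_def y_def by (simp add: mult.assoc)
  define g where "g = (1 - \<gamma>) * B"
  \<comment> \<open>With y0^2 = y^2 - y one has (y - 1)^2 = y0^2 - (y - 1), so the expanded square
    differs from the old weighted norm by the negative part of \<open>Lk\<close>.\<close>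
  have "g * (y0\<^sup>2 * (vnorm r0)\<^sup>2) - g * (y\<^sup>2 * (vnorm r)\<^sup>2)
      = - g * (2 * (y - 1) * (rt \<bullet> r0)) - g * ((vnorm rt)\<^sup>2 - (y - 1) * (vnorm r0)\<^sup>2)"
  proof -
    have y0: "y0\<^sup>2 = y\<^sup>2 - y" using yy by simp
    show ?thesis unfolding ynr y0 by (simp add: power2_eq_square algebra_simps)
  qed
  then show ?thesis
    unfolding U Lk E0 E1 g_def[symmetric] using 1[folded g_def] unfolding ylr by (simp add: algebra_simps)
qed

lemma saddle_residuals_bounded:
  assumes S: "saddle_point m l n f A b xs lams"
  shows "\<exists>C. \<forall>N. (\<Sum>i<N. (1 - \<gamma>) * B * ((yk (int i) - 1) * (vnorm (res (xbr (int i - 1))))\<^sup>2)) \<le> C"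
proof (rule weighted_residuals_bounded[where B = B and \<gamma> = \<gamma> and \<sigma> = "\<sigma>''"
      and X = "\<lambda>i. Uk xs lams (int i) - Lk (int i)" and En = "\<lambda>i. energy xs lams (int i)"
      and y = "\<lambda>i. yk (int i)" and D = "\<lambda>i. Dk (int i)"
      and m = "\<lambda>i. (vnorm (lam (int i) - lams))\<^sup>2"
      and P = "\<lambda>i. (vnorm (lam (int i) - t (int i) \<cdot>\<^sub>v res (xt (int i)) - lams))\<^sup>2"])
  show "0 < B" "0 < \<gamma>" "0 \<le> \<sigma>''" using B gamma sigma''_nonneg by auto
  have Suc: "int (Suc i) = int i + 1" for i by simp
  fix i :: nat
  show "0 \<le> energy xs lams (int i)" by (rule energy_nonneg[OF S]) simp
  show "Uk xs lams (int i) - Lk (int i) \<le> energy xs lams (int i) - energy xs lams (int (Suc i))"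
    unfolding Suc by (rule energy_decrease[OF S]) simp
  show "0 < yk (int i)" by (rule yk_pos) simp
  show "(yk (int (Suc i)))\<^sup>2 = (yk (int i))\<^sup>2 + yk (int (Suc i))"
    using yk_rec[of "int (Suc i)"] by simp
  show "Dk (int i) = (yk (int i))\<^sup>2 / B + \<sigma>'' * yk (int i)
      - ((yk (int (Suc i)))\<^sup>2 / B + \<sigma>'' * (1 - \<gamma>) * yk (int (Suc i)))"
    unfolding Suc by (rule Dk_def)
  show "0 \<le> Dk (int 0)" by (rule Dk_nonneg) simp
  show "Dk (int i) * (vnorm (lam (int (Suc i)) - lams))\<^sup>2 / \<gamma> \<le> Uk xs lams (int i) - Lk (int i)"
    unfolding Suc by (rule slack_ge_dual[OF S]) simp
  show "(1 - \<gamma>) * B * ((yk (int i) - 1) * (vnorm (res (xbr (int i - 1))))\<^sup>2)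
      - \<sigma>'' * yk (int i) * (vnorm (lam (int i) - t (int i) \<cdot>\<^sub>v res (xt (int i)) - lams))\<^sup>2
      \<le> Uk xs lams (int i) - Lk (int i)"
    by (rule slack_ge_residual[OF S]) simp
  show "(vnorm (lam (int i) - t (int i) \<cdot>\<^sub>v res (xt (int i)) - lams))\<^sup>2
      \<le> 2 / \<gamma>\<^sup>2 * ((vnorm (lam (int (Suc i)) - lams))\<^sup>2 + (vnorm (lam (int i) - lams))\<^sup>2)"
    unfolding Suc by (rule multiplier_split) (use saddle_feasible(2)[OF S] in simp_all)
  show "0 \<le> (vnorm (lam (int i) - lams))\<^sup>2" by simp
  show "0 \<le> (1 - \<gamma>) * B * ((yk (int i) - 1) * (vnorm (res (xbr (int i - 1))))\<^sup>2)"
    using gamma B yk_ge_1[of "int i"] by simp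
qed

text \<open>The increments may not depend on the saddle point; without saddle points only the lower bound matters.\<close>

lemma potential_exists:
  "\<exists>\<Theta> :: int \<Rightarrow> real. \<forall>k\<ge>0. 0 \<le> \<Theta> k \<and> Lk k \<le> \<Theta> (k + 1) - \<Theta> k \<and>
    (\<forall>xs lams. saddle_point m l n f A b xs lams \<longrightarrow> \<Theta> (k + 1) - \<Theta> k \<le> Uk xs lams k)"
proof (cases "\<exists>xs lams. saddle_point m l n f A b xs lams")
  case True
  then obtain xs lams where S: "saddle_point m l n f A b xs lams" by blast
  obtain C where C: "\<And>N. (\<Sum>i<N. (1 - \<gamma>) * B * ((yk (int i) - 1) * (vnorm (res (xbr (int i - 1))))\<^sup>2)) \<le> C"
    using saddle_residuals_bounded[OF S] by blast
  \<comment> \<open>The start value C bounds all partial sums of the negative parts of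
    \<open>Lk\<close>, which makes every T k nonnegative; the increments are untouched by
    it.\<close>
  define T where "T = (\<lambda>k. C + (\<Sum>i<nat k. Lk (int i)))"
  have "0 \<le> T k" for k
  proof -
    have "- (\<Sum>i<nat k. (1 - \<gamma>) * B * ((yk (int i) - 1) * (vnorm (res (xbr (int i - 1))))\<^sup>2)) \<le> (\<Sum>i<nat k. Lk (int i))"
      unfolding sum_negf[symmetric]
    proof (rule sum_mono)
      fix i
      have "0 \<le> (1 - \<gamma>) * B * (vnorm (res (xt (int i))))\<^sup>2" using gamma B by simp
      then show "- ((1 - \<gamma>) * B * ((yk (int i) - 1) * (vnorm (res (xbr (int i - 1))))\<^sup>2)) \<le> Lk (int i)"
        using Lk_eq[of "int i"] by (simp add: right_diff_distrib)
    qed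
    then show ?thesis using C[of "nat k"] by (simp add: T_def)
  qed
  moreover have "T (k + 1) - T k = Lk k" if "k \<ge> 0" for k
    using sum_nat_step[OF that, of Lk] by (simp add: T_def)
  ultimately show ?thesis using slack_nonneg by (intro exI[of _ T]) auto
next
  case False
  \<comment> \<open>The bound at saddle points is vacuous here, so the increments may be enlarged to
    absolute values to secure the sign.\<close>
  define T where "T = (\<lambda>k. \<Sum>i<nat k. \<bar>Lk (int i)\<bar>)"
  have "0 \<le> T k" for k unfolding T_def by (intro sum_nonneg) auto
  moreover have "T (k + 1) - T k = \<bar>Lk k\<bar>" if "k \<ge> 0" for k
    using sum_nat_step[OF that, of "\<lambda>k. \<bar>Lk k\<bar>"] by (simp add: T_def)
  ultimately show ?thesis using False by (intro exI[of _ T]) auto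
qed

lemma smooth_metric:
  "\<exists>(H :: int \<Rightarrow> real mat) (\<Theta> :: int \<Rightarrow> real).
           (\<forall>k\<ge>0. H k \<in> carrier_mat ((m - 1) * l + l) ((m - 1) * l + l) \<and>
              Q_mat m l (t k) = H k * M_mat m l \<gamma> (t k)) \<and>
           (\<forall>k\<ge>0. \<Theta> k \<ge> 0 \<and>
              \<Theta> (k + 1) - \<Theta> k \<ge> (1 - \<gamma>) * \<beta> k *
                ((vnorm (res (xt k)))\<^sup>2
                 - \<tau> k / (\<tau> (k - 1))\<^sup>2 * (vnorm (res (xbr (k - 1))))\<^sup>2)) \<and>
           (\<forall>k\<ge>0. \<forall>xs lams. saddle_point m l n f A b xs lams \<longrightarrow>
              (let v' = v_vec m l A xs lams; z' = gradient (n m) (f m) (xs m);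
                   G = G_mat (Q_mat m l (t k)) (M_mat m l \<gamma> (t k)) (H k);
                   H0 = (\<lambda>k::int. H0_mat m l \<gamma> B
                           (1 / (B * (\<tau> k)\<^sup>2) + \<sigma>'' * (1 - \<gamma>) / \<tau> k)) in
               1 / \<tau> k *
                 (sqnorm_wrt (H k) (v (k + 1) - v')
                  + 1 / L * sqnorm_wrt (1\<^sub>m (n m)) (gradient (n m) (f m) (xbr k m) - z')
                  - sqnorm_wrt (H k) (v k - v')
                  + sqnorm_wrt G (v k - vt k))
               \<ge> sqnorm_wrt (H0 (k + 1)) (v (k + 1) - v') - sqnorm_wrt (H0 k) (v k - v')
                 + \<Theta> (k + 1) - \<Theta> k))"
proof -
  obtain T :: "int \<Rightarrow> real" where T: "\<And>k. k \<ge> 0 \<Longrightarrow> 0 \<le> T k" "\<And>k. k \<ge> 0 \<Longrightarrow> Lk k \<le> T (k + 1) - T k"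
    "\<And>k xs lams. k \<ge> 0 \<Longrightarrow> saddle_point m l n f A b xs lams \<Longrightarrow> T (k + 1) - T k \<le> Uk xs lams k"
    using potential_exists by blast
  show ?thesis
  proof (intro exI[of _ "\<lambda>k. Hk k"] exI[of _ T] conjI allI impI)
    fix k :: int assume k: "k \<ge> 0"
    show "Hk k \<in> carrier_mat ((m - 1) * l + l) ((m - 1) * l + l)" by (rule H0_mat_carrier)
    show "Q_mat m l (t k) = Hk k * M_mat m l \<gamma> (t k)"
      by (rule Q_eq_H_M[OF t_pos[OF k]]) (use gamma in simp)
    show "0 \<le> T k" by (rule T(1)[OF k])
    show "(1 - \<gamma>) * \<beta> k * ((vnorm (res (xt k)))\<^sup>2
        - \<tau> k / (\<tau> (k - 1))\<^sup>2 * (vnorm (res (xbr (k - 1))))\<^sup>2) \<le> T (k + 1) - T k"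
      using T(2)[OF k] unfolding Lk_def .
    fix xs lams assume S: "saddle_point m l n f A b xs lams"
    have reorder: "S1 - S0 + a - c \<le> u" if "a - c \<le> u - (S1 - S0)" for S1 S0 a c u :: real
      using that by linarith
    show "let v' = v_vec m l A xs lams; z' = gradient (n m) (f m) (xs m); G = Gk k;
        H0 = (\<lambda>k::int. H0_mat m l \<gamma> B (1 / (B * (\<tau> k)\<^sup>2) + \<sigma>'' * (1 - \<gamma>) / \<tau> k)) in
      1 / \<tau> k * (sqnorm_wrt (Hk k) (v (k + 1) - v')
          + 1 / L * sqnorm_wrt (1\<^sub>m (n m)) (gradient (n m) (f m) (xbr k m) - z')
          - sqnorm_wrt (Hk k) (v k - v') + sqnorm_wrt G (v k - vt k))
       \<ge> sqnorm_wrt (H0 (k + 1)) (v (k + 1) - v') - sqnorm_wrt (H0 k) (v k - v') + T (k + 1) - T k"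
      unfolding Let_def by (rule reorder) (use T(3)[OF k S] in \<open>unfold Uk_def\<close>)
  qed
qed

end

text \<open>In both parts \<open>H\<close> and \<open>\<Theta>\<close> are chosen before the
  iteration index and the comparison point, so one pair of sequences serves all feasible points,
  respectively all saddle points.\<close>

theorem theorem5p6:
  fixes m l :: nat and n :: "nat \<Rightarrow> nat"
    and f :: "nat \<Rightarrow> real vec \<Rightarrow> real" and A :: "nat \<Rightarrow> real mat" and b :: "real vec"
    and \<gamma> :: real and \<tau> \<beta> :: "int \<Rightarrow> real"
    and xbr xt xba :: "int \<Rightarrow> blocks"
    and lam lamt v vt :: "int \<Rightarrow> real vec"
    and ut :: "int \<Rightarrow> primal_dual"
    and Q M :: "int \<Rightarrow> real mat"
  assumes problem: "problem_P3 m l n f A b"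
    and gamma: "0 < \<gamma>" "\<gamma> \<le> 1"
    and algorithm: "algorithm4 m l n f A b \<gamma> \<tau> \<beta> xbr xt xba lam"
    and lamt: "\<And>k. lamt k =
          lam k - (\<tau> k * \<beta> k) \<cdot>\<^sub>v (A 1 *\<^sub>v xt k 1 + A_sum l A {2..m} (xba k) - b)"
    and ut: "\<And>k. ut k = (xt k, lamt k)"
    and v: "\<And>k. v k = v_vec m l A (xba k) (lam k)"
    and vt: "\<And>k. vt k = v_vec m l A (xt k) (lamt k)"
    and Q: "\<And>k. Q k = Q_mat m l (\<tau> k * \<beta> k)"
    and M: "\<And>k. M k = M_mat m l \<gamma> (\<tau> k * \<beta> k)"
  shows
    "(\<forall>B::real. B > 0 \<and> 0 < \<tau> (- 1) \<and> \<tau> (- 1) < 1 \<and>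
        (\<forall>k\<ge>0. \<beta> k = B / \<tau> k \<and> 1 / \<tau> (k - 1) = (1 - \<tau> k) / \<tau> k) \<longrightarrow>
        (\<forall>k\<ge>0. \<forall>x\<in>block_space m n. \<forall>lam'\<in>carrier_vec l.
           1 / \<tau> k * (objective m f x - objective m f (xbr k))
           - 1 / \<tau> (k - 1) * (objective m f x - objective m f (xbr (k - 1)))
           + u_inner m (u_diff (x, lam') (ut k)) (F_op m l A b (ut k))
           + (1 - \<gamma>) * (1 - \<tau> k) * \<beta> k *
               (A_op m l A (\<lambda>i. x i - xt k i) \<bullet> residual m l A b (xbr (k - 1)))
           \<ge> (v_vec m l A x lam' - vt k) \<bullet> (Q k *\<^sub>v (v k - vt k))) \<and>
        (\<forall>k\<ge>0. v (k + 1) = v k - M k *\<^sub>v (v k - vt k)) \<and>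
        (\<exists>(H :: int \<Rightarrow> real mat) (\<Theta> :: int \<Rightarrow> real).
           (\<forall>k\<ge>0. H k \<in> carrier_mat ((m - 1) * l + l) ((m - 1) * l + l) \<and> Q k = H k * M k) \<and>
           (\<forall>k\<ge>0. \<Theta> k \<ge> 0 \<and>
              \<Theta> (k + 1) - \<Theta> k \<ge> (1 - \<gamma>) * \<tau> k * \<beta> k * (vnorm (residual m l A b (xt k)))\<^sup>2) \<and>
           (\<forall>k\<ge>0. \<forall>x'\<in>feasible_set m l n A b. \<forall>lam'\<in>carrier_vec l.
              (let v' = v_vec m l A x' lam'; G = G_mat (Q k) (M k) (H k);
                   H0 = (\<lambda>k::int. H0_mat m l \<gamma> B (1 / B)) in
               sqnorm_wrt (H k) (v (k + 1) - v') - sqnorm_wrt (H k) (v k - v')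
                 + sqnorm_wrt G (v k - vt k)
               \<ge> sqnorm_wrt (H0 (k + 1)) (v (k + 1) - v') - sqnorm_wrt (H0 k) (v k - v')
                 + \<Theta> (k + 1) - \<Theta> k))))
     \<and>
     (\<forall>(L::real) (B::real) (\<sigma>'::real) (\<sigma>''::real) (\<sigma>::real).
        gradient_Lipschitz (n m) (f m) L \<and> B > 0 \<and> (\<forall>k\<ge>0. \<beta> k = B) \<and> (1 - \<gamma>) * B \<le> 1 \<and>
        0 < \<tau> (- 1) \<and> \<tau> (- 1) < 1 \<and>
        (\<forall>k\<ge>0. \<tau> k > 0 \<and> 1 / (\<tau> (k - 1))\<^sup>2 = (1 - \<tau> k) / (\<tau> k)\<^sup>2) \<and>
        \<sigma>' = sigma_min (A m * transpose_mat (A m)) / L \<and>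
        \<sigma>'' = \<sigma>' - \<sigma>'\<^sup>2 / (\<sigma>' + 1) \<and>
        \<sigma> = 1 / L \<and>
        (\<forall>k\<ge>0. 1 / (B * (\<tau> k)\<^sup>2) + \<sigma>'' / \<tau> k
                \<ge> 1 / (B * (\<tau> (k + 1))\<^sup>2) + \<sigma>'' * (1 - \<gamma>) / \<tau> (k + 1)) \<longrightarrow>
        (\<forall>k\<ge>0. \<forall>x\<in>block_space m n. \<forall>lam'\<in>carrier_vec l.
           1 / (\<tau> k)\<^sup>2 * (objective m f x - objective m f (xbr k))
           - 1 / (\<tau> (k - 1))\<^sup>2 * (objective m f x - objective m f (xbr (k - 1)))
           + 1 / \<tau> k * u_inner m (u_diff (x, lam') (ut k)) (F_op m l A b (ut k))
           + (1 - \<gamma>) * (1 - \<tau> k) * \<beta> k / \<tau> k *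
               (A_op m l A (\<lambda>i. x i - xt k i) \<bullet> residual m l A b (xbr (k - 1)))
           \<ge> 1 / \<tau> k *
               ((v_vec m l A x lam' - vt k) \<bullet> (Q k *\<^sub>v (v k - vt k))
                + \<sigma> / 2 * sqnorm_wrt (1\<^sub>m (n m))
                    (gradient (n m) (f m) (xbr k m) - gradient (n m) (f m) (x m)))) \<and>
        (\<forall>k\<ge>0. v (k + 1) = v k - M k *\<^sub>v (v k - vt k)) \<and>
        (\<exists>(H :: int \<Rightarrow> real mat) (\<Theta> :: int \<Rightarrow> real).
           (\<forall>k\<ge>0. H k \<in> carrier_mat ((m - 1) * l + l) ((m - 1) * l + l) \<and> Q k = H k * M k) \<and>
           (\<forall>k\<ge>0. \<Theta> k \<ge> 0 \<and>
              \<Theta> (k + 1) - \<Theta> k \<ge> (1 - \<gamma>) * \<beta> k *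
                ((vnorm (residual m l A b (xt k)))\<^sup>2
                 - \<tau> k / (\<tau> (k - 1))\<^sup>2 * (vnorm (residual m l A b (xbr (k - 1))))\<^sup>2)) \<and>
           (\<forall>k\<ge>0. \<forall>xs lams. saddle_point m l n f A b xs lams \<longrightarrow>
              (let v' = v_vec m l A xs lams; z' = gradient (n m) (f m) (xs m);
                   G = G_mat (Q k) (M k) (H k);
                   H0 = (\<lambda>k::int. H0_mat m l \<gamma> B
                           (1 / (B * (\<tau> k)\<^sup>2) + \<sigma>'' * (1 - \<gamma>) / \<tau> k)) in
               1 / \<tau> k *
                 (sqnorm_wrt (H k) (v (k + 1) - v')
                  + \<sigma> * sqnorm_wrt (1\<^sub>m (n m)) (gradient (n m) (f m) (xbr k m) - z')
                  - sqnorm_wrt (H k) (v k - v')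
                  + sqnorm_wrt G (v k - vt k))
               \<ge> sqnorm_wrt (H0 (k + 1)) (v (k + 1) - v') - sqnorm_wrt (H0 k) (v k - v')
                 + \<Theta> (k + 1) - \<Theta> k))))"
proof (rule conjI, goal_cases)
  interpret a: alg4 m l n f A b \<gamma> \<tau> \<beta> xbr xt xba lam
    using problem gamma algorithm by unfold_locales
  have lamt': "lamt k = a.lamt k" for k unfolding lamt a.lamt_def ..
  {
    case 1
    show ?case
    proof (intro allI impI, goal_cases)
      case (1 B)
      then have B: "B > 0" and tm: "0 < \<tau> (- 1)" "\<tau> (- 1) < 1" by blast+
      have par: "\<beta> k = B / \<tau> k" "1 / \<tau> (k - 1) = (1 - \<tau> k) / \<tau> k" if "k \<ge> 0" for k
        using 1 that by blast+
      have t: "0 < \<tau> k * \<beta> k" if "k \<ge> 0" for k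
        using a.inverse_tau_regime(3)[OF B tm par that] B by simp
      show ?case
        unfolding ut v vt Q M lamt'
        using a.inverse_tau_descent[OF B tm par] a.v_update[OF _ t] a.inverse_tau_metric[OF B tm par]
        by (intro conjI allI impI ballI) blast+
    qed
  next
    case 2
    show ?case
    proof (intro allI impI, goal_cases)
      case (1 L B \<sigma>' \<sigma>'' \<sigma>)
      then interpret b: alg4_smooth m l n f A b \<gamma> \<tau> \<beta> xbr xt xba lam L B \<sigma>' \<sigma>''
        by unfold_locales blast+
      have \<sigma>: "\<sigma> = 1 / L" using 1 by blast
      show ?case
        unfolding ut v vt Q M lamt' \<sigma>
        using b.smooth_descent a.v_update[OF _ b.t_pos] b.smooth_metric
        by (intro conjI allI impI ballI) blast+
    qed
  }
qed

end
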